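(* Let $m\in(0,1)$. (i) Let $\Theta\subset\mathbb R$ be a compact set with Minkowski dimension $\beta(\Theta)\in[0,1]$. If $s>\frac12-\frac m4+\frac{m\beta(\Theta)}{4}$, then there exists a constant $C>0$ such that for all $f\in H^s(\mathbb R)$ \[ \Big(\int_0^1\sup_{t\in(0,1),\ \theta\in\Theta}\big|e^{it(-\Delta)^{m/2}}f(x-\theta t)\big|^4\,dx\Big)^{1/4}\leq C\|f\|_{H^s(\mathbb R)} . \] (ii) This is sharp in the sense that there exists a compact set $\Theta\subset\mathbb R$ such that, whenever $s<\frac12-\frac m4+\frac{m\beta(\Theta)}{4}$, the inequality in (i) fails, i.e. does not hold for all $f\in H^s(\mathbb R)$ with any finite constant $C$.
   Context: $H^s(\mathbb R)$ is the inhomogeneous $L^2$-Sobolev space with norm $\|f\|_{H^s(\mathbb R)}=\|(1-\Delta)^{s/2}f\|_{L^2(\mathbb R)}$. With $\widehat f(\xi)=\int_{\mathbb R}e^{-ix\xi}f(x)\,dx$, one (formally) sets \[ e^{it(-\Delta)^{m/2}}f(x)=(2\pi)^{-1}\int_{\mathbb R}e^{i(x\xi+t|\xi|^m)}\widehat f(\xi)\,d\xi . \] For $f\in H^s(\mathbb R)$ the value at a given point $x$ and time $t$ is understood as $\lim_{N\to\infty}(2\pi)^{-1}\int_{\mathbb R}e^{i(x\xi+t|\xi|^m)}e^{-|\xi|^2/N^2}\widehat f(\xi)\,d\xi$ whenever this limit exists. *)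

theory Defs
  imports "HOL-Analysis.Analysis"
begin

section \<open>Schwartz functions and tempered distributions on the real line\<close>

definition vderiv :: "(real \<Rightarrow> complex) \<Rightarrow> real \<Rightarrow> complex" where
  "vderiv \<phi> = (\<lambda>x. vector_derivative \<phi> (at x))"

definition schwartz :: "(real \<Rightarrow> complex) set" where
  "schwartz = {\<phi>. (\<forall>n x. (vderiv ^^ n) \<phi> differentiable (at x)) \<and>
     (\<forall>j n. bdd_above (range (\<lambda>x. \<bar>x\<bar> ^ j * norm ((vderiv ^^ n) \<phi> x))))}"

definition schwartz_seminorm :: "nat \<Rightarrow> nat \<Rightarrow> (real \<Rightarrow> complex) \<Rightarrow> real" where
  "schwartz_seminorm j n \<phi> = (SUP x. \<bar>x\<bar> ^ j * norm ((vderiv ^^ n) \<phi> x))"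

text \<open>Distributions are total functions; only their values on Schwartz functions matter.\<close>

type_synonym distr = "(real \<Rightarrow> complex) \<Rightarrow> complex"

definition tempered_distribution :: "distr \<Rightarrow> bool" where
  "tempered_distribution u \<longleftrightarrow>
     (\<forall>\<phi>\<in>schwartz. \<forall>\<psi>\<in>schwartz. u (\<lambda>x. \<phi> x + \<psi> x) = u \<phi> + u \<psi>) \<and>
     (\<forall>\<phi>\<in>schwartz. \<forall>c. u (\<lambda>x. c * \<phi> x) = c * u \<phi>) \<and>
     (\<exists>C K. \<forall>\<phi>\<in>schwartz. norm (u \<phi>) \<le> C * (\<Sum>j\<le>K. \<Sum>n\<le>K. schwartz_seminorm j n \<phi>))"

definition represents :: "distr \<Rightarrow> (real \<Rightarrow> complex) \<Rightarrow> bool" where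
  "represents u h \<longleftrightarrow> h \<in> borel_measurable lborel \<and>
     (\<forall>\<phi>\<in>schwartz. integrable lborel (\<lambda>x. h x * \<phi> x) \<and> u \<phi> = (LINT x|lborel. h x * \<phi> x))"

text \<open>The representing function is determined up to a null set, which does not affect
  the integrals below.\<close>

definition distr_fun :: "distr \<Rightarrow> real \<Rightarrow> complex" where
  "distr_fun u = (SOME h. represents u h)"

section \<open>Fourier transform and Sobolev spaces\<close>

definition fourier :: "(real \<Rightarrow> complex) \<Rightarrow> real \<Rightarrow> complex" where
  "fourier \<phi> \<xi> = (LINT x|lborel. cis (- (x * \<xi>)) * \<phi> x)"

definition inv_fourier :: "(real \<Rightarrow> complex) \<Rightarrow> real \<Rightarrow> complex" where
  "inv_fourier \<phi> x = complex_of_real (1 / (2 * pi)) * (LINT \<xi>|lborel. cis (x * \<xi>) * \<phi> \<xi>)"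

definition distr_fourier :: "distr \<Rightarrow> distr" where
  "distr_fourier u = (\<lambda>\<phi>. u (fourier \<phi>))"

text \<open>The operator \<open>(1 - \<Delta>)\<close> to the power \<open>s/2\<close>, that is, the Fourier multiplier with symbol
  \<open>(1 + \<xi>\<^sup>2)\<close> to the power \<open>s/2\<close>, acting on distributions by transposition.\<close>

definition bessel_op :: "real \<Rightarrow> distr \<Rightarrow> distr" where
  "bessel_op s u =
     (\<lambda>\<phi>. u (fourier (\<lambda>\<xi>. complex_of_real ((1 + \<xi>\<^sup>2) powr (s / 2)) * inv_fourier \<phi> \<xi>)))"

definition sobolev :: "real \<Rightarrow> distr set" where
  "sobolev s = {u. tempered_distribution u \<and>
     (\<exists>h. represents (bessel_op s u) h \<and> integrable lborel (\<lambda>x. (norm (h x))\<^sup>2))}"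

definition sobolev_norm :: "real \<Rightarrow> distr \<Rightarrow> real" where
  "sobolev_norm s u = sqrt (LINT x|lborel. (norm (distr_fun (bessel_op s u) x))\<^sup>2)"

section \<open>The fractional Schroedinger evolution and its maximal function\<close>

definition evolution_reg :: "real \<Rightarrow> distr \<Rightarrow> nat \<Rightarrow> real \<Rightarrow> real \<Rightarrow> complex" where
  "evolution_reg m f N x t = complex_of_real (1 / (2 * pi)) *
     (LINT \<xi>|lborel. cis (x * \<xi> + t * \<bar>\<xi>\<bar> powr m) *
        complex_of_real (exp (- (\<bar>\<xi>\<bar>\<^sup>2 / (real N)\<^sup>2))) * distr_fun (distr_fourier f) \<xi>)"

definition evolution_defined :: "real \<Rightarrow> distr \<Rightarrow> real \<Rightarrow> real \<Rightarrow> bool" where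
  "evolution_defined m f x t \<longleftrightarrow> convergent (\<lambda>N. evolution_reg m f N x t)"

definition evolution :: "real \<Rightarrow> distr \<Rightarrow> real \<Rightarrow> real \<Rightarrow> complex" where
  "evolution m f x t = lim (\<lambda>N. evolution_reg m f N x t)"

text \<open>The supremum ranges over those parameters for which the evolution has a value.\<close>

definition maximal_fun :: "real \<Rightarrow> real set \<Rightarrow> distr \<Rightarrow> real \<Rightarrow> ennreal" where
  "maximal_fun m \<Theta> f x =
     (SUP (t, \<theta>) \<in> {(t, \<theta>). t \<in> {0<..<1} \<and> \<theta> \<in> \<Theta> \<and> evolution_defined m f (x - \<theta> * t) t}.
        ennreal (norm (evolution m f (x - \<theta> * t) t)))"

definition L4_norm :: "real set \<Rightarrow> (real \<Rightarrow> ennreal) \<Rightarrow> ennreal" where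
  "L4_norm A F = (let I = (\<integral>\<^sup>+ x \<in> A. F x ^ 4 \<partial>lborel)
     in if I = \<infinity> then \<infinity> else ennreal (enn2real I powr (1 / 4)))"

definition maximal_estimate :: "real \<Rightarrow> real set \<Rightarrow> real \<Rightarrow> real \<Rightarrow> bool" where
  "maximal_estimate m \<Theta> s C \<longleftrightarrow>
     (\<forall>f\<in>sobolev s. L4_norm {0<..<1} (maximal_fun m \<Theta> f) \<le> ennreal (C * sobolev_norm s f))"

section \<open>Minkowski dimension\<close>

definition covering_number :: "real set \<Rightarrow> real \<Rightarrow> nat" where
  "covering_number \<Theta> \<delta> = (LEAST n. \<exists>A. finite A \<and> card A = n \<and> \<Theta> \<subseteq> (\<Union>a\<in>A. {a..a + \<delta>}))"

definition upper_minkowski_dim :: "real set \<Rightarrow> ereal" where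
  "upper_minkowski_dim \<Theta> =
     Limsup (at_right 0) (\<lambda>\<delta>. ereal (ln (real (covering_number \<Theta> \<delta>)) / ln (1 / \<delta>)))"

definition lower_minkowski_dim :: "real set \<Rightarrow> ereal" where
  "lower_minkowski_dim \<Theta> =
     Liminf (at_right 0) (\<lambda>\<delta>. ereal (ln (real (covering_number \<Theta> \<delta>)) / ln (1 / \<delta>)))"

definition has_minkowski_dim :: "real set \<Rightarrow> real \<Rightarrow> bool" where
  "has_minkowski_dim \<Theta> \<beta> \<longleftrightarrow>
     lower_minkowski_dim \<Theta> = ereal \<beta> \<and> upper_minkowski_dim \<Theta> = ereal \<beta>"

end

theory Submission
  imports Defs "HOL-Probability.Probability" "HOL-Real_Asymp.Real_Asymp"
begin

text \<open>Positive part. On the Fourier side the data is square integrable with weight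
  $(1+\xi^2)^s$. Split the frequencies dyadically, $|\xi| \sim R = 2^j$, and cover $\Theta$ by
  $N \lesssim R^{m(\beta+\epsilon)}$ intervals of length $R^{-m}$; the cover costs a factor $N^{1/4}$
  in $L^4$. For one interval and one dyadic block, linearise the supremum and use $TT^*$: since
  $\theta t - \theta' t' = \theta(t-t') + O(R^{-m})$, van der Corput's lemma bounds the squared kernel
  by $R^{2-m}/(|x-y| + R^{-m})$, whose integral over $|x-y| < 1$ is $O(R^{2-m}\log R)$. By Young's
  inequality the block contributes $R^{1/2-m/4+m\beta/4+\epsilon}\|f\|_2$, and the blocks are summed
  geometrically. The Gaussian regularisation is carried along as a decreasing amplitude.

  Sharpness. For $\Theta = [0,1]$ the supremum at $x \in (0,1/2)$ sees the solution at the origin at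
  time $1/2$ (take $\theta = 2x$), so the estimate would imply the false embedding of $H^s$ into
  bounded functions for some $s < 1/2$.\<close>

subsection \<open>Schwartz functions\<close>

text \<open>The length R^-m of the covering intervals is natural: at |x - y| about R^-m the kernel
  bound reaches the trivial size R^2, so a position error of that order is invisible. In fourth
  powers a block costs N from the cover, R^(2-m) from the kernel and R^(-4s) from the data; the
  exponent m beta + 2 - m - 4s is negative exactly in the stated range, and the small losses in N
  and in the logarithm are paid from the gap. Since m < 1, the frequency derivative of tau xi^m is
  at most |tau| for xi >= 1, so the phase can be stationary only if the time difference is at least
  a multiple of |x - y|. The evolution is a limit of regularised integrals. The Gaussian width is
  therefore a third parameter of the supremum beside t and theta; dependence on all three is
  continuous on each block, so a countable dense set suffices and a maximising parameter can be
  selected measurably. The Sobolev norm is defined through distributions and an arbitrarily chosen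
  representing function. The Fourier side is reached by transposition, uniqueness of
  representatives, and a Plancherel inequality with constant 2 pi in place of the identity.\<close>

lemma schwartzI_closed:
  assumes "\<And>\<phi> x. \<phi> \<in> S \<Longrightarrow> \<phi> differentiable (at x)"
    and "\<And>\<phi>. \<phi> \<in> S \<Longrightarrow> vderiv \<phi> \<in> S"
    and "\<And>\<phi> j. \<phi> \<in> S \<Longrightarrow> \<exists>C. \<forall>x. \<bar>x\<bar> ^ j * norm (\<phi> x) \<le> C"
  shows "S \<subseteq> schwartz"
proof
  fix \<phi> assume \<phi>: "\<phi> \<in> S"
  \<comment> \<open>Iterated derivatives never have to be estimated: each application enlarges the
    family of interest to some \<open>S\<close> stable under a single \<open>vderiv\<close>.\<close>
  have S: "(vderiv ^^ n) \<phi> \<in> S" for n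
    by (induction n) (use assms(2) \<phi> in auto)
  show "\<phi> \<in> schwartz"
    unfolding schwartz_def bdd_above_def using assms(1)[OF S] assms(3)[OF S] by auto
qed

lemma schwartz_differentiable: "\<phi> \<in> schwartz \<Longrightarrow> \<phi> differentiable (at x)"
  unfolding schwartz_def using funpow_0[of vderiv \<phi>] by (metis (no_types, lifting) mem_Collect_eq)

lemma schwartz_has_vector_derivative:
  "\<phi> \<in> schwartz \<Longrightarrow> (\<phi> has_vector_derivative vderiv \<phi> x) (at x)"
  unfolding vderiv_def using schwartz_differentiable vector_derivative_works by blast

lemma schwartz_vderiv: "\<phi> \<in> schwartz \<Longrightarrow> vderiv \<phi> \<in> schwartz"
proof -
  assume \<phi>: "\<phi> \<in> schwartz"
  have "(vderiv ^^ n) (vderiv \<phi>) = (vderiv ^^ (Suc n)) \<phi>" for n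
    by (simp add: funpow_swap1)
  then show ?thesis using \<phi> unfolding schwartz_def mem_Collect_eq by presburger
qed

lemma schwartz_continuous: "\<phi> \<in> schwartz \<Longrightarrow> continuous_on A \<phi>"
  by (meson differentiable_imp_continuous_within schwartz_differentiable continuous_at_imp_continuous_on)

lemma schwartz_measurable [measurable_dest]: "\<phi> \<in> schwartz \<Longrightarrow> \<phi> \<in> borel_measurable borel"
  using schwartz_continuous by (intro borel_measurable_continuous_onI)

lemma schwartz_seminorm_bound:
  "\<phi> \<in> schwartz \<Longrightarrow> \<bar>x\<bar> ^ j * norm (\<phi> x) \<le> schwartz_seminorm j 0 \<phi>"
proof -
  assume "\<phi> \<in> schwartz"
  then have "bdd_above (range (\<lambda>x. \<bar>x\<bar> ^ j * norm ((vderiv ^^ 0) \<phi> x)))"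
    unfolding schwartz_def by fast
  then show ?thesis unfolding schwartz_seminorm_def
    using cSUP_upper[of x UNIV "\<lambda>x. \<bar>x\<bar> ^ j * norm ((vderiv ^^ 0) \<phi> x)"] by simp
qed

lemma vderiv_eqI: "(\<And>x. (\<phi> has_vector_derivative \<phi>' x) (at x)) \<Longrightarrow> vderiv \<phi> = \<phi>'"
  unfolding vderiv_def by (auto intro!: vector_derivative_at)

text \<open>Chosen to be stable under \<open>vderiv\<close>: the product rule changes
  \<open>l\<close> by one, lowers \<open>b\<close> by one, or differentiates \<open>\<psi>\<close>,
  and the results are added. Hence the three parameters and the closure under sums.\<close>

inductive_set weighted_schwartz :: "(real \<Rightarrow> complex) set" where
  base: "\<psi> \<in> schwartz \<Longrightarrow> (\<lambda>x. c * of_real (x ^ l * (1 + x\<^sup>2) powr b) * \<psi> x) \<in> weighted_schwartz"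
| add: "\<phi> \<in> weighted_schwartz \<Longrightarrow> \<psi> \<in> weighted_schwartz \<Longrightarrow> (\<lambda>x. \<phi> x + \<psi> x) \<in> weighted_schwartz"

lemma schwartz_poly_decay:
  assumes "\<phi> \<in> schwartz"
  shows "\<exists>C. \<forall>x. \<bar>x\<bar> ^ j * (1 + x\<^sup>2) ^ n * norm (\<phi> x) \<le> C"
proof (induction n arbitrary: j)
  case 0
  then show ?case using schwartz_seminorm_bound[OF assms] by auto
next
  case (Suc n)
  obtain C where C: "\<And>x. \<bar>x\<bar> ^ j * (1 + x\<^sup>2) ^ n * norm (\<phi> x) \<le> C" using Suc[of j] by auto
  obtain D where D: "\<And>x. \<bar>x\<bar> ^ (j+2) * (1 + x\<^sup>2) ^ n * norm (\<phi> x) \<le> D" using Suc[of "j+2"] by auto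
  have "\<bar>x\<bar> ^ j * (1 + x\<^sup>2) ^ Suc n * norm (\<phi> x) \<le> C + D" for x
  proof -
    have "\<bar>x\<bar> ^ j * (1 + x\<^sup>2) ^ Suc n * norm (\<phi> x) =
       \<bar>x\<bar> ^ j * (1 + x\<^sup>2) ^ n * norm (\<phi> x) + \<bar>x\<bar> ^ (j+2) * (1 + x\<^sup>2) ^ n * norm (\<phi> x)"
      by (simp add: algebra_simps power2_eq_square power_add)
    then show ?thesis using C[of x] D[of x] by linarith
  qed
  then show ?case by blast
qed

lemma weighted_schwartz_decay:
  "\<phi> \<in> weighted_schwartz \<Longrightarrow> \<exists>C. \<forall>x. \<bar>x\<bar> ^ j * norm (\<phi> x) \<le> C"
proof (induction rule: weighted_schwartz.induct)
  case (base \<psi> c l b)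
  \<comment> \<open>The base of the weight is at least 1, so the real exponent \<open>b\<close> may
    be replaced by the natural number \<open>nat \<lceil>b\<rceil>\<close>, which is 0 for negative
    \<open>b\<close>.\<close>
  obtain C where C: "\<And>x. \<bar>x\<bar> ^ (j+l) * (1 + x\<^sup>2) ^ nat \<lceil>b\<rceil> * norm (\<psi> x) \<le> C"
    using schwartz_poly_decay[OF base] by blast
  have "\<bar>x\<bar> ^ j * norm (c * of_real (x ^ l * (1 + x\<^sup>2) powr b) * \<psi> x) \<le> norm c * C" for x
  proof -
    have "(1 + x\<^sup>2) powr b \<le> (1 + x\<^sup>2) powr (real (nat \<lceil>b\<rceil>))"
      by (intro powr_mono) (auto simp: le_of_int_ceiling real_nat_ceiling_ge)
    also have "\<dots> = (1 + x\<^sup>2) ^ nat \<lceil>b\<rceil>"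
      by (rule powr_realpow) (simp add: add_pos_nonneg)
    finally have *: "(1 + x\<^sup>2) powr b \<le> (1 + x\<^sup>2) ^ nat \<lceil>b\<rceil>" .
    have "\<bar>x\<bar> ^ j * norm (c * of_real (x ^ l * (1 + x\<^sup>2) powr b) * \<psi> x)
      = norm c * (\<bar>x\<bar> ^ (j+l) * (1 + x\<^sup>2) powr b * norm (\<psi> x))"
      by (simp add: norm_mult power_abs power_add abs_mult norm_power mult_ac)
    also have "\<dots> \<le> norm c * (\<bar>x\<bar> ^ (j+l) * (1 + x\<^sup>2) ^ nat \<lceil>b\<rceil> * norm (\<psi> x))"
      using * by (intro mult_left_mono mult_right_mono) auto
    also have "\<dots> \<le> norm c * C" using C by (intro mult_left_mono) auto
    finally show ?thesis .
  qed
  then show ?case by blast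
next
  case (add \<phi> \<psi>)
  obtain C D where *: "\<And>x. \<bar>x\<bar> ^ j * norm (\<phi> x) \<le> C" "\<And>x. \<bar>x\<bar> ^ j * norm (\<psi> x) \<le> D"
    using add by blast
  have "\<bar>x\<bar> ^ j * norm (\<phi> x + \<psi> x) \<le> C + D" for x
  proof -
    have "\<bar>x\<bar> ^ j * norm (\<phi> x + \<psi> x) \<le> \<bar>x\<bar> ^ j * (norm (\<phi> x) + norm (\<psi> x))"
      by (intro mult_left_mono norm_triangle_ineq) auto
    also have "\<dots> \<le> C + D" using *[of x] by (simp add: distrib_left)
    finally show ?thesis .
  qed
  then show ?case by blast
qed

lemma weighted_schwartz_deriv:
  "\<phi> \<in> weighted_schwartz \<Longrightarrow>
    \<exists>\<phi>'\<in>weighted_schwartz. \<forall>x. (\<phi> has_vector_derivative \<phi>' x) (at x)"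
proof (induction rule: weighted_schwartz.induct)
  case (base \<psi> c l b)
  \<comment> \<open>For \<open>l = 0\<close> the truncated \<open>l - 1\<close> is 0, but the factor
    \<open>of_nat l\<close> removes that term, so no case distinction is needed.\<close>
  define \<phi>' where "\<phi>' = (\<lambda>x. (c * of_nat l * of_real (x ^ (l - 1) * (1 + x\<^sup>2) powr b) * \<psi> x
      + 2 * c * of_real b * of_real (x ^ (l + 1) * (1 + x\<^sup>2) powr (b - 1)) * \<psi> x)
      + c * of_real (x ^ l * (1 + x\<^sup>2) powr b) * vderiv \<psi> x)"
  have "\<phi>' \<in> weighted_schwartz" unfolding \<phi>'_def
    by (intro weighted_schwartz.add weighted_schwartz.base base schwartz_vderiv)
  moreover have "((\<lambda>x. c * of_real (x ^ l * (1 + x\<^sup>2) powr b) * \<psi> x) has_vector_derivative \<phi>' x) (at x)" for x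
  proof -
    have p: "1 + x\<^sup>2 > 0" by (simp add: add_pos_nonneg)
    have "((\<lambda>x. x ^ l * (1 + x\<^sup>2) powr b) has_real_derivative
       real l * x ^ (l - 1) * (1 + x\<^sup>2) powr b + x ^ l * (b * (1 + x\<^sup>2) powr (b - 1) * (2 * x))) (at x)"
      using p by (auto intro!: derivative_eq_intros simp: algebra_simps powr_diff field_simps)
    then have "((\<lambda>x. of_real (x ^ l * (1 + x\<^sup>2) powr b) :: complex) has_vector_derivative
       of_real (real l * x ^ (l - 1) * (1 + x\<^sup>2) powr b + x ^ l * (b * (1 + x\<^sup>2) powr (b - 1) * (2 * x)))) (at x)"
      by (intro has_vector_derivative_of_real) (simp add: has_real_derivative_iff_has_vector_derivative)
    from has_vector_derivative_mult[OF has_vector_derivative_mult[OF has_vector_derivative_const[of c] this]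
       schwartz_has_vector_derivative[OF base, of x]]
    show ?thesis unfolding \<phi>'_def
      by (rule back_subst[of "\<lambda>d. ((\<lambda>x. c * of_real (x ^ l * (1 + x\<^sup>2) powr b) * \<psi> x) has_vector_derivative d) (at x)"])
         (simp add: algebra_simps)
  qed
  ultimately show ?case by blast
next
  case (add \<phi> \<psi>)
  then obtain \<phi>' \<psi>' where "\<phi>' \<in> weighted_schwartz" "\<psi>' \<in> weighted_schwartz"
    "\<forall>x. (\<phi> has_vector_derivative \<phi>' x) (at x)" "\<forall>x. (\<psi> has_vector_derivative \<psi>' x) (at x)" by blast
  then show ?case
    by (intro bexI[of _ "\<lambda>x. \<phi>' x + \<psi>' x"]) (auto intro!: weighted_schwartz.add has_vector_derivative_add)
qed

lemma weighted_schwartz_subset: "weighted_schwartz \<subseteq> schwartz"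
proof (rule schwartzI_closed)
  fix \<phi> x assume "\<phi> \<in> weighted_schwartz"
  then obtain \<phi>' where \<phi>': "\<phi>' \<in> weighted_schwartz" "\<And>x. (\<phi> has_vector_derivative \<phi>' x) (at x)"
    using weighted_schwartz_deriv by blast
  show "\<phi> differentiable (at x)"
    using \<phi>'(2) differentiableI_vector by blast
  show "vderiv \<phi> \<in> weighted_schwartz"
    using \<phi>' vderiv_eqI by metis
qed (rule weighted_schwartz_decay)

text \<open>This makes \<open>bessel_op\<close> meaningful for every real order: its transposed
  multiplier sends test functions to test functions.\<close>

lemma schwartz_weight:
  "\<psi> \<in> schwartz \<Longrightarrow> (\<lambda>x. of_real ((1 + x\<^sup>2) powr b) * \<psi> x) \<in> schwartz"
  using weighted_schwartz.base[of \<psi> 1 0 b] weighted_schwartz_subset by auto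

lemma one_plus_square_neq_zero: "1 + (x::real)\<^sup>2 \<noteq> 0"
  by (metis add_pos_nonneg less_irrefl zero_le_power2 zero_less_one)

lemma schwartz_mult_monom:
  "\<psi> \<in> schwartz \<Longrightarrow> (\<lambda>x. c * of_real x ^ l * \<psi> x) \<in> schwartz"
  using weighted_schwartz.base[of \<psi> c l 0] weighted_schwartz_subset
  by (auto simp: one_plus_square_neq_zero)

lemma schwartz_cmult: "\<psi> \<in> schwartz \<Longrightarrow> (\<lambda>x. c * \<psi> x) \<in> schwartz"
  using schwartz_mult_monom[of \<psi> c 0] by auto

lemma schwartz_reflect:
  assumes "\<phi> \<in> schwartz" shows "(\<lambda>x. \<phi> (- x)) \<in> schwartz"
proof -
  \<comment> \<open>The scalar \<open>c\<close> absorbs the sign that each derivative of a reflected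
    function produces.\<close>
  define S where "S = {\<lambda>x. c * \<psi> (- x) |c \<psi>. (\<psi> :: real \<Rightarrow> complex) \<in> schwartz}"
  have d: "((\<lambda>x. c * \<psi> (- x)) has_vector_derivative (- c) * vderiv \<psi> (- x)) (at x)"
    if "\<psi> \<in> schwartz" for c \<psi> x
  proof -
    have "((\<psi> \<circ> uminus) has_vector_derivative (-1) *\<^sub>R vderiv \<psi> (- x)) (at x)"
      by (rule vector_diff_chain_at) (auto intro!: derivative_eq_intros schwartz_has_vector_derivative that)
    from has_vector_derivative_mult_right[OF this, of c] show ?thesis by (simp add: o_def)
  qed
  have "S \<subseteq> schwartz"
  proof (rule schwartzI_closed)
    fix \<phi> assume "\<phi> \<in> S"
    then obtain c \<psi> where *: "\<phi> = (\<lambda>x. c * \<psi> (- x))" "\<psi> \<in> schwartz" unfolding S_def by blast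
    show "\<phi> differentiable (at x)" for x
      using d[OF *(2)] * differentiableI_vector by blast
    have "vderiv \<phi> = (\<lambda>x. (- c) * vderiv \<psi> (- x))"
      unfolding *(1) by (rule vderiv_eqI) (rule d[OF *(2)])
    then show "vderiv \<phi> \<in> S" unfolding S_def using schwartz_vderiv[OF *(2)] by blast
    show "\<exists>C. \<forall>x. \<bar>x\<bar> ^ j * norm (\<phi> x) \<le> C" for j
    proof (intro exI allI)
      fix x
      show "\<bar>x\<bar> ^ j * norm (\<phi> x) \<le> norm c * schwartz_seminorm j 0 \<psi>"
        using mult_left_mono[OF schwartz_seminorm_bound[OF *(2), of "-x" j], of "norm c"]
        by (simp add: * norm_mult mult_ac)
    qed
  qed
  moreover have "(\<lambda>x. \<phi> (- x)) \<in> S" unfolding S_def using assms by (auto intro!: exI[of _ 1])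
  ultimately show ?thesis by blast
qed

section \<open>Integrability and boundedness of Schwartz functions\<close>

lemma integrable_inverse_one_plus_sq: "integrable lborel (\<lambda>x::real. inverse (1 + x\<^sup>2))"
  using integrable_inverse_1_plus_square by (simp add: set_integrable_def einterval_def)

lemma schwartz_norm_le:
  assumes "\<phi> \<in> schwartz"
  shows "norm (\<phi> x) \<le> (schwartz_seminorm 0 0 \<phi> + schwartz_seminorm 2 0 \<phi>) * inverse (1 + x\<^sup>2)"
proof -
  have "(1 + x\<^sup>2) * norm (\<phi> x) \<le> schwartz_seminorm 0 0 \<phi> + schwartz_seminorm 2 0 \<phi>"
    using schwartz_seminorm_bound[OF assms, of x 0] schwartz_seminorm_bound[OF assms, of x 2]
    by (simp add: algebra_simps)
  moreover have "1 + x\<^sup>2 > 0" by (simp add: add_pos_nonneg)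
  ultimately show ?thesis by (simp add: field_simps)
qed

lemma schwartz_integrable:
  assumes "\<phi> \<in> schwartz"
  shows "integrable lborel \<phi>"
proof (rule Bochner_Integration.integrable_bound)
  show "integrable lborel (\<lambda>x. (schwartz_seminorm 0 0 \<phi> + schwartz_seminorm 2 0 \<phi>) * inverse (1 + x\<^sup>2))"
    by (intro integrable_mult_right integrable_inverse_one_plus_sq)
  show "\<phi> \<in> borel_measurable lborel" using schwartz_measurable[OF assms] by simp
  show "AE x in lborel. norm (\<phi> x) \<le> norm ((schwartz_seminorm 0 0 \<phi> + schwartz_seminorm 2 0 \<phi>) * inverse (1 + x\<^sup>2))"
    using schwartz_norm_le[OF assms] by (auto intro!: AE_I2 order_trans[OF _ abs_ge_self])
qed

lemma schwartz_bounded: "\<phi> \<in> schwartz \<Longrightarrow> norm (\<phi> x) \<le> schwartz_seminorm 0 0 \<phi>"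
  using schwartz_seminorm_bound[of \<phi> x 0] by simp

text \<open>For fixed \<open>q\<close> differentiation only replaces \<open>p\<close> by
  \<open>pderiv p - p * pderiv q\<close>, and the lower bound on \<open>q\<close> gives Gaussian
  decay. The freedom in \<open>q\<close> later yields Schwartz functions that approximate indicators
  of intervals.\<close>

lemma exp_poly_schwartz:
  assumes "\<And>x::real. poly q x \<ge> x\<^sup>2"
  shows "(\<lambda>x. of_real (poly p x * exp (- poly q x))) \<in> schwartz"
proof -
  define S where "S = {\<lambda>x. complex_of_real (poly p x * exp (- poly q x)) |p. True}"
  have d: "((\<lambda>x. complex_of_real (poly p x * exp (- poly q x))) has_vector_derivative
     of_real (poly (pderiv p - p * pderiv q) x * exp (- poly q x))) (at x)" for p x
  proof -
    have "((\<lambda>x. poly p x * exp (- poly q x)) has_real_derivative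
        (poly (pderiv p - p * pderiv q) x * exp (- poly q x))) (at x)"
      by (auto intro!: derivative_eq_intros poly_DERIV simp: algebra_simps)
    then show ?thesis
      by (intro has_vector_derivative_of_real) (simp add: has_real_derivative_iff_has_vector_derivative)
  qed
  have e: "\<exists>C. \<forall>x. \<bar>x\<bar> ^ j * exp (- poly q x) \<le> C" for j
  proof -
    \<comment> \<open>A single term of the exponential series gives |x|^j <= j! e^|x|, and |x| - x^2
      <= 1 bounds what remains.\<close>
    have "\<bar>x\<bar> ^ j * exp (- poly q x) \<le> fact j * exp 1" for x
    proof -
      have "\<bar>x\<bar> ^ j / fact j \<le> (\<Sum>i\<in>{..j}. \<bar>x\<bar> ^ i / fact i)"
        by (rule member_le_sum) auto
      also have "\<dots> \<le> exp \<bar>x\<bar>"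
        unfolding exp_def using summable_exp_generic[of "\<bar>x\<bar>"]
        by (auto intro!: sum_le_suminf simp: divide_inverse mult_ac)
      finally have "\<bar>x\<bar> ^ j \<le> fact j * exp \<bar>x\<bar>" by (simp add: field_simps)
      then have "\<bar>x\<bar> ^ j * exp (- poly q x) \<le> fact j * exp \<bar>x\<bar> * exp (- poly q x)"
        by (intro mult_right_mono) auto
      also have "\<dots> = fact j * exp (\<bar>x\<bar> - poly q x)" by (simp add: exp_diff exp_minus field_simps)
      also have "\<bar>x\<bar> - poly q x \<le> 1"
      proof -
        have "0 \<le> (\<bar>x\<bar> - 1)\<^sup>2" by simp
        then have "2 * \<bar>x\<bar> \<le> x\<^sup>2 + 1" by (simp add: power2_diff)
        then show ?thesis using assms[of x] zero_le_power2[of x] by linarith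
      qed
      finally show ?thesis by simp
    qed
    then show ?thesis by blast
  qed
  have b: "\<exists>C. \<forall>x. \<bar>x\<bar> ^ j * (\<bar>poly p x\<bar> * exp (- poly q x)) \<le> C" for j p
  proof (induction p arbitrary: j)
    case 0
    then show ?case by auto
  next
    case (pCons a p)
    obtain C where C: "\<And>x. \<bar>x\<bar> ^ j * exp (- poly q x) \<le> C" using e by blast
    obtain D where D: "\<And>x. \<bar>x\<bar> ^ (Suc j) * (\<bar>poly p x\<bar> * exp (- poly q x)) \<le> D"
      using pCons.IH by blast
    have "\<bar>x\<bar> ^ j * (\<bar>poly (pCons a p) x\<bar> * exp (- poly q x)) \<le> \<bar>a\<bar> * C + D" for x
    proof -
      have "\<bar>poly (pCons a p) x\<bar> \<le> \<bar>a\<bar> + \<bar>x\<bar> * \<bar>poly p x\<bar>"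
        using abs_triangle_ineq[of a "x * poly p x"] by (simp add: abs_mult)
      then have "\<bar>x\<bar> ^ j * (\<bar>poly (pCons a p) x\<bar> * exp (- poly q x)) \<le>
         \<bar>x\<bar> ^ j * ((\<bar>a\<bar> + \<bar>x\<bar> * \<bar>poly p x\<bar>) * exp (- poly q x))"
        by (intro mult_left_mono mult_right_mono) auto
      also have "\<dots> = \<bar>a\<bar> * (\<bar>x\<bar> ^ j * exp (- poly q x)) + \<bar>x\<bar> ^ (Suc j) * (\<bar>poly p x\<bar> * exp (- poly q x))"
        by (simp add: algebra_simps)
      also have "\<dots> \<le> \<bar>a\<bar> * C + D"
        using C[of x] D[of x] by (intro add_mono mult_left_mono) auto
      finally show ?thesis .
    qed
    then show ?case by blast
  qed
  have "S \<subseteq> schwartz"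
  proof (rule schwartzI_closed)
    fix \<phi> assume "\<phi> \<in> S"
    then obtain p where *: "\<phi> = (\<lambda>x. complex_of_real (poly p x * exp (- poly q x)))" unfolding S_def by blast
    show "\<phi> differentiable (at x)" for x
      using d[of p] * differentiableI_vector by blast
    have "vderiv \<phi> = (\<lambda>x. of_real (poly (pderiv p - p * pderiv q) x * exp (- poly q x)))"
      unfolding * by (rule vderiv_eqI) (rule d)
    then show "vderiv \<phi> \<in> S" unfolding S_def by blast
    show "\<exists>C. \<forall>x. \<bar>x\<bar> ^ j * norm (\<phi> x) \<le> C" for j
      using b[of j p] unfolding * norm_of_real by (simp add: abs_mult)
  qed
  then show ?thesis unfolding S_def by blast
qed

subsection \<open>Fourier transforms of integrable functions\<close>

lemma borel_measurable_cis [measurable (raw)]: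
  "f \<in> borel_measurable M \<Longrightarrow> (\<lambda>x. cis (f x)) \<in> borel_measurable M"
  by (rule measurable_compose[of f M borel cis borel])
     (auto intro!: borel_measurable_continuous_onI continuous_intros)

lemma integrable_bounded_mult:
  fixes f k :: "'a \<Rightarrow> complex"
  assumes "integrable M f" "k \<in> borel_measurable M" "\<And>x. norm (k x) \<le> B"
  shows "integrable M (\<lambda>x. k x * f x)"
proof (rule Bochner_Integration.integrable_bound)
  show "integrable M (\<lambda>x. B * norm (f x))" using assms(1) by auto
  show "AE x in M. norm (k x * f x) \<le> norm (B * norm (f x))"
    using assms(3) by (auto intro!: AE_I2 mult_right_mono order_trans[OF _ abs_ge_self] simp: norm_mult)
qed (use assms in measurable)

text \<open>A bounded kernel against a product of two integrable functions is absolutely integrable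
  on the plane. The multiplication formula, Gaussian inversion, the Plancherel inequality and the
  \<open>TT*\<close> argument all interchange integrals through this form.\<close>

lemma fubini_kernel:
  fixes f g :: "real \<Rightarrow> complex" and k :: "real \<times> real \<Rightarrow> complex"
  assumes [simp]: "integrable lborel f" "integrable lborel g"
    and k [measurable]: "k \<in> borel_measurable (lborel \<Otimes>\<^sub>M lborel)" and k1: "\<And>z. norm (k z) \<le> B"
  shows "integrable lborel (\<lambda>x. g x * (LINT y|lborel. k (x, y) * f y))"
    and "(LINT x|lborel. g x * (LINT y|lborel. k (x, y) * f y)) = (LINT y|lborel. f y * (LINT x|lborel. k (x, y) * g x))"
proof -
  have [measurable]: "f \<in> borel_measurable borel" "g \<in> borel_measurable borel"
    using assms(1,2)[THEN borel_measurable_integrable] by auto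
  have "integrable (lborel \<Otimes>\<^sub>M lborel) (\<lambda>(x, y). g x * f y)"
  proof (rule lborel_pair.Fubini_integrable)
    show "integrable lborel (\<lambda>x. LINT y|lborel. norm (case (x, y) of (x, y) \<Rightarrow> g x * f y))"
      by (simp add: norm_mult)
  qed auto
  from integrable_bounded_mult[OF this k k1]
  have i: "integrable (lborel \<Otimes>\<^sub>M lborel) (\<lambda>(x, y). k (x, y) * (g x * f y))"
    by (simp add: case_prod_unfold)
  have eq1: "(LINT y|lborel. k (x, y) * (g x * f y)) = g x * (LINT y|lborel. k (x, y) * f y)" for x
    by (subst integral_mult_right_zero[symmetric]) (simp add: mult_ac)
  have eq2: "(LINT x|lborel. k (x, y) * (g x * f y)) = f y * (LINT x|lborel. k (x, y) * g x)" for y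
    by (subst integral_mult_right_zero[symmetric]) (simp add: mult_ac)
  show "integrable lborel (\<lambda>x. g x * (LINT y|lborel. k (x, y) * f y))"
    using lborel_pair.integrable_fst'[OF i] by (simp add: eq1)
  show "(LINT x|lborel. g x * (LINT y|lborel. k (x, y) * f y)) = (LINT y|lborel. f y * (LINT x|lborel. k (x, y) * g x))"
    using lborel_pair.Fubini_integral[OF i] by (simp add: eq1 eq2)
qed

lemma integrable_cis_mult:
  "integrable M f \<Longrightarrow> a \<in> borel_measurable M \<Longrightarrow> integrable M (\<lambda>x. cis (a x) * f x)"
  by (rule integrable_bounded_mult[where B = 1]) auto

lemma norm_fourier_le:
  assumes "integrable lborel f" shows "norm (fourier f \<xi>) \<le> (LINT x|lborel. norm (f x))"
  unfolding fourier_def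
  by (rule order_trans[OF integral_norm_bound]) (simp add: norm_mult)

lemma fourier_measurable [measurable]:
  assumes [measurable]: "f \<in> borel_measurable borel"
  shows "fourier f \<in> borel_measurable borel"
  unfolding fourier_def by measurable

lemma fourier_diff:
  assumes "integrable lborel f" "integrable lborel g"
  shows "fourier (\<lambda>x. f x - g x) \<xi> = fourier f \<xi> - fourier g \<xi>"
  unfolding fourier_def right_diff_distrib
  by (rule Bochner_Integration.integral_diff) (auto intro!: integrable_cis_mult assms)

lemma fourier_multiplication_formula:
  assumes "integrable lborel f" "integrable lborel g"
  shows "(LINT x|lborel. f x * fourier g x) = (LINT x|lborel. fourier f x * g x)"
  unfolding fourier_def
  using fubini_kernel(2)[OF assms(2,1), of "\<lambda>z. cis (- (snd z * fst z))" 1] by (simp add: mult_ac)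

lemma inv_fourier_conv_fourier:
  "inv_fourier \<phi> x = fourier (\<lambda>y. of_real (1 / (2 * pi)) * \<phi> (- y)) x"
proof -
  have "inv_fourier \<phi> x = of_real (1 / (2 * pi)) * (LINT \<xi>|lborel. cis (- (\<xi> * x)) * \<phi> (- \<xi>))"
    unfolding inv_fourier_def
    by (subst lborel_integral_real_affine[where c = "-1" and t = 0]) (auto simp: mult_ac)
  also have "\<dots> = fourier (\<lambda>y. of_real (1 / (2 * pi)) * \<phi> (- y)) x"
    unfolding fourier_def by (subst integral_mult_right_zero[symmetric]) (simp add: mult_ac)
  finally show ?thesis .
qed

subsection \<open>The Fourier transform on Schwartz functions\<close>

text \<open>The remainder of e^(-ixh) after its linear term is at most (xh)^2/2, so the difference
  quotient has an error of order |h| times the second absolute moment of \<open>\<phi>\<close>,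
  which is finite.\<close>

lemma fourier_has_vector_derivative:
  assumes "\<phi> \<in> schwartz"
  shows "(fourier \<phi> has_vector_derivative fourier (\<lambda>x. - \<i> * of_real x ^ 1 * \<phi> x) \<xi>) (at \<xi>)"
proof -
  define D where "D = fourier (\<lambda>x. - \<i> * of_real x ^ 1 * \<phi> x) \<xi>"
  have i0: "integrable lborel \<phi>" using assms schwartz_integrable by auto
  have i1: "integrable lborel (\<lambda>x. - \<i> * of_real x ^ 1 * \<phi> x)"
    by (intro schwartz_integrable schwartz_mult_monom assms)
  have i2: "integrable lborel (\<lambda>x. norm (1 * of_real x ^ 2 * \<phi> x))"
    by (intro integrable_norm schwartz_integrable schwartz_mult_monom assms)
  define B where "B = (LINT x|lborel. norm (1 * of_real x ^ 2 * \<phi> x)) / 2"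
  have B: "norm (fourier \<phi> (\<xi> + h) - fourier \<phi> \<xi> - h *\<^sub>R D) \<le> B * h\<^sup>2" for h
  proof -
    have "fourier \<phi> (\<xi> + h) - fourier \<phi> \<xi> - h *\<^sub>R D =
       (LINT x|lborel. cis (- (x * (\<xi> + h))) * \<phi> x - cis (- (x * \<xi>)) * \<phi> x
          - of_real h * (cis (- (x * \<xi>)) * (- \<i> * of_real x ^ 1 * \<phi> x)))"
    proof -
      have T: "integrable lborel (\<lambda>x. cis (- (x * (\<xi> + h))) * \<phi> x)" "integrable lborel (\<lambda>x. cis (- (x * \<xi>)) * \<phi> x)"
        "integrable lborel (\<lambda>x. of_real h * (cis (- (x * \<xi>)) * (- \<i> * of_real x ^ 1 * \<phi> x)))"
        by (intro integrable_cis_mult i0 i1 integrable_mult_right; measurable)+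
      show ?thesis
        unfolding D_def fourier_def scaleR_conv_of_real Bochner_Integration.integral_diff[OF Bochner_Integration.integrable_diff[OF T(1,2)] T(3)]
          Bochner_Integration.integral_diff[OF T(1,2)] integral_mult_right_zero by simp
    qed
    also have "norm \<dots> \<le> (LINT x|lborel. norm (1 * of_real x ^ 2 * \<phi> x) / 2 * h\<^sup>2)"
    proof (rule order_trans[OF integral_norm_bound], rule integral_mono)
      show "integrable lborel (\<lambda>x. norm (1 * of_real x ^ 2 * \<phi> x) / 2 * h\<^sup>2)"
        by (intro integrable_mult_left integrable_divide i2)
      show "integrable lborel (\<lambda>x. norm (cis (- (x * (\<xi> + h))) * \<phi> x - cis (- (x * \<xi>)) * \<phi> x
          - of_real h * (cis (- (x * \<xi>)) * (- \<i> * of_real x ^ 1 * \<phi> x))))"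
        by (intro integrable_norm Bochner_Integration.integrable_diff integrable_cis_mult i0 i1 integrable_mult_right) auto
      fix x
      have e: "norm (cis (- (x * h)) - 1 + \<i> * of_real (x * h)) \<le> (x * h)\<^sup>2 / 2"
        using iexp_approx1[of "- (x * h)" 1] by (simp add: cis_conv_exp numeral_2_eq_2 power2_eq_square algebra_simps)
      have "cis (- (x * (\<xi> + h))) * \<phi> x - cis (- (x * \<xi>)) * \<phi> x
          - of_real h * (cis (- (x * \<xi>)) * (- \<i> * of_real x ^ 1 * \<phi> x))
         = (cis (- (x * h)) - 1 + \<i> * of_real (x * h)) * (cis (- (x * \<xi>)) * \<phi> x)"
        by (simp add: algebra_simps cis_mult)
      also have "norm \<dots> \<le> (x * h)\<^sup>2 / 2 * norm (cis (- (x * \<xi>)) * \<phi> x)"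
        unfolding norm_mult[of "_ + _"] by (intro mult_right_mono e) auto
      also have "\<dots> = norm (1 * of_real x ^ 2 * \<phi> x) / 2 * h\<^sup>2"
        by (simp add: norm_mult norm_power power_mult_distrib)
      finally show "norm (cis (- (x * (\<xi> + h))) * \<phi> x - cis (- (x * \<xi>)) * \<phi> x
          - of_real h * (cis (- (x * \<xi>)) * (- \<i> * of_real x ^ 1 * \<phi> x)))
          \<le> norm (1 * of_real x ^ 2 * \<phi> x) / 2 * h\<^sup>2" .
    qed
    also have "\<dots> = B * h\<^sup>2" unfolding B_def by simp
    finally show ?thesis .
  qed
  show ?thesis unfolding D_def[symmetric] has_vector_derivative_def has_derivative_at
  proof (intro conjI bounded_linear_scaleR_left)
    show "(\<lambda>h. norm (fourier \<phi> (\<xi> + h) - fourier \<phi> \<xi> - h *\<^sub>R D) / norm h) \<midarrow>0\<rightarrow> 0"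
    proof (rule Lim_null_comparison)
      show "\<forall>\<^sub>F h in at 0. norm (norm (fourier \<phi> (\<xi> + h) - fourier \<phi> \<xi> - h *\<^sub>R D) / norm h) \<le> B * \<bar>h\<bar>"
      proof (rule always_eventually, intro allI)
        fix h :: real
        show "norm (norm (fourier \<phi> (\<xi> + h) - fourier \<phi> \<xi> - h *\<^sub>R D) / norm h) \<le> B * \<bar>h\<bar>"
        proof (cases "h = 0")
          case False
          have "norm (fourier \<phi> (\<xi> + h) - fourier \<phi> \<xi> - h *\<^sub>R D) / \<bar>h\<bar> \<le> B * h\<^sup>2 / \<bar>h\<bar>"
            using B[of h] by (intro divide_right_mono) auto
          also have "B * h\<^sup>2 / \<bar>h\<bar> = B * \<bar>h\<bar>"
            using False by (simp add: power2_eq_square field_simps)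
          finally show ?thesis by simp
        qed auto
      qed
      show "(\<lambda>h. B * \<bar>h\<bar>) \<midarrow>0\<rightarrow> 0" by (auto intro!: tendsto_eq_intros)
    qed
  qed
qed

lemma schwartz_tendsto_zero:
  assumes "\<phi> \<in> schwartz" shows "(\<phi> \<longlongrightarrow> 0) at_top" "(\<phi> \<longlongrightarrow> 0) at_bot"
proof -
  define C where "C = schwartz_seminorm 0 0 \<phi> + schwartz_seminorm 2 0 \<phi>"
  have le: "norm (\<phi> x) \<le> C * inverse (1 + x\<^sup>2)" for x
    using schwartz_norm_le[OF assms] C_def by auto
  show "(\<phi> \<longlongrightarrow> 0) at_top"
    by (rule Lim_null_comparison[where g = "\<lambda>x. C * inverse (1 + x\<^sup>2)", OF always_eventually]) (use le in auto, real_asymp)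
  show "(\<phi> \<longlongrightarrow> 0) at_bot"
    by (rule Lim_null_comparison[where g = "\<lambda>x. C * inverse (1 + x\<^sup>2)", OF always_eventually]) (use le in auto, real_asymp)
qed

text \<open>Integration by parts on the whole line: \<open>f\<close> is the derivative of
  \<open>F\<close>, which tends to 0 at both ends, so the integral of \<open>f\<close> vanishes and
  splits into the two sides of the claim.\<close>

lemma fourier_vderiv:
  assumes "\<phi> \<in> schwartz"
  shows "fourier (vderiv \<phi>) \<xi> = \<i> * of_real \<xi> * fourier \<phi> \<xi>"
proof -
  define F where "F = (\<lambda>x. cis (- (x * \<xi>)) * \<phi> x)"
  define f where "f = (\<lambda>x. cis (- (x * \<xi>)) * vderiv \<phi> x + (- \<i> * of_real \<xi>) * (cis (- (x * \<xi>)) * \<phi> x))"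
  note sm = assms schwartz_vderiv[OF assms]
  have i: "integrable lborel (\<lambda>x. cis (- (x * \<xi>)) * vderiv \<phi> x)" "integrable lborel (\<lambda>x. cis (- (x * \<xi>)) * \<phi> x)"
    by (intro integrable_cis_mult schwartz_integrable sm; simp)+
  have "(LBINT x=-\<infinity>..\<infinity>. f x) = 0 - 0"
  proof (rule interval_integral_FTC_integrable)
    show "(F has_vector_derivative f x) (at x)" for x
    proof -
      have "((\<lambda>x. cis (- (x * \<xi>))) has_vector_derivative (- \<xi>) *\<^sub>R (\<i> * cis (- (x * \<xi>)))) (at x)"
        unfolding has_vector_derivative_def
        by (auto intro!: derivative_eq_intros simp: scaleR_conv_of_real algebra_simps)
      from has_vector_derivative_mult[OF this schwartz_has_vector_derivative[OF assms, of x]]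
      show ?thesis unfolding F_def f_def by (simp add: scaleR_conv_of_real algebra_simps)
    qed
    show "isCont f x" for x unfolding f_def
      using schwartz_continuous[OF sm(1), of UNIV] schwartz_continuous[OF sm(2), of UNIV]
      by (auto intro!: continuous_intros tendsto_cis simp: continuous_on_eq_continuous_at isCont_def tendsto_intros)
    show "set_integrable lborel (einterval (- \<infinity>) \<infinity>) f"
      unfolding set_integrable_def einterval_def f_def
      using i by (auto intro!: integrable_mult_right)
    have n: "(F \<longlongrightarrow> 0) G" if "(\<phi> \<longlongrightarrow> 0) G" for G
      using that unfolding F_def by (subst tendsto_norm_zero_iff[symmetric], subst (asm) tendsto_norm_zero_iff[symmetric])
         (simp add: norm_mult)
    show "((F \<circ> real_of_ereal) \<longlongrightarrow> 0) (at_right (- \<infinity>))" "((F \<circ> real_of_ereal) \<longlongrightarrow> 0) (at_left \<infinity>)"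
      unfolding ereal_tendsto_simps using n schwartz_tendsto_zero[OF assms] by auto
  qed auto
  moreover have "(LBINT x=-\<infinity>..\<infinity>. f x) = (LINT x|lborel. f x)"
    by (simp add: interval_lebesgue_integral_def set_lebesgue_integral_def einterval_def)
  moreover have "(LINT x|lborel. f x) = fourier (vderiv \<phi>) \<xi> - \<i> * of_real \<xi> * fourier \<phi> \<xi>"
    unfolding f_def fourier_def by (subst Bochner_Integration.integral_add) (use i in \<open>auto intro!: integrable_mult_right\<close>)
  ultimately show ?thesis by simp
qed

text \<open>Each power of the frequency is traded for one derivative of \<open>\<phi>\<close>, so
  decay follows by induction over all Schwartz functions at once. Smoothness holds because the image
  of \<open>schwartz\<close> under \<open>fourier\<close> is itself stable under
  \<open>vderiv\<close>.\<close>

lemma fourier_schwartz: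
  assumes "\<phi> \<in> schwartz" shows "fourier \<phi> \<in> schwartz"
proof -
  have d: "\<exists>C. \<forall>\<xi>. \<bar>\<xi>\<bar> ^ j * norm (fourier \<phi> \<xi>) \<le> C" if "\<phi> \<in> schwartz" for j \<phi>
    using that
  proof (induction j arbitrary: \<phi>)
    case 0
    then show ?case using norm_fourier_le[OF schwartz_integrable] by auto
  next
    case (Suc j)
    then obtain C where "\<And>\<xi>. \<bar>\<xi>\<bar> ^ j * norm (fourier (vderiv \<phi>) \<xi>) \<le> C"
      using schwartz_vderiv by blast
    then show ?case using fourier_vderiv[OF Suc.prems] by (auto simp: norm_mult mult_ac)
  qed
  have "fourier ` schwartz \<subseteq> schwartz"
  proof (rule schwartzI_closed)
    fix \<psi> assume "\<psi> \<in> fourier ` schwartz"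
    then obtain \<phi> where \<phi>: "\<phi> \<in> schwartz" "\<psi> = fourier \<phi>" by blast
    show "\<psi> differentiable (at x)" for x
      unfolding \<phi>(2) by (rule differentiableI_vector[OF fourier_has_vector_derivative[OF \<phi>(1)]])
    have "vderiv \<psi> = fourier (\<lambda>x. - \<i> * of_real x ^ 1 * \<phi> x)"
      unfolding \<phi>(2) by (rule vderiv_eqI) (rule fourier_has_vector_derivative[OF \<phi>(1)])
    then show "vderiv \<psi> \<in> fourier ` schwartz" using schwartz_mult_monom[OF \<phi>(1)] by blast
    show "\<exists>C. \<forall>x. \<bar>x\<bar> ^ j * norm (\<psi> x) \<le> C" for j unfolding \<phi>(2) by (rule d[OF \<phi>(1)])
  qed
  then show ?thesis using assms by blast
qed

lemma inv_fourier_schwartz: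
  assumes "\<phi> \<in> schwartz" shows "inv_fourier \<phi> \<in> schwartz"
proof -
  have "fourier (\<lambda>y. of_real (1 / (2 * pi)) * \<phi> (- y)) \<in> schwartz"
    by (intro fourier_schwartz schwartz_cmult schwartz_reflect assms)
  moreover have "inv_fourier \<phi> = fourier (\<lambda>y. of_real (1 / (2 * pi)) * \<phi> (- y))"
    using inv_fourier_conv_fourier by blast
  ultimately show ?thesis by simp
qed

subsection \<open>Gaussian regularisation, inversion and the Plancherel inequality\<close>

lemma borel_measurable_cnj [measurable (raw)]:
  "f \<in> borel_measurable M \<Longrightarrow> (\<lambda>x. cnj (f x)) \<in> borel_measurable M"
  by (rule measurable_compose[of f M borel cnj borel])
     (auto intro!: borel_measurable_continuous_onI continuous_intros)

lemma norm_integral_le_nn_integral: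
  fixes f :: "'a \<Rightarrow> 'b::{banach, second_countable_topology}"
  shows "ennreal (norm (integral\<^sup>L M f)) \<le> (\<integral>\<^sup>+x. ennreal (norm (f x)) \<partial>M)"
  by (cases "integrable M f") (auto simp: integral_norm_bound_ennreal not_integrable_integral_eq)

text \<open>Here \<open>n\<close> is the standard deviation. With this scaling
  \<open>gauss 1\<close> is a multiple of the standard normal density, whose transform is known as a
  characteristic function.\<close>

definition gauss :: "real \<Rightarrow> real \<Rightarrow> real" where
  "gauss n x = exp (- (x / n)\<^sup>2 / 2)"

lemma gauss_measurable [measurable]: "gauss n \<in> borel_measurable borel"
  unfolding gauss_def by measurable

lemma gauss_nonneg [simp]: "0 \<le> gauss n x" and gauss_le_1: "gauss n x \<le> 1"
  by (simp_all add: gauss_def)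

lemma gauss_1_conv: "gauss 1 x = sqrt (2 * pi) * std_normal_density x"
  by (simp add: gauss_def std_normal_density_def field_simps)

lemma gauss_scale: "n \<noteq> 0 \<Longrightarrow> gauss n (n * x) = gauss 1 x"
  by (simp add: gauss_def)

lemma integrable_gauss_1: "integrable lborel (gauss 1)"
  unfolding gauss_1_conv using integrable_std_normal_moment[of 0] by (intro integrable_mult_right) simp

lemma integral_gauss_1: "(LINT x|lborel. gauss 1 x) = sqrt (2 * pi)"
  unfolding gauss_1_conv using integral_std_normal_moment_even[of 0] by simp

lemma integrable_gauss:
  assumes "n > 0" shows "integrable lborel (gauss n)"
  using lborel_integrable_real_affine_iff[of n "gauss n" 0] integrable_gauss_1 assms
  by (simp add: gauss_scale)

lemma fourier_gauss_1: "(LINT x|lborel. cis (z * x) * of_real (gauss 1 x)) = of_real (sqrt (2 * pi) * gauss 1 z)"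
proof -
  have "of_real (exp (- (z\<^sup>2) / 2)) = char std_normal_distribution z"
    by (simp add: char_std_normal_distribution)
  also have "\<dots> = (LINT x|lborel. std_normal_density x *\<^sub>R iexp (z * x))"
    unfolding char_def by (subst integral_density) auto
  finally have "(LINT x|lborel. of_real (sqrt (2 * pi)) * (std_normal_density x *\<^sub>R iexp (z * x))) =
      of_real (sqrt (2 * pi)) * of_real (exp (- (z\<^sup>2) / 2))"
    by (subst integral_mult_right_zero) simp
  moreover have "of_real (sqrt (2 * pi)) * (std_normal_density x *\<^sub>R iexp (z * x)) = cis (z * x) * of_real (gauss 1 x)" for x
    by (simp only: gauss_1_conv cis_conv_exp scaleR_conv_of_real of_real_mult mult_ac)
  ultimately show ?thesis by (simp add: gauss_def)
qed

lemma fourier_gauss: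
  assumes "n > 0"
  shows "(LINT x|lborel. cis (z * x) * of_real (gauss n x)) = of_real (n * sqrt (2 * pi) * gauss 1 (n * z))"
proof -
  have "(LINT x|lborel. cis (z * x) * of_real (gauss n x)) =
      n *\<^sub>R (LINT x|lborel. cis (z * n * x) * of_real (gauss 1 x))"
    using assms by (subst lborel_integral_real_affine[where c = n and t = 0]) (auto simp: gauss_scale mult.assoc)
  then show ?thesis unfolding fourier_gauss_1 using assms by (simp add: scaleR_conv_of_real mult_ac)
qed

text \<open>The Gaussian factor makes the double integral absolutely convergent; exchanging the
  integrals turns the multiplier into convolution with an approximate identity of total mass 2
  pi.\<close>

lemma gauss_regularised_inversion:
  assumes f: "integrable lborel f" and n: "n > 0"
  shows "(LINT \<xi>|lborel. cis (x * \<xi>) * of_real (gauss n \<xi>) * fourier f \<xi>) =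
     (LINT y|lborel. f y * of_real (n * sqrt (2 * pi) * gauss 1 (n * (x - y))))"
proof -
  have g: "integrable lborel (\<lambda>\<xi>. cis (x * \<xi>) * of_real (gauss n \<xi>))"
    by (intro integrable_cis_mult integrable_of_real integrable_gauss n) simp
  have "(LINT \<xi>|lborel. cis (x * \<xi>) * of_real (gauss n \<xi>) * fourier f \<xi>) =
     (LINT y|lborel. f y * (LINT \<xi>|lborel. cis (- (y * \<xi>)) * (cis (x * \<xi>) * of_real (gauss n \<xi>))))"
    unfolding fourier_def
    using fubini_kernel(2)[OF f g, of "\<lambda>z. cis (- (snd z * fst z))" 1] by simp
  also have "(\<lambda>y. (LINT \<xi>|lborel. cis (- (y * \<xi>)) * (cis (x * \<xi>) * of_real (gauss n \<xi>)))) =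
     (\<lambda>y. LINT \<xi>|lborel. cis ((x - y) * \<xi>) * of_real (gauss n \<xi>))"
    by (simp add: cis_mult mult.assoc[symmetric] algebra_simps)
  finally show ?thesis unfolding fourier_gauss[OF n] .
qed

lemma gauss_tendsto_1: "(\<lambda>n. gauss (real (Suc n)) x) \<longlonglongrightarrow> 1"
proof -
  have "(\<lambda>n. exp (- (x / (1 + real n))\<^sup>2 / 2)) \<longlonglongrightarrow> exp (- 0\<^sup>2 / 2)"
  proof -
    have "(\<lambda>n. x / (1 + real n)) \<longlonglongrightarrow> 0" by real_asymp
    then show ?thesis by (intro tendsto_intros) auto
  qed
  then show ?thesis unfolding gauss_def of_nat_Suc by simp
qed

text \<open>The Gaussian means \<open>u\<close> are evaluated twice. On the frequency side the
  Gaussian tends to 1; on the space side, after rescaling, \<open>\<phi>\<close> is averaged over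
  shrinking neighbourhoods of \<open>x\<close>. Both limits are taken by dominated convergence and
  compared.\<close>

theorem inv_fourier_fourier:
  assumes \<phi>: "\<phi> \<in> schwartz"
  shows "inv_fourier (fourier \<phi>) = \<phi>"
proof
  fix x
  define u where "u = (\<lambda>n. (LINT \<xi>|lborel. cis (x * \<xi>) * of_real (gauss (real (Suc n)) \<xi>) * fourier \<phi> \<xi>))"
  have [measurable]: "\<phi> \<in> borel_measurable borel" "fourier \<phi> \<in> borel_measurable borel"
    using \<phi> fourier_schwartz schwartz_measurable by blast+
  have "u \<longlonglongrightarrow> (LINT \<xi>|lborel. cis (x * \<xi>) * fourier \<phi> \<xi>)"
    unfolding u_def
  proof (rule integral_dominated_convergence)
    show "integrable lborel (\<lambda>\<xi>. norm (fourier \<phi> \<xi>))"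
      by (intro integrable_norm schwartz_integrable fourier_schwartz \<phi>)
    show "AE \<xi> in lborel. (\<lambda>n. cis (x * \<xi>) * of_real (gauss (real (Suc n)) \<xi>) * fourier \<phi> \<xi>) \<longlonglongrightarrow> cis (x * \<xi>) * fourier \<phi> \<xi>"
    proof (rule AE_I2)
      fix \<xi>
      have "(\<lambda>n. cis (x * \<xi>) * of_real (gauss (real (Suc n)) \<xi>) * fourier \<phi> \<xi>) \<longlonglongrightarrow> cis (x * \<xi>) * of_real 1 * fourier \<phi> \<xi>"
        by (intro tendsto_intros gauss_tendsto_1)
      then show "(\<lambda>n. cis (x * \<xi>) * of_real (gauss (real (Suc n)) \<xi>) * fourier \<phi> \<xi>) \<longlonglongrightarrow> cis (x * \<xi>) * fourier \<phi> \<xi>" by simp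
    qed
    show "AE \<xi> in lborel. norm (cis (x * \<xi>) * of_real (gauss (real (Suc n)) \<xi>) * fourier \<phi> \<xi>) \<le> norm (fourier \<phi> \<xi>)" for n
      using gauss_le_1 by (auto simp: norm_mult intro!: AE_I2 mult_left_le_one_le)
  qed auto
  then have 1: "u \<longlonglongrightarrow> of_real (2 * pi) * inv_fourier (fourier \<phi>) x"
    unfolding inv_fourier_def by (simp add: field_simps)
  have u: "u n = (LINT z|lborel. of_real (sqrt (2 * pi) * gauss 1 z) * \<phi> (x - z / real (Suc n)))" for n
  proof -
    have "u n = (LINT y|lborel. \<phi> y * of_real (real (Suc n) * sqrt (2 * pi) * gauss 1 (real (Suc n) * (x - y))))"
      unfolding u_def by (rule gauss_regularised_inversion) (auto intro: schwartz_integrable \<phi>)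
    also have "\<dots> = (LINT z|lborel. of_real (sqrt (2 * pi) * gauss 1 z) * \<phi> (x - z / real (Suc n)))"
      by (subst lborel_integral_real_affine[where c = "- 1 / real (Suc n)" and t = x])
         (auto simp del: of_nat_Suc simp: scaleR_conv_of_real integral_mult_right_zero[symmetric] field_simps
           simp del: integral_mult_right_zero integral_mult_left_zero intro!: Bochner_Integration.integral_cong)
    finally show ?thesis .
  qed
  have "u \<longlonglongrightarrow> (LINT z|lborel. of_real (sqrt (2 * pi) * gauss 1 z) * \<phi> x)"
    unfolding u
  proof (rule integral_dominated_convergence)
    show "integrable lborel (\<lambda>z. sqrt (2 * pi) * gauss 1 z * schwartz_seminorm 0 0 \<phi>)"
      by (intro integrable_mult_left integrable_mult_right integrable_gauss_1)
    show "AE z in lborel. (\<lambda>n. of_real (sqrt (2 * pi) * gauss 1 z) * \<phi> (x - z / real (Suc n))) \<longlonglongrightarrow> of_real (sqrt (2 * pi) * gauss 1 z) * \<phi> x"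
    proof (rule AE_I2, rule tendsto_mult[OF tendsto_const])
      fix z
      have "(\<lambda>n. x - z / real (Suc n)) \<longlonglongrightarrow> x" by real_asymp
      moreover have "isCont \<phi> x" using schwartz_continuous[OF \<phi>, of UNIV] continuous_on_eq_continuous_at by blast
      ultimately show "(\<lambda>n. \<phi> (x - z / real (Suc n))) \<longlonglongrightarrow> \<phi> x"
        using isCont_tendsto_compose by blast
    qed
    show "AE z in lborel. norm (of_real (sqrt (2 * pi) * gauss 1 z) * \<phi> (x - z / real (Suc n))) \<le> sqrt (2 * pi) * gauss 1 z * schwartz_seminorm 0 0 \<phi>" for n
      using schwartz_bounded[OF \<phi>] by (auto simp: norm_mult intro!: AE_I2 mult_left_mono)
  qed auto
  also have "(LINT z|lborel. of_real (sqrt (2 * pi) * gauss 1 z) * \<phi> x) = of_real (2 * pi) * \<phi> x"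
  proof -
    have "(LINT z|lborel. complex_of_real (sqrt (2 * pi) * gauss 1 z)) = of_real (sqrt (2 * pi) * sqrt (2 * pi))"
      unfolding integral_complex_of_real by (simp only: integral_mult_right_zero integral_gauss_1)
    moreover have "sqrt (2 * pi) * sqrt (2 * pi) = 2 * pi" by simp
    ultimately have "(LINT z|lborel. complex_of_real (sqrt (2 * pi) * gauss 1 z)) = of_real (2 * pi)" by (simp only:)
    then show ?thesis by (simp only: integral_mult_left_zero)
  qed
  finally have "u \<longlonglongrightarrow> of_real (2 * pi) * \<phi> x" .
  from LIMSEQ_unique[OF 1 this] show "inv_fourier (fourier \<phi>) x = \<phi> x" by simp
qed

text \<open>Schur's test bounds the quadratic form of the Gaussian kernel, uniformly in the width.\<close>

lemma gauss_schur:
  assumes [measurable]: "h \<in> borel_measurable borel" and n: "n > 0"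
  shows "(\<integral>\<^sup>+x. (\<integral>\<^sup>+y. ennreal (norm (h x) * norm (h y) * (n * sqrt (2 * pi) * gauss 1 (n * (x - y)))) \<partial>lborel) \<partial>lborel)
     \<le> ennreal (2 * pi) * (\<integral>\<^sup>+x. ennreal ((norm (h x :: complex))\<^sup>2) \<partial>lborel)"
proof -
  define G where "G = (\<lambda>z. n * sqrt (2 * pi) * gauss 1 (n * z))"
  have G0: "G z \<ge> 0" for z using n by (simp add: G_def)
  have [measurable]: "G \<in> borel_measurable borel" unfolding G_def by measurable
  have "(\<integral>\<^sup>+z. ennreal (gauss 1 z) \<partial>lborel) = ennreal (sqrt (2 * pi))"
    using integral_gauss_1 integrable_gauss_1 by (subst nn_integral_eq_integral) auto
  then have g: "ennreal n * (\<integral>\<^sup>+z. ennreal (gauss 1 (n * z)) \<partial>lborel) = ennreal (sqrt (2 * pi))"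
    using nn_integral_real_affine[of "\<lambda>z. ennreal (gauss 1 z)" n 0] n by simp
  have "(\<integral>\<^sup>+z. ennreal (G z) \<partial>lborel) = (\<integral>\<^sup>+z. ennreal (n * sqrt (2 * pi)) * ennreal (gauss 1 (n * z)) \<partial>lborel)"
    unfolding G_def using n by (subst ennreal_mult[symmetric]) auto
  also have "\<dots> = ennreal (sqrt (2 * pi)) * (ennreal n * (\<integral>\<^sup>+z. ennreal (gauss 1 (n * z)) \<partial>lborel))"
    using n by (subst nn_integral_cmult) (auto simp: ennreal_mult mult_ac)
  finally have "(\<integral>\<^sup>+z. ennreal (G z) \<partial>lborel) = ennreal (sqrt (2 * pi)) * ennreal (sqrt (2 * pi))"
    unfolding g .
  then have GI: "(\<integral>\<^sup>+z. ennreal (G z) \<partial>lborel) = ennreal (2 * pi)"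
    by (simp flip: ennreal_mult)
  have GIx: "(\<integral>\<^sup>+y. ennreal (G (x - y)) \<partial>lborel) = ennreal (2 * pi)" for x
    using nn_integral_real_affine[of "\<lambda>z. ennreal (G z)" "-1" x] GI by simp
  have GIy: "(\<integral>\<^sup>+x. ennreal (G (x - y)) \<partial>lborel) = ennreal (2 * pi)" for y
    using nn_integral_real_affine[of "\<lambda>z. ennreal (G z)" 1 "-y"] GI by simp
  \<comment> \<open>The product of the two norms is split symmetrically into halves of the two
    squares, so each half needs only the mass of the kernel in one variable.\<close>
  define q where "q = (\<lambda>x. (norm (h x))\<^sup>2 / 2)"
  have [measurable]: "q \<in> borel_measurable borel" unfolding q_def by measurable
  have q0: "q x \<ge> 0" for x by (simp add: q_def)
  have "norm (h x) * norm (h y) * G (x - y) \<le> q x * G (x - y) + q y * G (x - y)" for x y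
  proof -
    have "norm (h x) * norm (h y) \<le> q x + q y"
      using sum_squares_bound[of "norm (h x)" "norm (h y)"] by (simp add: q_def)
    then show ?thesis using G0 by (metis distrib_right mult_right_mono)
  qed
  then have "(\<integral>\<^sup>+x. (\<integral>\<^sup>+y. ennreal (norm (h x) * norm (h y) * G (x - y)) \<partial>lborel) \<partial>lborel) \<le>
     (\<integral>\<^sup>+x. (\<integral>\<^sup>+y. ennreal (q x) * ennreal (G (x - y)) + ennreal (q y) * ennreal (G (x - y)) \<partial>lborel) \<partial>lborel)"
    using G0 q0 by (intro nn_integral_mono) (simp flip: ennreal_mult ennreal_plus)
  also have "\<dots> = (\<integral>\<^sup>+x. (\<integral>\<^sup>+y. ennreal (q x) * ennreal (G (x - y)) \<partial>lborel) \<partial>lborel)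
     + (\<integral>\<^sup>+x. (\<integral>\<^sup>+y. ennreal (q y) * ennreal (G (x - y)) \<partial>lborel) \<partial>lborel)"
    by (simp add: nn_integral_add)
  also have "(\<integral>\<^sup>+x. (\<integral>\<^sup>+y. ennreal (q y) * ennreal (G (x - y)) \<partial>lborel) \<partial>lborel)
     = (\<integral>\<^sup>+y. (\<integral>\<^sup>+x. ennreal (q y) * ennreal (G (x - y)) \<partial>lborel) \<partial>lborel)"
    by (rule lborel_pair.Fubini') measurable
  also have "(\<integral>\<^sup>+x. (\<integral>\<^sup>+y. ennreal (q x) * ennreal (G (x - y)) \<partial>lborel) \<partial>lborel) + \<dots> =
     (\<integral>\<^sup>+x. ennreal (q x) \<partial>lborel) * ennreal (2 * pi) + (\<integral>\<^sup>+x. ennreal (q x) \<partial>lborel) * ennreal (2 * pi)"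
    by (simp add: nn_integral_cmult GIx GIy nn_integral_multc)
  also have "\<dots> = ennreal (2 * pi) * ((\<integral>\<^sup>+x. ennreal (q x) \<partial>lborel) + (\<integral>\<^sup>+x. ennreal (q x) \<partial>lborel))"
    by (simp add: algebra_simps)
  also have "(\<integral>\<^sup>+x. ennreal (q x) \<partial>lborel) + (\<integral>\<^sup>+x. ennreal (q x) \<partial>lborel) = (\<integral>\<^sup>+x. ennreal ((norm (h x))\<^sup>2) \<partial>lborel)"
    by (subst nn_integral_add[symmetric]) (auto simp: q_def simp flip: ennreal_plus)
  finally show ?thesis unfolding G_def .
qed

text \<open>With a Gaussian weight the left side becomes, by expanding one factor and inverting, a
  quadratic form in \<open>h\<close> with a Gaussian kernel. Schur's test bounds it independently of
  the width, and Fatou's lemma removes the weight. The right side may be infinite.\<close>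

theorem plancherel_inequality:
  assumes h: "integrable lborel h"
  shows "(\<integral>\<^sup>+\<xi>. ennreal ((norm (fourier h \<xi>))\<^sup>2) \<partial>lborel) \<le> ennreal (2 * pi) * (\<integral>\<^sup>+x. ennreal ((norm (h x))\<^sup>2) \<partial>lborel)"
    (is "_ \<le> ?R")
proof -
  have [measurable]: "h \<in> borel_measurable borel" using h by auto
  define B where "B = (LINT x|lborel. norm (h x))"
  have B: "norm (fourier h \<xi>) \<le> B" for \<xi> unfolding B_def by (rule norm_fourier_le[OF h])
  have le: "(\<integral>\<^sup>+\<xi>. ennreal (gauss n \<xi> * (norm (fourier h \<xi>))\<^sup>2) \<partial>lborel) \<le> ?R" if n: "n > 0" for n
  proof -
    have ig: "integrable lborel (\<lambda>\<xi>. of_real (gauss n \<xi>) * fourier h \<xi>)"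
      using integrable_bounded_mult[of lborel "\<lambda>\<xi>. of_real (gauss n \<xi>)" "fourier h" B] B integrable_gauss[OF n]
      by (simp add: mult.commute)
    have ii: "integrable lborel (\<lambda>\<xi>. cnj (fourier h \<xi>) * (of_real (gauss n \<xi>) * fourier h \<xi>))"
      by (rule integrable_bounded_mult[OF ig, where B = B]) (use B in auto)
    have eq: "cnj (fourier h \<xi>) * (of_real (gauss n \<xi>) * fourier h \<xi>) = of_real (gauss n \<xi> * (norm (fourier h \<xi>))\<^sup>2)" for \<xi>
      unfolding of_real_mult complex_norm_square by (simp add: mult_ac)
    have ir: "integrable lborel (\<lambda>\<xi>. gauss n \<xi> * (norm (fourier h \<xi>))\<^sup>2)"
      using ii unfolding eq by (rule complex_of_real_integrable_eq[THEN iffD1])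
    have cj: "cnj (fourier h \<xi>) = (LINT x|lborel. cis (x * \<xi>) * cnj (h x))" for \<xi>
      unfolding fourier_def
      using integral_bounded_linear[OF bounded_linear_cnj integrable_cis_mult[OF h], of "\<lambda>x. - (x * \<xi>)"] by (simp add: cis_cnj)
    have "of_real (LINT \<xi>|lborel. gauss n \<xi> * (norm (fourier h \<xi>))\<^sup>2) =
        (LINT \<xi>|lborel. (of_real (gauss n \<xi>) * fourier h \<xi>) * (LINT x|lborel. cis (x * \<xi>) * cnj (h x)))"
      unfolding integral_complex_of_real[symmetric] eq[symmetric] cj by (simp add: mult_ac)
    also have "\<dots> = (LINT x|lborel. cnj (h x) * (LINT \<xi>|lborel. cis (x * \<xi>) * (of_real (gauss n \<xi>) * fourier h \<xi>)))"
      using fubini_kernel(2)[of "\<lambda>x. cnj (h x)" "\<lambda>\<xi>. of_real (gauss n \<xi>) * fourier h \<xi>" "\<lambda>z. cis (snd z * fst z)" 1]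
        h ig by simp
    also have "\<dots> = (LINT x|lborel. cnj (h x) * (LINT y|lborel. h y * of_real (n * sqrt (2 * pi) * gauss 1 (n * (x - y)))))"
      using gauss_regularised_inversion[OF h n] by (simp add: mult.assoc)
    finally have main: "of_real (LINT \<xi>|lborel. gauss n \<xi> * (norm (fourier h \<xi>))\<^sup>2) =
       (LINT x|lborel. cnj (h x) * (LINT y|lborel. h y * of_real (n * sqrt (2 * pi) * gauss 1 (n * (x - y)))))" .
    have "(\<integral>\<^sup>+\<xi>. ennreal (gauss n \<xi> * (norm (fourier h \<xi>))\<^sup>2) \<partial>lborel) =
       ennreal (norm (complex_of_real (LINT \<xi>|lborel. gauss n \<xi> * (norm (fourier h \<xi>))\<^sup>2)))"
      using ir by (subst nn_integral_eq_integral) auto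
    also have "\<dots> \<le> (\<integral>\<^sup>+x. ennreal (norm (cnj (h x) * (LINT y|lborel. h y * of_real (n * sqrt (2 * pi) * gauss 1 (n * (x - y)))))) \<partial>lborel)"
      unfolding main by (rule norm_integral_le_nn_integral)
    also have "\<dots> \<le> (\<integral>\<^sup>+x. (\<integral>\<^sup>+y. ennreal (norm (h x) * norm (h y) * (n * sqrt (2 * pi) * gauss 1 (n * (x - y)))) \<partial>lborel) \<partial>lborel)"
    proof (rule nn_integral_mono)
      fix x
      have "ennreal (norm (cnj (h x) * (LINT y|lborel. h y * of_real (n * sqrt (2 * pi) * gauss 1 (n * (x - y)))))) =
        ennreal (norm (LINT y|lborel. cnj (h x) * (h y * of_real (n * sqrt (2 * pi) * gauss 1 (n * (x - y))))))"
        by simp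
      also have "\<dots> \<le> (\<integral>\<^sup>+y. ennreal (norm (cnj (h x) * (h y * of_real (n * sqrt (2 * pi) * gauss 1 (n * (x - y)))))) \<partial>lborel)"
        by (rule norm_integral_le_nn_integral)
      also have "\<dots> = (\<integral>\<^sup>+y. ennreal (norm (h x) * norm (h y) * (n * sqrt (2 * pi) * gauss 1 (n * (x - y)))) \<partial>lborel)"
        using n by (simp add: norm_mult mult_ac abs_mult)
      finally show "ennreal (norm (cnj (h x) * (LINT y|lborel. h y * of_real (n * sqrt (2 * pi) * gauss 1 (n * (x - y))))))
         \<le> (\<integral>\<^sup>+y. ennreal (norm (h x) * norm (h y) * (n * sqrt (2 * pi) * gauss 1 (n * (x - y)))) \<partial>lborel)" .
    qed
    also have "\<dots> \<le> ?R" by (rule gauss_schur[OF _ n]) simp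
    finally show ?thesis .
  qed
  have "(\<integral>\<^sup>+\<xi>. ennreal ((norm (fourier h \<xi>))\<^sup>2) \<partial>lborel) =
     (\<integral>\<^sup>+\<xi>. liminf (\<lambda>n. ennreal (gauss (real (Suc n)) \<xi> * (norm (fourier h \<xi>))\<^sup>2)) \<partial>lborel)"
  proof (rule nn_integral_cong)
    fix \<xi>
    have "(\<lambda>n. gauss (real (Suc n)) \<xi> * (norm (fourier h \<xi>))\<^sup>2) \<longlonglongrightarrow> 1 * (norm (fourier h \<xi>))\<^sup>2"
      by (intro tendsto_mult gauss_tendsto_1 tendsto_const)
    then have "(\<lambda>n. ennreal (gauss (real (Suc n)) \<xi> * (norm (fourier h \<xi>))\<^sup>2)) \<longlonglongrightarrow> ennreal ((norm (fourier h \<xi>))\<^sup>2)"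
      unfolding mult_1 by (intro tendsto_ennrealI)
    then show "ennreal ((norm (fourier h \<xi>))\<^sup>2) = liminf (\<lambda>n. ennreal (gauss (real (Suc n)) \<xi> * (norm (fourier h \<xi>))\<^sup>2))"
      by (rule lim_imp_Liminf[OF trivial_limit_sequentially, symmetric])
  qed
  also have "\<dots> \<le> liminf (\<lambda>n. (\<integral>\<^sup>+\<xi>. ennreal (gauss (real (Suc n)) \<xi> * (norm (fourier h \<xi>))\<^sup>2) \<partial>lborel))"
    by (rule nn_integral_liminf) measurable
  also have "\<dots> \<le> ?R"
    by (rule Liminf_le) (auto intro!: always_eventually le)
  finally show ?thesis .
qed

subsection \<open>The Fourier transform on square integrable functions\<close>

lemma ennreal_tendsto_zero_le:
  fixes f g :: "nat \<Rightarrow> ennreal"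
  assumes "g \<longlonglongrightarrow> 0" "\<And>k. f k \<le> g k"
  shows "f \<longlonglongrightarrow> 0"
  by (rule tendsto_sandwich[OF always_eventually always_eventually tendsto_const assms(1)]) (auto intro: assms(2))

abbreviation l2sq :: "(real \<Rightarrow> complex) \<Rightarrow> ennreal" where
  "l2sq f \<equiv> \<integral>\<^sup>+x. ennreal ((norm (f x))\<^sup>2) \<partial>lborel"

lemma l2_Cauchy_Schwarz:
  assumes [measurable]: "f \<in> borel_measurable borel" "g \<in> borel_measurable borel"
  shows "(\<integral>\<^sup>+x. ennreal (norm (f x * g x)) \<partial>lborel)\<^sup>2 \<le> l2sq f * l2sq g"
  using Cauchy_Schwarz_nn_integral[of "\<lambda>x. ennreal (norm (f x))" lborel "\<lambda>x. ennreal (norm (g x))"]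
  by (simp add: norm_mult ennreal_mult ennreal_power)

lemma l2_mult_integrable:
  assumes [measurable]: "f \<in> borel_measurable borel" "g \<in> borel_measurable borel"
    and "l2sq f < \<infinity>" "l2sq g < \<infinity>"
  shows "integrable lborel (\<lambda>x. f x * g x)"
proof (rule integrableI_bounded)
  have "(\<integral>\<^sup>+x. ennreal (norm (f x * g x)) \<partial>lborel)\<^sup>2 < \<infinity>"
    using le_less_trans[OF l2_Cauchy_Schwarz[OF assms(1,2)]] ennreal_mult_less_top assms(3,4) by auto
  then show "(\<integral>\<^sup>+x. ennreal (norm (f x * g x)) \<partial>lborel) < \<infinity>"
    by (auto simp: power2_eq_square ennreal_mult_less_top)
qed measurable

lemma schwartz_l2: "\<phi> \<in> schwartz \<Longrightarrow> l2sq \<phi> < \<infinity>"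
proof -
  assume \<phi>: "\<phi> \<in> schwartz"
  have "integrable lborel (\<lambda>x. cnj (\<phi> x) * \<phi> x)"
    by (rule integrable_bounded_mult[OF schwartz_integrable[OF \<phi>]])
       (use schwartz_measurable[OF \<phi>] schwartz_bounded[OF \<phi>] in auto)
  then show ?thesis
    by (simp add: integrable_iff_bounded norm_mult power2_eq_square)
qed

lemma norm_diff_sq_le: "(norm (a - b :: complex))\<^sup>2 \<le> 2 * (norm a)\<^sup>2 + 2 * (norm b)\<^sup>2"
proof -
  have "(norm (a - b))\<^sup>2 \<le> (norm a + norm b)\<^sup>2"
    by (intro power_mono norm_triangle_ineq4) auto
  also have "\<dots> \<le> 2 * (norm a)\<^sup>2 + 2 * (norm b)\<^sup>2"
    using sum_squares_bound[of "norm a" "norm b"] by (simp add: power2_sum)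
  finally show ?thesis .
qed

lemma l2sq_diff_le:
  assumes [measurable]: "f \<in> borel_measurable borel" "g \<in> borel_measurable borel"
  shows "l2sq (\<lambda>x. f x - g x) \<le> ennreal 2 * l2sq f + ennreal 2 * l2sq g"
proof -
  have "l2sq (\<lambda>x. f x - g x) \<le> (\<integral>\<^sup>+x. ennreal 2 * ennreal ((norm (f x))\<^sup>2) + ennreal 2 * ennreal ((norm (g x))\<^sup>2) \<partial>lborel)"
  proof (rule nn_integral_mono)
    fix x
    have "ennreal ((norm (f x - g x))\<^sup>2) \<le> ennreal (2 * (norm (f x))\<^sup>2 + 2 * (norm (g x))\<^sup>2)"
      by (intro ennreal_leI norm_diff_sq_le)
    also have "\<dots> = ennreal (2 * (norm (f x))\<^sup>2) + ennreal (2 * (norm (g x))\<^sup>2)"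
      by (rule ennreal_plus) auto
    finally show "ennreal ((norm (f x - g x))\<^sup>2) \<le> ennreal 2 * ennreal ((norm (f x))\<^sup>2) + ennreal 2 * ennreal ((norm (g x))\<^sup>2)"
      unfolding ennreal_mult'[OF zero_le_numeral] .
  qed
  also have "\<dots> = ennreal 2 * l2sq f + ennreal 2 * l2sq g"
    by (subst nn_integral_add) (auto simp: nn_integral_cmult)
  finally show ?thesis .
qed

text \<open>Completeness of $L^2$ in the form needed: a sequence whose consecutive squared distances
  decay like $4^{-k}$ converges almost everywhere, because $\sum_k 2^k |u_{k+1}-u_k|^2$ is
  integrable.\<close>

lemma l2_fast_Cauchy_AE_convergent:
  fixes u :: "nat \<Rightarrow> real \<Rightarrow> complex"
  assumes [measurable]: "\<And>k. u k \<in> borel_measurable borel"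
    and le: "\<And>k. l2sq (\<lambda>x. u (Suc k) x - u k x) \<le> ennreal (B * (1/4) ^ k)"
    and "B \<ge> 0"
  shows "AE x in lborel. convergent (\<lambda>k. u k x)"
proof -
  have "(\<integral>\<^sup>+x. (\<Sum>k. ennreal (2 ^ k * (norm (u (Suc k) x - u k x))\<^sup>2)) \<partial>lborel) =
     (\<Sum>k. \<integral>\<^sup>+x. ennreal (2 ^ k * (norm (u (Suc k) x - u k x))\<^sup>2) \<partial>lborel)"
    by (rule nn_integral_suminf) measurable
  also have "\<dots> \<le> (\<Sum>k. ennreal (B * (1/2) ^ k))"
  proof (intro suminf_le summableI)
    fix k
    have "(\<integral>\<^sup>+x. ennreal (2 ^ k * (norm (u (Suc k) x - u k x))\<^sup>2) \<partial>lborel) =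
       ennreal (2 ^ k) * l2sq (\<lambda>x. u (Suc k) x - u k x)"
      by (subst nn_integral_cmult[symmetric]) (auto simp: ennreal_mult)
    also have "\<dots> \<le> ennreal (2 ^ k) * ennreal (B * (1/4) ^ k)" by (intro mult_left_mono le) auto
    also have "\<dots> = ennreal (B * (1/2) ^ k)"
    proof -
      have "(2::real) ^ k * (B * (1/4) ^ k) = B * (2 * (1/4)) ^ k" unfolding power_mult_distrib by simp
      then show ?thesis using \<open>B \<ge> 0\<close> by (subst ennreal_mult[symmetric]) auto
    qed
    finally show "(\<integral>\<^sup>+x. ennreal (2 ^ k * (norm (u (Suc k) x - u k x))\<^sup>2) \<partial>lborel) \<le> ennreal (B * (1/2) ^ k)" .
  qed
  also have "\<dots> < \<infinity>"
  proof -
    have "summable (\<lambda>k. B * (1/2::real) ^ k)" by (intro summable_mult summable_geometric) auto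
    then show ?thesis using \<open>B \<ge> 0\<close> by (subst suminf_ennreal2) auto
  qed
  finally have "AE x in lborel. (\<Sum>k. ennreal (2 ^ k * (norm (u (Suc k) x - u k x))\<^sup>2)) \<noteq> \<infinity>"
    by (intro nn_integral_PInf_AE) auto
  then show ?thesis
  proof eventually_elim
    case (elim x)
    define S where "S = (\<Sum>k. ennreal (2 ^ k * (norm (u (Suc k) x - u k x))\<^sup>2))"
    obtain C where C: "S = ennreal C" "C \<ge> 0" using elim unfolding S_def by (cases S) (auto simp: S_def)
    have h: "norm (sqrt (1/2)) < 1" by (simp add: real_sqrt_divide)
    \<comment> \<open>A single term is at most the finite sum \<open>C\<close>, so the increments
      decay like 2^(-k/2) and their telescoping series converges absolutely.\<close>
    have n: "norm (u (Suc k) x - u k x) \<le> sqrt C * sqrt (1/2) ^ k" for k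
    proof -
      have "ennreal (2 ^ k * (norm (u (Suc k) x - u k x))\<^sup>2) \<le> S"
      proof -
        have "(\<Sum>k\<in>{k}. ennreal (2 ^ k * (norm (u (Suc k) x - u k x))\<^sup>2)) \<le> S"
          unfolding S_def by (rule sum_le_suminf) (auto intro: summableI)
        then show ?thesis by (simp only: sum.insert sum.empty finite.emptyI empty_iff not_False_eq_True add_0_right)
      qed
      then have "2 ^ k * (norm (u (Suc k) x - u k x))\<^sup>2 \<le> C" unfolding C(1) using C(2) by (subst (asm) ennreal_le_iff)
      then have "(norm (u (Suc k) x - u k x))\<^sup>2 \<le> C / 2 ^ k" by (simp only: pos_le_divide_eq zero_less_power zero_less_numeral mult.commute)
      then have "(norm (u (Suc k) x - u k x))\<^sup>2 \<le> C * (1/2) ^ k" by (simp only: power_divide power_one times_divide_eq_right mult_1_right)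
      then have "norm (u (Suc k) x - u k x) \<le> sqrt (C * (1/2) ^ k)" by (rule real_le_rsqrt)
      then show ?thesis by (simp add: real_sqrt_mult real_sqrt_power)
    qed
    have "summable (\<lambda>k. sqrt C * sqrt (1/2) ^ k)"
      by (intro summable_mult summable_geometric h)
    then have "summable (\<lambda>k. u (Suc k) x - u k x)"
      by (rule summable_comparison_test'[where N = 0]) (rule n)
    then have "convergent (\<lambda>n. \<Sum>k<n. u (Suc k) x - u k x)" by (simp add: summable_iff_convergent)
    then have "convergent (\<lambda>n. u n x - u 0 x)" unfolding sum_lessThan_telescope[of "\<lambda>n. u n x"] .
    then show ?case using convergent_add_const_right_iff[of "\<lambda>n. u n x" "- u 0 x"] by simp
  qed
qed

text \<open>Fatou's lemma. The start index \<open>k0\<close> allows bounds that hold only on a tail,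
  as for \<open>u k - u l\<close> with \<open>l\<close> at least \<open>k\<close>.\<close>

lemma l2sq_liminf:
  assumes [measurable]: "\<And>k. v k \<in> borel_measurable borel"
    and "AE x in lborel. (\<lambda>k. v k x) \<longlonglongrightarrow> w x" and le: "\<And>k. k \<ge> k0 \<Longrightarrow> l2sq (v k) \<le> B"
  shows "l2sq w \<le> B"
proof -
  have "l2sq w \<le> (\<integral>\<^sup>+x. liminf (\<lambda>k. ennreal ((norm (v k x))\<^sup>2)) \<partial>lborel)"
  proof (rule nn_integral_mono_AE, use assms(2) in eventually_elim)
    case (elim x)
    then have "(\<lambda>k. ennreal ((norm (v k x))\<^sup>2)) \<longlonglongrightarrow> ennreal ((norm (w x))\<^sup>2)"
      by (intro tendsto_ennrealI tendsto_intros)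
    from lim_imp_Liminf[OF trivial_limit_sequentially this] show ?case by simp
  qed
  also have "\<dots> \<le> liminf (\<lambda>k. l2sq (v k))" by (rule nn_integral_liminf) measurable
  also have "\<dots> \<le> B" by (rule Liminf_le) (auto intro!: eventually_sequentiallyI le)
  finally show ?thesis .
qed

lemma l2_integral_tendsto:
  assumes [measurable]: "\<And>k. v k \<in> borel_measurable borel" "w \<in> borel_measurable borel" "\<phi> \<in> borel_measurable borel"
    and fin: "\<And>k. l2sq (v k) < \<infinity>" "l2sq w < \<infinity>" "l2sq \<phi> < \<infinity>"
    and lim: "(\<lambda>k. l2sq (\<lambda>x. v k x - w x)) \<longlonglongrightarrow> 0"
  shows "(\<lambda>k. LINT x|lborel. v k x * \<phi> x) \<longlonglongrightarrow> (LINT x|lborel. w x * \<phi> x)"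
proof -
  have *: "ennreal ((norm ((LINT x|lborel. v k x * \<phi> x) - (LINT x|lborel. w x * \<phi> x)))\<^sup>2)
       \<le> l2sq (\<lambda>x. v k x - w x) * l2sq \<phi>" for k
  proof -
    have "(LINT x|lborel. v k x * \<phi> x) - (LINT x|lborel. w x * \<phi> x) = (LINT x|lborel. (v k x - w x) * \<phi> x)"
      unfolding left_diff_distrib
      by (rule Bochner_Integration.integral_diff[symmetric]) (intro l2_mult_integrable fin; measurable)+
    then have "ennreal (norm ((LINT x|lborel. v k x * \<phi> x) - (LINT x|lborel. w x * \<phi> x)))
       \<le> (\<integral>\<^sup>+x. ennreal (norm ((v k x - w x) * \<phi> x)) \<partial>lborel)"
      using norm_integral_le_nn_integral by metis
    then have "(ennreal (norm ((LINT x|lborel. v k x * \<phi> x) - (LINT x|lborel. w x * \<phi> x))))\<^sup>2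
       \<le> (\<integral>\<^sup>+x. ennreal (norm ((v k x - w x) * \<phi> x)) \<partial>lborel)\<^sup>2"
      by (rule power_mono) simp
    also have "\<dots> \<le> l2sq (\<lambda>x. v k x - w x) * l2sq \<phi>"
      by (rule l2_Cauchy_Schwarz) measurable
    finally show ?thesis by (simp add: ennreal_power)
  qed
  have "(\<lambda>k. l2sq \<phi> * l2sq (\<lambda>x. v k x - w x)) \<longlonglongrightarrow> l2sq \<phi> * 0"
    using fin(3) by (intro ennreal_tendsto_cmult lim) simp
  then have "(\<lambda>k. l2sq (\<lambda>x. v k x - w x) * l2sq \<phi>) \<longlonglongrightarrow> 0" by (simp add: mult.commute)
  then have "(\<lambda>k. ennreal ((norm ((LINT x|lborel. v k x * \<phi> x) - (LINT x|lborel. w x * \<phi> x)))\<^sup>2)) \<longlonglongrightarrow> 0"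
    by (rule ennreal_tendsto_zero_le) (rule *)
  then have "(\<lambda>k. ennreal ((norm ((LINT x|lborel. v k x * \<phi> x) - (LINT x|lborel. w x * \<phi> x)))\<^sup>2)) \<longlonglongrightarrow> ennreal 0"
    by simp
  then have "(\<lambda>k. (norm ((LINT x|lborel. v k x * \<phi> x) - (LINT x|lborel. w x * \<phi> x)))\<^sup>2) \<longlonglongrightarrow> 0"
    by (subst (asm) tendsto_ennreal_iff) auto
  then have "(\<lambda>k. sqrt ((norm ((LINT x|lborel. v k x * \<phi> x) - (LINT x|lborel. w x * \<phi> x)))\<^sup>2)) \<longlonglongrightarrow> sqrt 0"
    by (rule tendsto_real_sqrt)
  then have "(\<lambda>k. (LINT x|lborel. v k x * \<phi> x) - (LINT x|lborel. w x * \<phi> x)) \<longlonglongrightarrow> 0"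
    by (simp add: tendsto_norm_zero_iff)
  then show ?thesis using Lim_null by blast
qed

text \<open>The transform is extended from integrable functions: the truncations \<open>t n\<close>
  are integrable and converge to \<open>h\<close> in \<open>L^2\<close>, and the Plancherel
  inequality makes the transforms of a fast subsequence converge almost everywhere. The limit
  \<open>H\<close> is pinned down by transposition against Schwartz functions, the form in which
  \<open>represents\<close> tests a distribution.\<close>

theorem l2_fourier_exists:
  assumes [measurable]: "h \<in> borel_measurable borel" and fin: "l2sq h < \<infinity>"
  obtains H where "H \<in> borel_measurable borel" "l2sq H \<le> ennreal (2 * pi) * l2sq h"
    "\<And>\<phi>. \<phi> \<in> schwartz \<Longrightarrow> (LINT x|lborel. h x * fourier \<phi> x) = (LINT x|lborel. H x * \<phi> x)"
proof -
  define t where "t = (\<lambda>n x. indicator {- real n..real n} x * h x)"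
  have [measurable]: "t n \<in> borel_measurable borel" for n unfolding t_def by measurable
  have t_le: "norm (t n x) \<le> norm (h x)" for n x by (auto simp: t_def indicator_def)
  have t_fin: "l2sq (t n) < \<infinity>" for n
    using le_less_trans[OF nn_integral_mono fin] t_le by (simp add: power_mono)
  have t_int: "integrable lborel (t n)" for n
  proof -
    have "integrable lborel (\<lambda>x. indicator {- real n..real n} x * h x)"
    proof (rule l2_mult_integrable[OF _ _ _ fin])
      have "l2sq (\<lambda>x. indicator {- real n..real n} x :: complex) = (\<integral>\<^sup>+x. indicator {- real n..real n} x \<partial>lborel)"
        by (intro nn_integral_cong) (auto simp: indicator_def)
      then show "l2sq (\<lambda>x. indicator {- real n..real n} x :: complex) < \<infinity>" by simp
    qed auto
    then show ?thesis by (simp add: t_def)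
  qed
  have t_lim: "(\<lambda>n. l2sq (\<lambda>x. t n x - h x)) \<longlonglongrightarrow> 0"
  proof -
    have "(\<lambda>n. l2sq (\<lambda>x. t n x - h x)) \<longlonglongrightarrow> (\<integral>\<^sup>+(x::real). 0 \<partial>lborel)"
    proof (rule nn_integral_dominated_convergence[where w = "\<lambda>x. ennreal ((norm (h x))\<^sup>2)"])
      show "(\<integral>\<^sup>+x. ennreal ((norm (h x))\<^sup>2) \<partial>lborel) < \<infinity>" by (rule fin)
      show "AE x in lborel. ennreal ((norm (t n x - h x))\<^sup>2) \<le> ennreal ((norm (h x))\<^sup>2)" for n
        by (auto simp: t_def indicator_def)
      show "AE x in lborel. (\<lambda>n. ennreal ((norm (t n x - h x))\<^sup>2)) \<longlonglongrightarrow> 0"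
      proof (rule AE_I2)
        fix x
        have "\<forall>\<^sub>F n in sequentially. ennreal ((norm (t n x - h x))\<^sup>2) = 0"
          using eventually_ge_at_top[of "nat \<lceil>\<bar>x\<bar>\<rceil>"]
        proof eventually_elim
          case (elim n)
          then have "\<bar>x\<bar> \<le> real n" by linarith
          then show ?case by (auto simp: t_def indicator_def)
        qed
        then show "(\<lambda>n. ennreal ((norm (t n x - h x))\<^sup>2)) \<longlonglongrightarrow> 0" by (rule tendsto_eventually)
      qed
    qed measurable
    then show ?thesis by simp
  qed
  have ex: "\<exists>n. l2sq (\<lambda>x. t n x - h x) \<le> ennreal ((1/4) ^ k)" for k
  proof -
    have "\<forall>\<^sub>F n in sequentially. l2sq (\<lambda>x. t n x - h x) < ennreal ((1/4) ^ k)"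
      using t_lim by (rule order_tendstoD) simp
    then show ?thesis by (metis (no_types, lifting) eventually_sequentially less_imp_le order_refl)
  qed
  \<comment> \<open>The indices \<open>r k\<close> need not increase; the later estimates use only
    the distance of \<open>t (r k)\<close> to \<open>h\<close>.\<close>
  then obtain r where r: "\<And>k. l2sq (\<lambda>x. t (r k) x - h x) \<le> ennreal ((1/4) ^ k)" by metis
  have d: "l2sq (\<lambda>x. t (r k) x - t (r l) x) \<le> ennreal (4 * (1/4) ^ k)" if "l \<ge> k" for k l
  proof -
    have "l2sq (\<lambda>x. t (r k) x - t (r l) x) \<le> ennreal 2 * l2sq (\<lambda>x. t (r k) x - h x) + ennreal 2 * l2sq (\<lambda>x. t (r l) x - h x)"
      using l2sq_diff_le[of "\<lambda>x. t (r k) x - h x" "\<lambda>x. t (r l) x - h x"] by simp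
    also have "\<dots> \<le> ennreal 2 * ennreal ((1/4) ^ k) + ennreal 2 * ennreal ((1/4) ^ l)"
      by (intro add_mono mult_left_mono r) auto
    also have "\<dots> = ennreal (2 * (1/4) ^ k + 2 * (1/4) ^ l)"
      by (subst (1 2) ennreal_mult[symmetric], simp_all del: ennreal_plus add: ennreal_plus[symmetric])
    also have "\<dots> \<le> ennreal (4 * (1/4) ^ k)"
      using power_decreasing[OF that, of "1/4::real"] by (intro ennreal_leI) linarith
    finally show ?thesis .
  qed
  define u where "u = (\<lambda>k. fourier (t (r k)))"
  have [measurable]: "u k \<in> borel_measurable borel" for k unfolding u_def by measurable
  have ud: "l2sq (\<lambda>x. u k x - u l x) \<le> ennreal (8 * pi * (1/4) ^ k)" if "l \<ge> k" for k l
  proof -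
    have "l2sq (\<lambda>x. u k x - u l x) = l2sq (fourier (\<lambda>x. t (r k) x - t (r l) x))"
      by (simp add: u_def fourier_diff t_int)
    also have "\<dots> \<le> ennreal (2 * pi) * l2sq (\<lambda>x. t (r k) x - t (r l) x)"
      by (intro plancherel_inequality Bochner_Integration.integrable_diff t_int)
    also have "\<dots> \<le> ennreal (2 * pi) * ennreal (4 * (1/4) ^ k)" by (intro mult_left_mono d that) auto
    also have "\<dots> = ennreal (8 * pi * (1/4) ^ k)" by (subst ennreal_mult[symmetric]) (auto simp: mult_ac)
    finally show ?thesis .
  qed
  have u_le: "l2sq (u k) \<le> ennreal (2 * pi) * l2sq h" for k
  proof -
    have "l2sq (u k) \<le> ennreal (2 * pi) * l2sq (t (r k))" unfolding u_def by (intro plancherel_inequality t_int)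
    also have "\<dots> \<le> ennreal (2 * pi) * l2sq h"
      by (intro mult_left_mono nn_integral_mono ennreal_leI power_mono t_le) simp_all
    finally show ?thesis .
  qed
  have conv: "AE x in lborel. convergent (\<lambda>k. u k x)"
    by (rule l2_fast_Cauchy_AE_convergent[of _ "8 * pi"]) (use ud in \<open>auto simp: norm_minus_commute\<close>)
  define H where "H = (\<lambda>x. lim (\<lambda>k. u k x))"
  have [measurable]: "H \<in> borel_measurable borel" unfolding H_def by measurable
  have lim: "AE x in lborel. (\<lambda>k. u k x) \<longlonglongrightarrow> H x"
    using conv by eventually_elim (simp add: H_def convergent_LIMSEQ_iff)
  have H_le: "l2sq H \<le> ennreal (2 * pi) * l2sq h"
    by (rule l2sq_liminf[OF _ lim, of 0]) (auto intro: u_le)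
  have H_fin: "l2sq H < \<infinity>" and u_fin: "l2sq (u k) < \<infinity>" for k
    using le_less_trans[OF H_le] le_less_trans[OF u_le] fin by (auto simp: ennreal_mult_less_top)
  have "l2sq (\<lambda>x. u k x - H x) \<le> ennreal (8 * pi * (1/4) ^ k)" for k
  proof (rule l2sq_liminf[of "\<lambda>l x. u k x - u l x" _ k])
    show "AE x in lborel. (\<lambda>l. u k x - u l x) \<longlonglongrightarrow> u k x - H x"
      using lim by eventually_elim (intro tendsto_intros)
  qed (use ud in auto)
  note uH_le = this
  have "(\<lambda>k. ennreal (8 * pi * (1/4) ^ k)) \<longlonglongrightarrow> ennreal (8 * pi * 0)"
    by (intro tendsto_ennrealI tendsto_mult tendsto_const LIMSEQ_power_zero) simp
  then have "(\<lambda>k. ennreal (8 * pi * (1/4) ^ k)) \<longlonglongrightarrow> 0" by simp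
  then have uH: "(\<lambda>k. l2sq (\<lambda>x. u k x - H x)) \<longlonglongrightarrow> 0"
    by (rule ennreal_tendsto_zero_le) (rule uH_le)
  have "(\<lambda>k. ennreal ((1/4) ^ k)) \<longlonglongrightarrow> ennreal 0"
    by (intro tendsto_ennrealI LIMSEQ_power_zero) simp
  then have "(\<lambda>k. ennreal ((1/4) ^ k)) \<longlonglongrightarrow> 0" by simp
  then have th: "(\<lambda>k. l2sq (\<lambda>x. t (r k) x - h x)) \<longlonglongrightarrow> 0"
    by (rule ennreal_tendsto_zero_le) (rule r)
  have "(LINT x|lborel. h x * fourier \<phi> x) = (LINT x|lborel. H x * \<phi> x)" if \<phi>: "\<phi> \<in> schwartz" for \<phi>
  proof -
    have f\<phi>: "fourier \<phi> \<in> schwartz" using fourier_schwartz \<phi> .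
    have [measurable]: "\<phi> \<in> borel_measurable borel" "fourier \<phi> \<in> borel_measurable borel"
      using \<phi> f\<phi> schwartz_measurable by blast+
    have 1: "(\<lambda>k. LINT x|lborel. t (r k) x * fourier \<phi> x) \<longlonglongrightarrow> (LINT x|lborel. h x * fourier \<phi> x)"
      by (rule l2_integral_tendsto) (use t_fin fin schwartz_l2[OF f\<phi>] th in auto)
    have 2: "(\<lambda>k. LINT x|lborel. u k x * \<phi> x) \<longlonglongrightarrow> (LINT x|lborel. H x * \<phi> x)"
      by (rule l2_integral_tendsto) (use u_fin H_fin schwartz_l2[OF \<phi>] uH in auto)
    have "(LINT x|lborel. t (r k) x * fourier \<phi> x) = (LINT x|lborel. u k x * \<phi> x)" for k
      unfolding u_def by (intro fourier_multiplication_formula t_int schwartz_integrable \<phi>)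
    then show ?thesis using LIMSEQ_unique[OF 1] 2 by simp
  qed
  with H_le show thesis by (intro that[of H]) auto
qed

subsection \<open>Functions representing a distribution\<close>

text \<open>Half-open intervals are stable under intersection and generate the Borel sets, so the
  vanishing of the integral spreads to all Borel sets. Complements are reached through the vanishing
  total integral \<open>0\<close>.\<close>

lemma integral_intervals_zero_imp_AE_zero:
  fixes G :: "real \<Rightarrow> complex"
  assumes G: "integrable lborel G" and 0: "(LINT x|lborel. G x) = 0"
    and I: "\<And>a b. a < b \<Longrightarrow> (LINT x:{a<..b}|lborel. G x) = 0"
  shows "AE x in lborel. G x = 0"
proof (rule sigma_finite_measure.density_zero[OF sigma_finite_lborel G])
  fix A :: "real set" assume "A \<in> sets lborel"
  then have A: "A \<in> sigma_sets UNIV (range (\<lambda>(a, b). {a<..b::real}))"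
    by (simp add: borel_sigma_sets_Ioc)
  have si: "set_integrable lborel B G" if "B \<in> sets borel" for B
    using integrable_mult_indicator[of B lborel G] that G by (simp add: set_integrable_def)
  have sb: "B \<in> sets borel" if "B \<in> sigma_sets UNIV (range (\<lambda>(a, b). {a<..b::real}))" for B
    using that by (simp add: borel_sigma_sets_Ioc)
  have "Int_stable (range (\<lambda>(a, b). {a<..b::real}))"
    by (auto simp: Int_stable_def)
  then show "(LINT x:A|lborel. G x) = 0"
    using subset_UNIV[of "range (\<lambda>(a, b). {a<..b::real})", folded Pow_UNIV] A
  proof (induction rule: sigma_sets_induct_disjoint)
    case (basic B)
    then obtain a b where B: "B = {a<..b}" by auto
    then show ?case using I[of a b] by (cases "a < b") (auto simp: set_lebesgue_integral_def)
  next
    case (compl B)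
    have B: "B \<in> sets borel" using sb compl(1) by auto
    have "(LINT x:UNIV - B|lborel. G x) + (LINT x:B|lborel. G x) = (LINT x:(UNIV - B) \<union> B|lborel. G x)"
      by (rule set_integral_Un[symmetric]) (use B si in auto)
    also have "(UNIV - B) \<union> B = UNIV" by auto
    finally show ?case using compl 0 by (simp add: set_lebesgue_integral_def)
  next
    case (union B)
    have Bi [measurable]: "B i \<in> sets borel" for i using sb union(2) by blast
    have "(LINT x:\<Union>(range B)|lborel. G x) = (\<Sum>i. LINT x:B i|lborel. G x)"
      by (rule lebesgue_integral_countable_add) (use union(1) in \<open>auto simp: disjoint_family_on_def intro!: si\<close>)
    then show ?case using union by simp
  qed (auto simp: set_lebesgue_integral_def)
qed

text \<open>Uniqueness: the functions $e^{-x^2-((x-c)/r)^{2k}}$ are Schwartz and converge, as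
  $k\to\infty$, to $e^{-x^2}$ times the indicator of the interval of radius $r$ around $c$.\<close>

lemma represents_unique:
  assumes 1: "represents u h1" and 2: "represents u h2"
  shows "AE x in lborel. h1 x = h2 x"
proof -
  define D where "D = (\<lambda>x. h1 x - h2 x)"
  have [measurable]: "h1 \<in> borel_measurable borel" "h2 \<in> borel_measurable borel" "D \<in> borel_measurable borel"
    using 1 2 by (auto simp: represents_def D_def)
  have D: "integrable lborel (\<lambda>x. D x * \<phi> x)" "(LINT x|lborel. D x * \<phi> x) = 0" if "\<phi> \<in> schwartz" for \<phi>
  proof -
    have i: "integrable lborel (\<lambda>x. h1 x * \<phi> x)" "integrable lborel (\<lambda>x. h2 x * \<phi> x)"
      and e: "(LINT x|lborel. h1 x * \<phi> x) = (LINT x|lborel. h2 x * \<phi> x)"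
      using 1 2 that unfolding represents_def by metis+
    show "integrable lborel (\<lambda>x. D x * \<phi> x)" "(LINT x|lborel. D x * \<phi> x) = 0"
      unfolding D_def left_diff_distrib using i e by auto
  qed
  \<comment> \<open>\<open>D\<close> itself need not be integrable. The Gaussian makes it so, and
    since it has no zeros nothing is lost when it is divided out at the end.\<close>
  define G where "G = (\<lambda>x. D x * of_real (exp (- x\<^sup>2)))"
  have s0: "(\<lambda>x. complex_of_real (exp (- x\<^sup>2))) \<in> schwartz"
    using exp_poly_schwartz[of "[:0, 0, 1:]" 1] by (simp add: power2_eq_square)
  have G: "integrable lborel G" "(LINT x|lborel. G x) = 0"
    unfolding G_def using D[OF s0] by auto
  have "AE x in lborel. G x = 0"
  proof (rule integral_intervals_zero_imp_AE_zero[OF G])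
    fix a b :: real assume "a < b"
    define c where "c = (a + b) / 2"
    define r where "r = (b - a) / 2"
    have r: "r > 0" "a = c - r" "b = c + r" using \<open>a < b\<close> by (auto simp: c_def r_def field_simps)
    define q where "q = (\<lambda>k. [:0, 0, 1:] + [:- c / r, 1 / r:] ^ (2 * k))"
    have q: "poly (q k) x = x\<^sup>2 + (((x - c) / r)\<^sup>2) ^ k" for k x
    proof -
      have "poly [:- c / r, 1 / r:] x = (x - c) / r" by (simp add: diff_divide_distrib)
      then show ?thesis unfolding q_def poly_add poly_power power_mult by (simp add: power2_eq_square)
    qed
    have s: "(\<lambda>x. complex_of_real (exp (- poly (q k) x))) \<in> schwartz" for k
      using exp_poly_schwartz[of "q k" 1] by (simp add: q)
    have eq: "D x * of_real (exp (- poly (q k) x)) = of_real (exp (- ((((x - c) / r)\<^sup>2) ^ k))) * G x" for k x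
      unfolding q G_def minus_add_distrib exp_add of_real_mult by (simp only: mult_ac)
    have z: "(LINT x|lborel. of_real (exp (- ((((x - c) / r)\<^sup>2) ^ k))) * G x) = 0" for k
      using D(2)[OF s[of k]] unfolding eq .
    have "(\<lambda>k. LINT x|lborel. of_real (exp (- ((((x - c) / r)\<^sup>2) ^ k))) * G x) \<longlonglongrightarrow>
       (LINT x|lborel. indicator {a<..b} x *\<^sub>R G x)"
    proof (rule integral_dominated_convergence)
      show "integrable lborel (\<lambda>x. norm (G x))" using G by auto
      show "AE x in lborel. norm (of_real (exp (- ((((x - c) / r)\<^sup>2) ^ k))) * G x) \<le> norm (G x)" for k
        by (auto simp: norm_mult intro!: mult_left_le_one_le)
      \<comment> \<open>At the endpoints the base \<open>y\<close> equals 1 and the factor stays at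
        exp (-1), so these two points are discarded as a null set.\<close>
      have "AE x in lborel. x \<noteq> a" "AE x in lborel. x \<noteq> b" by (auto intro: AE_lborel_singleton)
      then show "AE x in lborel. (\<lambda>k. of_real (exp (- ((((x - c) / r)\<^sup>2) ^ k))) * G x) \<longlonglongrightarrow> indicator {a<..b} x *\<^sub>R G x"
      proof eventually_elim
        case (elim x)
        define y where "y = ((x - c) / r)\<^sup>2"
        have y0: "y \<ge> 0" by (simp add: y_def)
        have "(\<lambda>k. exp (- (y ^ k))) \<longlonglongrightarrow> indicator {a<..b} x"
        proof (cases "x \<in> {a<..b}")
          case True
          then have "\<bar>(x - c) / r\<bar> < 1" using r elim by (auto simp: abs_less_iff field_simps)
          then have "y < 1" unfolding y_def by (simp add: abs_square_less_1)
          then have "(\<lambda>k. exp (- (y ^ k))) \<longlonglongrightarrow> exp (- 0)"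
            using y0 by (intro tendsto_intros LIMSEQ_power_zero) auto
          then show ?thesis using True by simp
        next
          case False
          then have "\<bar>(x - c) / r\<bar> > 1" using r elim by (auto simp: field_simps abs_if split: if_splits)
          then have "y > 1" unfolding y_def by (metis one_less_power power2_abs zero_less_numeral)
          then have "filterlim (\<lambda>k. y ^ k) at_top sequentially" by real_asymp
          then have "(\<lambda>k. exp (- (y ^ k))) \<longlonglongrightarrow> 0"
            by (intro filterlim_compose[OF exp_at_bot] filterlim_compose[OF filterlim_uminus_at_bot_at_top])
          then show ?thesis using False by simp
        qed
        then have "(\<lambda>k. complex_of_real (exp (- (y ^ k))) * G x) \<longlonglongrightarrow> of_real (indicator {a<..b} x) * G x"
          by (intro tendsto_intros)
        then show ?case unfolding y_def scaleR_conv_of_real .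
      qed
    qed (use G in measurable)
    then show "(LINT x:{a<..b}|lborel. G x) = 0"
      unfolding z set_lebesgue_integral_def using LIMSEQ_unique tendsto_const by blast
  qed
  then show ?thesis by eventually_elim (simp add: G_def D_def)
qed

lemma represents_distr_fun: "represents u h \<Longrightarrow> represents u (distr_fun u)"
  unfolding distr_fun_def by (rule someI[where P = "represents u"])

lemma distr_fun_AE_eq: "represents u h \<Longrightarrow> AE x in lborel. distr_fun u x = h x"
  by (rule represents_unique[OF represents_distr_fun])

lemma distr_fun_measurable: "represents u h \<Longrightarrow> distr_fun u \<in> borel_measurable borel"
  using represents_distr_fun[THEN iffD1[OF represents_def], THEN conjunct1] by simp

lemma l2_represents_integrable:
  assumes "h \<in> borel_measurable borel" "l2sq h < \<infinity>" "\<phi> \<in> schwartz"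
  shows "integrable lborel (\<lambda>x. h x * \<phi> x)"
  by (rule l2_mult_integrable[OF assms(1) schwartz_measurable[OF assms(3)] assms(2) schwartz_l2[OF assms(3)]])

section \<open>Sobolev norms expressed on the Fourier side\<close>

lemma l2sq_finite_iff:
  assumes [measurable]: "h \<in> borel_measurable borel"
  shows "l2sq h < \<top> \<longleftrightarrow> integrable lborel (\<lambda>x. (norm (h x))\<^sup>2)"
  by (simp add: integrable_iff_bounded)

text \<open>The norm is defined through a chosen representative; almost everywhere uniqueness lets
  any square integrable representative compute it.\<close>

lemma sobolev_norm_eq:
  assumes "represents (bessel_op s u) h" "l2sq h < \<infinity>"
  shows "ennreal ((sobolev_norm s u)\<^sup>2) = l2sq h"
proof -
  have [measurable]: "h \<in> borel_measurable borel"
    using assms(1) by (simp add: represents_def)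
  have [measurable]: "distr_fun (bessel_op s u) \<in> borel_measurable borel"
    by (rule distr_fun_measurable[OF assms(1)])
  have ae: "AE x in lborel. distr_fun (bessel_op s u) x = h x" by (rule distr_fun_AE_eq[OF assms(1)])
  have "(LINT x|lborel. (norm (distr_fun (bessel_op s u) x))\<^sup>2) = (LINT x|lborel. (norm (h x))\<^sup>2)"
    by (rule integral_cong_AE) (use ae in \<open>auto elim: eventually_mono\<close>)
  then have "(sobolev_norm s u)\<^sup>2 = (LINT x|lborel. (norm (h x))\<^sup>2)"
    unfolding sobolev_norm_def by simp
  then show ?thesis using assms(2) by (subst nn_integral_eq_integral) (auto simp: l2sq_finite_iff)
qed

abbreviation bessel_weight :: "real \<Rightarrow> real \<Rightarrow> real" where
  "bessel_weight a \<xi> \<equiv> (1 + \<xi>\<^sup>2) powr a"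

lemma bessel_weight_inverse: "bessel_weight a \<xi> * bessel_weight (- a) \<xi> = 1"
  unfolding powr_add[symmetric] by (simp add: one_plus_square_neq_zero)

text \<open>If \<open>h\<close> represents the Bessel potential of \<open>f\<close> and
  \<open>H\<close> is its \<open>L^2\<close> transform, then the transform of \<open>f\<close>
  should be \<open>H\<close> with the weight divided out. This is \<open>k\<close>; the weighted
  norm of \<open>k\<close> is then the plain norm of \<open>H\<close>, bounded by the Plancherel
  inequality.\<close>

theorem sobolev_fourier:
  assumes f: "f \<in> sobolev s"
  defines "g \<equiv> distr_fun (distr_fourier f)"
  shows "g \<in> borel_measurable borel"
    and "(\<integral>\<^sup>+\<xi>. ennreal (bessel_weight s \<xi> * (norm (g \<xi>))\<^sup>2) \<partial>lborel) \<le> ennreal (2 * pi * (sobolev_norm s f)\<^sup>2)"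
proof -
  obtain h where h: "represents (bessel_op s f) h" "integrable lborel (\<lambda>x. (norm (h x))\<^sup>2)"
    using f unfolding sobolev_def by blast
  have [measurable]: "h \<in> borel_measurable borel" using h(1) by (simp add: represents_def)
  have fin: "l2sq h < \<infinity>" using h(2) by (simp add: l2sq_finite_iff)
  obtain H where [measurable]: "H \<in> borel_measurable borel" and H: "l2sq H \<le> ennreal (2 * pi) * l2sq h"
    and hH: "\<And>\<phi>. \<phi> \<in> schwartz \<Longrightarrow> (LINT x|lborel. h x * fourier \<phi> x) = (LINT x|lborel. H x * \<phi> x)"
    using l2_fourier_exists[OF _ fin] by auto
  have Hfin: "l2sq H < \<infinity>" using le_less_trans[OF H] fin by (auto simp: ennreal_mult_less_top)
  define k where "k = (\<lambda>\<xi>. of_real (bessel_weight (- (s / 2)) \<xi>) * H \<xi>)"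
  have [measurable]: "k \<in> borel_measurable borel" unfolding k_def by measurable
  have rep: "represents (distr_fourier f) k"
    unfolding represents_def
  proof (intro conjI ballI)
    fix \<psi> assume \<psi>: "\<psi> \<in> schwartz"
    \<comment> \<open>Tested on \<open>fourier \<eta>\<close>, the operator \<open>bessel_op\<close>
      first inverts the transform and then multiplies by the weight, which returns
      \<open>\<psi>\<close>.\<close>
    define \<eta> where "\<eta> = (\<lambda>\<xi>. of_real (bessel_weight (- (s / 2)) \<xi>) * \<psi> \<xi>)"
    have \<eta>: "\<eta> \<in> schwartz" unfolding \<eta>_def by (rule schwartz_weight[OF \<psi>])
    have k\<eta>: "k \<xi> * \<psi> \<xi> = H \<xi> * \<eta> \<xi>" for \<xi> by (simp add: k_def \<eta>_def)
    show "integrable lborel (\<lambda>x. k x * \<psi> x)"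
      unfolding k\<eta> by (rule l2_represents_integrable[OF _ Hfin \<eta>]) simp
    have "of_real (bessel_weight (s / 2) \<xi>) * \<eta> \<xi> = \<psi> \<xi>" for \<xi>
    proof -
      have "of_real (bessel_weight (s / 2) \<xi>) * \<eta> \<xi> = of_real (bessel_weight (s / 2) \<xi> * bessel_weight (- (s / 2)) \<xi>) * \<psi> \<xi>"
        by (simp only: \<eta>_def of_real_mult mult.assoc)
      then show ?thesis unfolding bessel_weight_inverse by simp
    qed
    then have "distr_fourier f \<psi> = bessel_op s f (fourier \<eta>)"
      unfolding distr_fourier_def bessel_op_def inv_fourier_fourier[OF \<eta>] by simp
    also have "\<dots> = (LINT x|lborel. h x * fourier \<eta> x)"
      using h(1) fourier_schwartz[OF \<eta>] unfolding represents_def by blast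
    also have "\<dots> = (LINT x|lborel. k x * \<psi> x)" unfolding k\<eta> by (rule hH[OF \<eta>])
    finally show "distr_fourier f \<psi> = (LINT x|lborel. k x * \<psi> x)" .
  qed simp
  show "g \<in> borel_measurable borel" unfolding g_def by (rule distr_fun_measurable[OF rep])
  have ae: "AE \<xi> in lborel. g \<xi> = k \<xi>" unfolding g_def by (rule distr_fun_AE_eq[OF rep])
  have "(\<integral>\<^sup>+\<xi>. ennreal (bessel_weight s \<xi> * (norm (g \<xi>))\<^sup>2) \<partial>lborel) = l2sq H"
  proof (rule nn_integral_cong_AE, use ae in eventually_elim)
    case (elim \<xi>)
    have "bessel_weight s \<xi> * (norm (g \<xi>))\<^sup>2 = bessel_weight s \<xi> * (bessel_weight (- (s / 2)) \<xi> * bessel_weight (- (s / 2)) \<xi>) * (norm (H \<xi>))\<^sup>2"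
      by (simp add: elim k_def norm_mult power_mult_distrib power2_eq_square)
    also have "bessel_weight (- (s / 2)) \<xi> * bessel_weight (- (s / 2)) \<xi> = bessel_weight (- s) \<xi>"
      unfolding powr_add[symmetric] by simp
    finally show ?case unfolding bessel_weight_inverse by simp
  qed
  also have "\<dots> \<le> ennreal (2 * pi) * ennreal ((sobolev_norm s f)\<^sup>2)"
    unfolding sobolev_norm_eq[OF h(1) fin] by (rule H)
  also have "\<dots> = ennreal (2 * pi * (sobolev_norm s f)\<^sup>2)" by (rule ennreal_mult[symmetric]) auto
  finally show "(\<integral>\<^sup>+\<xi>. ennreal (bessel_weight s \<xi> * (norm (g \<xi>))\<^sup>2) \<partial>lborel) \<le> ennreal (2 * pi * (sobolev_norm s f)\<^sup>2)" .
qed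

lemma sobolev_norm_nonneg: "sobolev_norm s f \<ge> 0"
  unfolding sobolev_norm_def by (intro real_sqrt_ge_zero Bochner_Integration.integral_nonneg) auto

text \<open>The distribution with Fourier transform \<open>g\<close>, written by transposition:
  inserting \<open>fourier \<phi>\<close> leaves the integral of \<open>g\<close> against
  \<open>\<phi>\<close>, by inversion on Schwartz functions.\<close>

definition fourier_synthesis :: "(real \<Rightarrow> complex) \<Rightarrow> distr" where
  "fourier_synthesis g \<phi> = (LINT \<xi>|lborel. g \<xi> * inv_fourier \<phi> \<xi>)"

lemma
  assumes g: "integrable lborel g"
  defines "f \<equiv> fourier_synthesis g"
  shows tempered_fourier_synthesis: "tempered_distribution f"
    and distr_fourier_synthesis: "represents (distr_fourier f) g"
proof -
  have i: "integrable lborel (\<lambda>\<xi>. g \<xi> * \<psi> \<xi>)" if "\<psi> \<in> schwartz" for \<psi>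
    using integrable_bounded_mult[OF g, of \<psi> "schwartz_seminorm 0 0 \<psi>"] schwartz_bounded[OF that] schwartz_measurable[OF that]
    by (simp add: mult.commute)
  show "tempered_distribution f"
    unfolding tempered_distribution_def
  proof (intro conjI ballI allI)
    fix \<phi> \<psi> assume \<phi>: "\<phi> \<in> schwartz" and \<psi>: "\<psi> \<in> schwartz"
    have ci: "integrable lborel (\<lambda>\<xi>. cis (x * \<xi>) * \<phi> \<xi>)" if "\<phi> \<in> schwartz" for \<phi> x
      by (intro integrable_cis_mult schwartz_integrable that) simp
    have "inv_fourier (\<lambda>x. \<phi> x + \<psi> x) = (\<lambda>x. inv_fourier \<phi> x + inv_fourier \<psi> x)"
      unfolding inv_fourier_def using ci[OF \<phi>] ci[OF \<psi>] by (simp add: algebra_simps)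
    then show "f (\<lambda>x. \<phi> x + \<psi> x) = f \<phi> + f \<psi>"
      unfolding f_def fourier_synthesis_def using i[OF inv_fourier_schwartz[OF \<phi>]] i[OF inv_fourier_schwartz[OF \<psi>]]
      by (simp add: distrib_left)
  next
    fix \<phi> c assume \<phi>: "\<phi> \<in> schwartz"
    have "inv_fourier (\<lambda>x. c * \<phi> x) = (\<lambda>x. c * inv_fourier \<phi> x)"
      unfolding inv_fourier_def by (simp add: mult.left_commute[of _ c])
    then show "f (\<lambda>x. c * \<phi> x) = c * f \<phi>"
      unfolding f_def fourier_synthesis_def by (simp add: mult.left_commute[of _ c])
  next
    \<comment> \<open>\<open>J\<close> converts the seminorms of orders 0 and 2 into an
      \<open>L^1\<close> bound, hence a uniform bound for \<open>inv_fourier \<phi>\<close>. This is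
      why the order \<open>K = 2\<close> suffices for temperedness.\<close>
    define J where "J = (LINT x|lborel. inverse (1 + (x::real)\<^sup>2))"
    define C where "C = (LINT \<xi>|lborel. norm (g \<xi>)) * (1 / (2 * pi) * J)"
    have J0: "J \<ge> 0" unfolding J_def by (intro Bochner_Integration.integral_nonneg) auto
    have C0: "C \<ge> 0" unfolding C_def using J0 by (intro mult_nonneg_nonneg Bochner_Integration.integral_nonneg) auto
    have "norm (f \<phi>) \<le> C * (\<Sum>j\<le>2. \<Sum>n\<le>2. schwartz_seminorm j n \<phi>)" if \<phi>: "\<phi> \<in> schwartz" for \<phi>
    proof -
      define S where "S = schwartz_seminorm 0 0 \<phi> + schwartz_seminorm 2 0 \<phi>"
      have nn: "schwartz_seminorm j n \<phi> \<ge> 0" for j n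
      proof -
        have "bdd_above (range (\<lambda>x. \<bar>x\<bar> ^ j * norm ((vderiv ^^ n) \<phi> x)))" using \<phi> unfolding schwartz_def by fast
        then show ?thesis unfolding schwartz_seminorm_def
          by (intro cSUP_upper2[of _ _ 0]) auto
      qed
      have iv: "norm (inv_fourier \<phi> \<xi>) \<le> 1 / (2 * pi) * (J * S)" for \<xi>
      proof -
        have "norm (LINT x|lborel. cis (\<xi> * x) * \<phi> x) \<le> (LINT x|lborel. norm (\<phi> x))"
          by (rule order_trans[OF integral_norm_bound]) (simp add: norm_mult)
        also have "\<dots> \<le> (LINT x|lborel. S * inverse (1 + x\<^sup>2))"
          using schwartz_norm_le[OF \<phi>] unfolding S_def
          by (intro integral_mono integrable_norm schwartz_integrable \<phi> integrable_mult_right integrable_inverse_one_plus_sq)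
        also have "\<dots> = J * S" by (simp add: J_def mult.commute)
        finally show ?thesis unfolding inv_fourier_def norm_mult norm_of_real by (simp add: divide_right_mono)
      qed
      have "norm (f \<phi>) \<le> (LINT \<xi>|lborel. norm (g \<xi> * inv_fourier \<phi> \<xi>))"
        unfolding f_def fourier_synthesis_def by (rule integral_norm_bound)
      also have "\<dots> \<le> (LINT \<xi>|lborel. norm (g \<xi>) * (1 / (2 * pi) * (J * S)))"
        by (intro integral_mono integrable_norm i inv_fourier_schwartz \<phi> integrable_mult_left g)
           (auto simp only: norm_mult intro!: mult_left_mono iv norm_ge_zero)
      also have "\<dots> = C * S" by (simp add: C_def)
      also have "S \<le> (\<Sum>j\<le>2. \<Sum>n\<le>2. schwartz_seminorm j n \<phi>)"
        using nn by (simp add: S_def numeral_2_eq_2)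
      finally show ?thesis using C0 by (simp add: mult_left_mono)
    qed
    then show "\<exists>C K. \<forall>\<phi>\<in>schwartz. norm (f \<phi>) \<le> C * (\<Sum>j\<le>K. \<Sum>n\<le>K. schwartz_seminorm j n \<phi>)" by blast
  qed
  show "represents (distr_fourier f) g"
    unfolding represents_def
    using g i by (auto simp: distr_fourier_def f_def fourier_synthesis_def inv_fourier_fourier)
qed

lemma
  assumes [simp]: "integrable lborel g"
    and G: "integrable lborel (\<lambda>\<xi>. of_real (bessel_weight (s / 2) \<xi>) * g \<xi>)" (is "integrable lborel ?G")
    and fin: "l2sq (\<lambda>\<xi>. of_real (bessel_weight (s / 2) \<xi>) * g \<xi>) < \<infinity>"
  shows sobolev_fourier_synthesis: "fourier_synthesis g \<in> sobolev s"
    and sobolev_norm_fourier_synthesis: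
      "ennreal ((sobolev_norm s (fourier_synthesis g))\<^sup>2) \<le> l2sq (\<lambda>\<xi>. of_real (bessel_weight (s / 2) \<xi>) * g \<xi>)"
proof -
  \<comment> \<open>\<open>h\<close> is the inverse transform of the weighted data. Plancherel gives
    the constant (2 pi)^-2 times 2 pi, which is below 1 and is dropped.\<close>
  define h where "h = (\<lambda>x. of_real (1 / (2 * pi)) * fourier ?G (- x))"
  have [measurable]: "?G \<in> borel_measurable borel" using G by auto
  have [measurable]: "h \<in> borel_measurable borel" unfolding h_def by measurable
  have "l2sq h = (\<integral>\<^sup>+x. ennreal ((1 / (2 * pi))\<^sup>2) * ennreal ((norm (fourier ?G (- x)))\<^sup>2) \<partial>lborel)"
    unfolding h_def norm_mult norm_of_real power_mult_distrib power2_abs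
    by (intro nn_integral_cong) (subst ennreal_mult[symmetric], auto)
  also have "\<dots> = ennreal ((1 / (2 * pi))\<^sup>2) * (\<integral>\<^sup>+x. ennreal ((norm (fourier ?G (- x)))\<^sup>2) \<partial>lborel)"
    by (rule nn_integral_cmult) measurable
  also have "(\<integral>\<^sup>+x. ennreal ((norm (fourier ?G (- x)))\<^sup>2) \<partial>lborel) = l2sq (fourier ?G)"
    by (subst nn_integral_real_affine[where c = "-1" and t = 0]) auto
  also have "ennreal ((1 / (2 * pi))\<^sup>2) * \<dots> \<le> ennreal ((1 / (2 * pi))\<^sup>2) * (ennreal (2 * pi) * l2sq ?G)"
    by (intro mult_left_mono plancherel_inequality G) auto
  also have "\<dots> = ennreal ((1 / (2 * pi))\<^sup>2 * (2 * pi)) * l2sq ?G"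
    by (subst ennreal_mult) (auto simp: mult_ac)
  also have "\<dots> \<le> 1 * l2sq ?G"
    using pi_gt3 by (intro mult_right_mono) (auto simp: power2_eq_square field_simps)
  finally have hG: "l2sq h \<le> l2sq ?G" by simp
  have hfin: "l2sq h < \<infinity>" using hG fin by (rule le_less_trans)
  have rep: "represents (bessel_op s (fourier_synthesis g)) h"
    unfolding represents_def
  proof (intro conjI ballI)
    fix \<phi> assume \<phi>: "\<phi> \<in> schwartz"
    show "integrable lborel (\<lambda>x. h x * \<phi> x)" by (rule l2_represents_integrable[OF _ hfin \<phi>]) simp
    have w: "(\<lambda>\<xi>. of_real (bessel_weight (s / 2) \<xi>) * inv_fourier \<phi> \<xi>) \<in> schwartz"
      by (intro schwartz_weight inv_fourier_schwartz \<phi>)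
    have "bessel_op s (fourier_synthesis g) \<phi> = (LINT \<xi>|lborel. ?G \<xi> * inv_fourier \<phi> \<xi>)"
      unfolding bessel_op_def fourier_synthesis_def inv_fourier_fourier[OF w] by (simp add: mult_ac)
    also have "\<dots> = (LINT x|lborel. fourier ?G x * (of_real (1 / (2 * pi)) * \<phi> (- x)))"
      unfolding inv_fourier_conv_fourier
      by (intro fourier_multiplication_formula G schwartz_integrable schwartz_cmult schwartz_reflect \<phi>)
    also have "\<dots> = (LINT x|lborel. h x * \<phi> x)"
      by (subst lborel_integral_real_affine[where c = "-1" and t = 0]) (auto simp: h_def mult_ac)
    finally show "bessel_op s (fourier_synthesis g) \<phi> = (LINT x|lborel. h x * \<phi> x)" .
  qed simp
  show "fourier_synthesis g \<in> sobolev s"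
    unfolding sobolev_def using tempered_fourier_synthesis[of g] rep hfin by (auto simp: l2sq_finite_iff)
  show "ennreal ((sobolev_norm s (fourier_synthesis g))\<^sup>2) \<le> l2sq ?G"
    unfolding sobolev_norm_eq[OF rep hfin] by (rule hG)
qed

subsection \<open>The $L^4$ norm and covering numbers\<close>

text \<open>Removes the fourth root and the separate treatment of infinity, so that all estimates
  can be made for integrals of fourth powers.\<close>

lemma L4_norm_le_iff:
  assumes "c \<ge> 0"
  shows "L4_norm A F \<le> ennreal c \<longleftrightarrow> (\<integral>\<^sup>+x\<in>A. F x ^ 4 \<partial>lborel) \<le> ennreal (c ^ 4)"
proof -
  define I where "I = (\<integral>\<^sup>+x\<in>A. F x ^ 4 \<partial>lborel)"
  show ?thesis
  proof (cases I)
    case (real r)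
    have "r powr (1/4) \<le> c \<longleftrightarrow> r \<le> c ^ 4"
    proof
      assume "r powr (1/4) \<le> c"
      then have "(r powr (1/4)) ^ 4 \<le> c ^ 4" by (intro power_mono) auto
      also have "(r powr (1/4)) ^ 4 = r" using real by (simp add: powr_powr flip: powr_numeral)
      finally show "r \<le> c ^ 4" .
    next
      assume "r \<le> c ^ 4"
      then have "r powr (1/4) \<le> (c ^ 4) powr (1/4)" using real by (intro powr_mono2) auto
      also have "(c ^ 4) powr (1/4) = c" using assms by (simp add: powr_powr flip: powr_numeral)
      finally show "r powr (1/4) \<le> c" .
    qed
    then show ?thesis unfolding L4_norm_def I_def[symmetric] using real assms by (simp add: Let_def)
  next
    case top
    then show ?thesis unfolding L4_norm_def I_def[symmetric] by (simp add: Let_def top_unique)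
  qed
qed

lemma covering_number_le:
  assumes "finite A" "\<Theta> \<subseteq> (\<Union>a\<in>A. {a..a + \<delta>})"
  shows "covering_number \<Theta> \<delta> \<le> card A"
  unfolding covering_number_def by (rule Least_le) (use assms in blast)

text \<open>\<open>LEAST\<close> carries information only once some finite cover is known; hence the
  cover \<open>A\<close> among the hypotheses.\<close>

lemma covering_number_attained:
  assumes "finite A" "\<Theta> \<subseteq> (\<Union>a\<in>A. {a..a + \<delta>})"
  obtains B where "finite B" "card B = covering_number \<Theta> \<delta>" "\<Theta> \<subseteq> (\<Union>a\<in>B. {a..a + \<delta>})"
proof -
  have "\<exists>B. finite B \<and> card B = covering_number \<Theta> \<delta> \<and> \<Theta> \<subseteq> (\<Union>a\<in>B. {a..a + \<delta>})"
    unfolding covering_number_def by (rule LeastI_ex) (use assms in blast)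
  then show thesis using that by blast
qed

lemma interval_cover:
  assumes "\<delta> > 0"
  shows "{a..b} \<subseteq> (\<Union>c\<in>(\<lambda>i. a + real i * \<delta>) ` {..nat \<lfloor>(b - a) / \<delta>\<rfloor>}. {c..c + \<delta>})"
proof
  fix x assume x: "x \<in> {a..b}"
  define i where "i = nat \<lfloor>(x - a) / \<delta>\<rfloor>"
  have "(x - a) / \<delta> \<le> (b - a) / \<delta>" using x assms by (intro divide_right_mono) auto
  then have i: "i \<in> {..nat \<lfloor>(b - a) / \<delta>\<rfloor>}" unfolding i_def by (auto intro!: nat_mono floor_mono)
  have "0 \<le> (x - a) / \<delta>" using x assms by simp
  then have "real i \<le> (x - a) / \<delta>" "(x - a) / \<delta> \<le> real i + 1" unfolding i_def by linarith+
  then have "real i * \<delta> \<le> x - a" "x - a \<le> (real i + 1) * \<delta>"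
    using assms by (simp_all add: field_simps)
  then have "x \<in> {a + real i * \<delta>..a + real i * \<delta> + \<delta>}" by (auto simp: algebra_simps)
  then show "x \<in> (\<Union>c\<in>(\<lambda>i. a + real i * \<delta>) ` {..nat \<lfloor>(b - a) / \<delta>\<rfloor>}. {c..c + \<delta>})" using i by blast
qed

text \<open>Below, the lengths of the covering intervals must add up to at least 1; above, a grid
  has at most 1 / \<delta> + 1 points, and \<delta> < 1 turns this into 2 / \<delta>.\<close>

lemma unit_interval_covering_number:
  assumes "0 < \<delta>" "\<delta> < 1"
  shows "1 / \<delta> \<le> covering_number {0..1} \<delta>" "covering_number {0..1} \<delta> \<le> 2 / \<delta>"
proof -
  define A where "A = (\<lambda>i. 0 + real i * \<delta>) ` {..nat \<lfloor>(1 - 0) / \<delta>\<rfloor>}"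
  have A: "finite A" "{0..1} \<subseteq> (\<Union>a\<in>A. {a..a + \<delta>})"
    unfolding A_def using interval_cover[OF assms(1), of 0 1] by blast+
  have "card A \<le> nat \<lfloor>1 / \<delta>\<rfloor> + 1"
    unfolding A_def using card_image_le[of "{..nat \<lfloor>1 / \<delta>\<rfloor>}"] by simp
  then have "real (card A) \<le> 1 / \<delta> + 1" 
  proof -
    have "real (nat \<lfloor>1 / \<delta>\<rfloor>) \<le> 1 / \<delta>" using assms by (intro of_nat_floor) simp
    then show ?thesis using \<open>card A \<le> nat \<lfloor>1 / \<delta>\<rfloor> + 1\<close> by linarith
  qed
  also have "\<dots> \<le> 2 / \<delta>" using assms by (simp add: field_simps)
  finally show "covering_number {0..1} \<delta> \<le> 2 / \<delta>"
    using covering_number_le[OF A] by linarith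
  obtain B where B: "finite B" "card B = covering_number {0..1} \<delta>" "{0..1} \<subseteq> (\<Union>a\<in>B. {a..a + \<delta>})"
    using covering_number_attained[OF A] .
  have "ennreal 1 = emeasure lborel {0..1::real}" by simp
  also have "\<dots> \<le> emeasure lborel (\<Union>a\<in>B. {a..a + \<delta>})" by (rule emeasure_mono) (use B in auto)
  also have "\<dots> \<le> (\<Sum>a\<in>B. emeasure lborel {a..a + \<delta>})" by (rule emeasure_subadditive_finite) (use B in auto)
  also have "\<dots> = ennreal (real (covering_number {0..1} \<delta>) * \<delta>)"
    using assms B by (simp add: ennreal_mult' ennreal_of_nat_eq_real_of_nat)
  finally show "1 / \<delta> \<le> covering_number {0..1} \<delta>" using assms by (simp add: ennreal_le_iff2 field_simps)
qed

lemma has_minkowski_dim_unit_interval: "has_minkowski_dim {0..1} 1"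
proof -
  define r where "r = (\<lambda>\<delta>. ln (real (covering_number {0..1} \<delta>)) / ln (1 / \<delta>))"
  have ev: "\<forall>\<^sub>F \<delta> in at_right (0::real). 0 < \<delta> \<and> \<delta> < 1"
    by (rule eventually_at_rightI[of 0 1]) auto
  have "(r \<longlongrightarrow> 1) (at_right 0)"
  proof (rule tendsto_sandwich)
    show "\<forall>\<^sub>F \<delta> in at_right 0. 1 \<le> r \<delta>" using ev
    proof eventually_elim
      case (elim \<delta>)
      then have "ln (1 / \<delta>) > 0" by (simp add: ln_div)
      moreover have "ln (1 / \<delta>) \<le> ln (real (covering_number {0..1} \<delta>))"
        using unit_interval_covering_number(1)[of \<delta>] elim by (intro ln_mono) auto
      ultimately show ?case unfolding r_def by simp
    qed
    show "\<forall>\<^sub>F \<delta> in at_right 0. r \<delta> \<le> ln (2 / \<delta>) / ln (1 / \<delta>)" using ev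
    proof eventually_elim
      case (elim \<delta>)
      then have "ln (1 / \<delta>) > 0" by (simp add: ln_div)
      moreover have "ln (real (covering_number {0..1} \<delta>)) \<le> ln (2 / \<delta>)"
      proof (intro ln_mono)
        have "0 < 1 / \<delta>" using elim by simp
        then show "0 < real (covering_number {0..1} \<delta>)"
          using unit_interval_covering_number(1)[of \<delta>] elim by linarith
      qed (use unit_interval_covering_number(2)[of \<delta>] elim in auto)
      ultimately show ?case unfolding r_def by (intro divide_right_mono) auto
    qed
    show "((\<lambda>\<delta>. ln (2 / \<delta>) / ln (1 / \<delta>)) \<longlongrightarrow> 1) (at_right (0::real))" by real_asymp
  qed auto
  then have "((\<lambda>\<delta>. ereal (r \<delta>)) \<longlongrightarrow> ereal 1) (at_right 0)" by simp
  then show ?thesis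
    unfolding has_minkowski_dim_def lower_minkowski_dim_def upper_minkowski_dim_def r_def
    by (auto intro!: lim_imp_Liminf lim_imp_Limsup)
qed

subsection \<open>Sharpness\<close>

text \<open>For $\Theta = [0,1]$ the points $x - \theta/2$ reach the origin for every $x \in (0,1/2)$.
  Data whose frequencies all focus at the origin at time $1/2$ therefore contradict the estimate
  below the Sobolev exponent $1/2$.\<close>

definition focusing :: "real \<Rightarrow> real \<Rightarrow> real \<Rightarrow> complex" where
  "focusing m R \<xi> = of_real (indicator {R..2*R} \<xi>) * cis (- (\<bar>\<xi>\<bar> powr m / 2))"

lemma focusing_measurable [measurable]: "focusing m R \<in> borel_measurable borel"
  unfolding focusing_def by measurable

lemma integrable_focusing: "integrable lborel (focusing m R)"
proof (rule Bochner_Integration.integrable_bound)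
  show "integrable lborel (indicator {R..2*R} :: real \<Rightarrow> real)" by (rule integrable_real_indicator) (auto simp: emeasure_lborel_Icc_eq)
  show "AE x in lborel. norm (focusing m R x) \<le> norm (indicator {R..2*R} x :: real)"
    by (auto simp: focusing_def norm_mult)
qed simp

text \<open>After division by R^2 the base of the weight lies between 1 and 5, so the exponent
  \<open>\<bar>s\<bar>\<close> serves both signs of \<open>s\<close>.\<close>

lemma focusing_weight_bound:
  assumes "R \<ge> 1" "\<xi> \<in> {R..2*R}"
  shows "bessel_weight s \<xi> \<le> 5 powr \<bar>s\<bar> * R powr (2 * s)"
proof -
  have R: "R > 0" "R\<^sup>2 > 0" "R powr (2 * s) = (R\<^sup>2) powr s"
    using assms(1) powr_powr[of R 2 s] by auto
  define y where "y = (1 + \<xi>\<^sup>2) / R\<^sup>2"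
  have "R\<^sup>2 \<le> \<xi>\<^sup>2" "1 \<le> R\<^sup>2" using assms by (auto intro!: power_mono)
  moreover have "\<xi>\<^sup>2 \<le> (2*R)\<^sup>2" using assms by (intro power_mono) auto
  ultimately have y: "1 \<le> y" "y \<le> 5" using R by (auto simp: y_def field_simps power2_eq_square)
  have "bessel_weight s \<xi> = (y * R\<^sup>2) powr s" using R by (simp add: y_def)
  also have "\<dots> = y powr s * R powr (2 * s)" using y R by (simp add: powr_mult)
  also have "y powr s \<le> y powr \<bar>s\<bar>" using y by (intro powr_mono) auto
  also have "\<dots> \<le> 5 powr \<bar>s\<bar>" using y by (intro powr_mono2) auto
  finally show ?thesis by (simp add: mult_right_mono)
qed

lemma focusing_l2:
  assumes "R \<ge> 1"
  shows "l2sq (\<lambda>\<xi>. of_real (bessel_weight (s / 2) \<xi>) * focusing m R \<xi>) \<le> ennreal (5 powr \<bar>s\<bar> * R powr (2 * s + 1))"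
proof -
  have "l2sq (\<lambda>\<xi>. of_real (bessel_weight (s / 2) \<xi>) * focusing m R \<xi>) \<le> (\<integral>\<^sup>+\<xi>. ennreal (5 powr \<bar>s\<bar> * R powr (2 * s)) * indicator {R..2*R} \<xi> \<partial>lborel)"
  proof (rule nn_integral_mono)
    fix \<xi>
    have "(bessel_weight (s / 2) \<xi>)\<^sup>2 = bessel_weight s \<xi>"
      by (simp add: power2_eq_square flip: powr_add)
    then show "ennreal ((norm (of_real (bessel_weight (s / 2) \<xi>) * focusing m R \<xi>))\<^sup>2) \<le> ennreal (5 powr \<bar>s\<bar> * R powr (2 * s)) * indicator {R..2*R} \<xi>"
      using focusing_weight_bound[OF assms, of \<xi> s]
      by (auto simp: focusing_def norm_mult power_mult_distrib indicator_def intro!: ennreal_leI)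
  qed
  also have "\<dots> = ennreal (5 powr \<bar>s\<bar> * R powr (2 * s)) * ennreal R"
    using assms by (subst nn_integral_cmult_indicator) auto
  also have "\<dots> = ennreal (5 powr \<bar>s\<bar> * R powr (2 * s + 1))"
    using assms by (subst ennreal_mult[symmetric]) (auto simp: powr_add mult.assoc)
  finally show ?thesis .
qed

lemma focusing_sobolev:
  assumes "R \<ge> 1"
  shows "fourier_synthesis (focusing m R) \<in> sobolev s"
    and "(sobolev_norm s (fourier_synthesis (focusing m R)))\<^sup>2 \<le> 5 powr \<bar>s\<bar> * R powr (2 * s + 1)"
proof -
  have fin: "l2sq (\<lambda>\<xi>. of_real (bessel_weight (s / 2) \<xi>) * focusing m R \<xi>) < \<infinity>"
    unfolding infinity_ennreal_def by (rule le_less_trans[OF focusing_l2[OF assms] ennreal_less_top])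
  have i: "integrable lborel (\<lambda>\<xi>. of_real (bessel_weight (s / 2) \<xi>) * focusing m R \<xi>)"
  proof (rule Bochner_Integration.integrable_bound)
    show "integrable lborel (\<lambda>\<xi>. 5 powr \<bar>s / 2\<bar> * R powr (2 * (s / 2)) * indicator {R..2*R} \<xi> :: real)"
      by (intro integrable_mult_right integrable_real_indicator) (auto simp: emeasure_lborel_Icc_eq)
    show "AE \<xi> in lborel. norm (of_real (bessel_weight (s / 2) \<xi>) * focusing m R \<xi>) \<le> norm (5 powr \<bar>s / 2\<bar> * R powr (2 * (s / 2)) * indicator {R..2*R} \<xi> :: real)"
      using focusing_weight_bound[OF assms, of _ "s / 2"]
      by (auto simp: focusing_def norm_mult indicator_def)
  qed measurable
  show "fourier_synthesis (focusing m R) \<in> sobolev s"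
    by (rule sobolev_fourier_synthesis[OF integrable_focusing i fin])
  have "ennreal ((sobolev_norm s (fourier_synthesis (focusing m R)))\<^sup>2) \<le> ennreal (5 powr \<bar>s\<bar> * R powr (2 * s + 1))"
    by (rule order_trans[OF sobolev_norm_fourier_synthesis[OF integrable_focusing i fin] focusing_l2[OF assms]])
  then show "(sobolev_norm s (fourier_synthesis (focusing m R)))\<^sup>2 \<le> 5 powr \<bar>s\<bar> * R powr (2 * s + 1)"
    by (subst (asm) ennreal_le_iff) auto
qed

text \<open>The phase of the data is opposite to the one acquired by time 1/2, so at the origin all
  frequencies add up without cancellation to the length \<open>R\<close> of the frequency
  interval.\<close>

lemma focusing_evolution:
  fixes m :: real
  assumes "R \<ge> 1"
  defines "f \<equiv> fourier_synthesis (focusing m R)"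
  shows "(\<lambda>N. evolution_reg m f N 0 (1/2)) \<longlonglongrightarrow> of_real (R / (2 * pi))"
proof -
  have rep: "represents (distr_fourier f) (focusing m R)"
    unfolding f_def by (rule distr_fourier_synthesis[OF integrable_focusing])
  have [measurable]: "distr_fun (distr_fourier f) \<in> borel_measurable borel" by (rule distr_fun_measurable[OF rep])
  have ae: "AE \<xi> in lborel. distr_fun (distr_fourier f) \<xi> = focusing m R \<xi>" by (rule distr_fun_AE_eq[OF rep])
  define I where "I = (\<lambda>N::nat. LINT \<xi>|lborel. complex_of_real (exp (- (\<bar>\<xi>\<bar>\<^sup>2 / (real N)\<^sup>2))) * of_real (indicator {R..2*R} \<xi>))"
  have reg: "evolution_reg m f N 0 (1/2) = of_real (1 / (2 * pi)) * I N" for N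
    unfolding evolution_reg_def I_def
  proof (rule arg_cong[where f = "\<lambda>z. _ * z"], rule integral_cong_AE)
    show "AE \<xi> in lborel. cis (0 * \<xi> + 1 / 2 * \<bar>\<xi>\<bar> powr m) * complex_of_real (exp (- (\<bar>\<xi>\<bar>\<^sup>2 / (real N)\<^sup>2))) * distr_fun (distr_fourier f) \<xi>
       = complex_of_real (exp (- (\<bar>\<xi>\<bar>\<^sup>2 / (real N)\<^sup>2))) * of_real (indicator {R..2*R} \<xi>)"
      using ae
    proof eventually_elim
      case (elim \<xi>)
      have "cis (0 * \<xi> + 1 / 2 * \<bar>\<xi>\<bar> powr m) * cis (- (\<bar>\<xi>\<bar> powr m / 2)) = 1" by (simp add: cis_mult)
      then show ?case unfolding elim focusing_def by (simp add: mult_ac)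
    qed
  qed measurable
  have "I \<longlonglongrightarrow> (LINT \<xi>|lborel. of_real (indicator {R..2*R} \<xi>))"
    unfolding I_def
  proof (rule integral_dominated_convergence)
    show "integrable lborel (indicator {R..2*R} :: real \<Rightarrow> real)" by (rule integrable_real_indicator) (auto simp: emeasure_lborel_Icc_eq)
    show "AE \<xi> in lborel. (\<lambda>N. complex_of_real (exp (- (\<bar>\<xi>\<bar>\<^sup>2 / (real N)\<^sup>2))) * of_real (indicator {R..2*R} \<xi>)) \<longlonglongrightarrow> of_real (indicator {R..2*R} \<xi>)"
    proof (rule AE_I2)
      fix \<xi> :: real
      have "(\<lambda>N::nat. \<bar>\<xi>\<bar>\<^sup>2 / (real N)\<^sup>2) \<longlonglongrightarrow> 0" by real_asymp
      then have "(\<lambda>N. complex_of_real (exp (- (\<bar>\<xi>\<bar>\<^sup>2 / (real N)\<^sup>2))) * of_real (indicator {R..2*R} \<xi>)) \<longlonglongrightarrow> of_real (exp (- 0)) * of_real (indicator {R..2*R} \<xi>)"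
        by (intro tendsto_mult tendsto_of_real tendsto_exp tendsto_minus tendsto_const)
      then show "(\<lambda>N. complex_of_real (exp (- (\<bar>\<xi>\<bar>\<^sup>2 / (real N)\<^sup>2))) * of_real (indicator {R..2*R} \<xi>)) \<longlonglongrightarrow> of_real (indicator {R..2*R} \<xi>)" by simp
    qed
    show "AE \<xi> in lborel. norm (complex_of_real (exp (- (\<bar>\<xi>\<bar>\<^sup>2 / (real N)\<^sup>2))) * of_real (indicator {R..2*R} \<xi>)) \<le> indicator {R..2*R} \<xi>" for N
      by (auto simp: norm_mult indicator_def)
  qed measurable
  also have "(LINT \<xi>|lborel. complex_of_real (indicator {R..2*R} \<xi>)) = of_real R"
    unfolding integral_complex_of_real using assms(1) by simp
  finally have "(\<lambda>N. of_real (1 / (2 * pi)) * I N) \<longlonglongrightarrow> of_real (1 / (2 * pi)) * of_real R"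
    by (intro tendsto_intros)
  then show ?thesis unfolding reg by (simp add: field_simps)
qed

lemma focusing_maximal_fun:
  assumes "R \<ge> 1" "x \<in> {0<..<1/2}"
  shows "maximal_fun m {0..1} (fourier_synthesis (focusing m R)) x \<ge> ennreal (R / (2 * pi))"
proof -
  define f where "f = fourier_synthesis (focusing m R)"
  have lim: "(\<lambda>N. evolution_reg m f N 0 (1/2)) \<longlonglongrightarrow> of_real (R / (2 * pi))"
    unfolding f_def by (rule focusing_evolution[OF assms(1)])
  have x: "x - 2 * x * (1/2) = 0" by simp
  have d: "evolution_defined m f (x - 2 * x * (1/2)) (1/2)"
    unfolding evolution_defined_def x using lim by (rule convergentI)
  have "norm (evolution m f (x - 2 * x * (1/2)) (1/2)) = R / (2 * pi)"
    unfolding evolution_def x limI[OF lim] norm_of_real using assms by simp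
  then show ?thesis
    unfolding maximal_fun_def f_def[symmetric]
    by (intro SUP_upper2[of "(1/2, 2 * x)"]) (use d assms in auto)
qed

theorem no_maximal_estimate_unit_interval:
  assumes "s < 1/2"
  shows "\<not> maximal_estimate m {0..1} s C"
proof
  assume est: "maximal_estimate m {0..1} s C"
  \<comment> \<open>The factor 32 pi^4 is 2 (2 pi)^4, where 2 is the inverse length of (0, 1/2). The
    estimate would give R^4 <= K R^(4s+2) for all R >= 1, which fails for s < 1/2. The absolute
    value covers a negative \<open>C\<close>.\<close>
  define K where "K = 32 * pi ^ 4 * \<bar>C\<bar> ^ 4 * (5 powr \<bar>s\<bar>)\<^sup>2"
  have le: "R ^ 4 \<le> K * R powr (2 * (2 * s + 1))" if R: "R \<ge> 1" for R :: real
  proof -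
    define f where "f = fourier_synthesis (focusing m R)"
    define n where "n = sobolev_norm s f"
    have n: "n \<ge> 0" "n\<^sup>2 \<le> 5 powr \<bar>s\<bar> * R powr (2 * s + 1)"
      unfolding n_def f_def using focusing_sobolev[OF R] sobolev_norm_nonneg by auto
    have "L4_norm {0<..<1} (maximal_fun m {0..1} f) \<le> ennreal (C * n)"
      using est focusing_sobolev(1)[OF R] unfolding maximal_estimate_def f_def n_def by blast
    also have "\<dots> \<le> ennreal (\<bar>C\<bar> * n)" using n by (intro ennreal_leI mult_right_mono) auto
    finally have I: "(\<integral>\<^sup>+x\<in>{0<..<1}. maximal_fun m {0..1} f x ^ 4 \<partial>lborel) \<le> ennreal ((\<bar>C\<bar> * n) ^ 4)"
      using n by (subst (asm) L4_norm_le_iff) auto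
    have "ennreal ((R / (2 * pi)) ^ 4 * (1/2)) = (\<integral>\<^sup>+x. ennreal ((R / (2 * pi)) ^ 4) * indicator {0<..<1/2::real} x \<partial>lborel)"
    proof -
      have "emeasure lborel {0<..<1/2::real} = ennreal (1/2)" by (subst emeasure_lborel_Ioo) auto
      then show ?thesis
        using R by (subst nn_integral_cmult_indicator) (simp_all only: borel_open open_greaterThanLessThan sets_lborel ennreal_mult'[symmetric] zero_le_divide_1_iff zero_le_numeral ennreal_mult''[symmetric])
    qed
    also have "\<dots> \<le> (\<integral>\<^sup>+x\<in>{0<..<1}. maximal_fun m {0..1} f x ^ 4 \<partial>lborel)"
    proof (rule nn_integral_mono)
      fix x :: real
      have "ennreal ((R / (2 * pi)) ^ 4) \<le> maximal_fun m {0..1} f x ^ 4" if "x \<in> {0<..<1/2}"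
        using power_mono[OF focusing_maximal_fun[OF R that, of m], of 4] R unfolding f_def
        by (simp add: ennreal_power)
      then show "ennreal ((R / (2 * pi)) ^ 4) * indicator {0<..<1/2} x \<le> maximal_fun m {0..1} f x ^ 4 * indicator {0<..<1} x"
        by (auto simp: indicator_def)
    qed
    also note I
    finally have "(R / (2 * pi)) ^ 4 * (1/2) \<le> (\<bar>C\<bar> * n) ^ 4" by (subst (asm) ennreal_le_iff) auto
    then have "R ^ 4 \<le> 32 * pi ^ 4 * ((\<bar>C\<bar> * n) ^ 4)" by (simp add: field_simps power_divide)
    also have "(\<bar>C\<bar> * n) ^ 4 = \<bar>C\<bar> ^ 4 * (n\<^sup>2)\<^sup>2" by (simp add: power_mult_distrib flip: power_mult)
    also have "32 * pi ^ 4 * (\<bar>C\<bar> ^ 4 * (n\<^sup>2)\<^sup>2) \<le> 32 * pi ^ 4 * (\<bar>C\<bar> ^ 4 * (5 powr \<bar>s\<bar> * R powr (2 * s + 1))\<^sup>2)"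
      using n by (intro mult_left_mono power_mono) auto
    also have "(5 powr \<bar>s\<bar> * R powr (2 * s + 1))\<^sup>2 = (5 powr \<bar>s\<bar>)\<^sup>2 * R powr (2 * (2 * s + 1))"
      unfolding power_mult_distrib by (simp only: power2_eq_square mult_2 powr_add mult_ac)
    finally show ?thesis unfolding K_def by (simp only: mult_ac)
  qed
  have "R powr (2 - 4 * s) \<le> K" if R: "R \<ge> 1" for R :: real
  proof -
    have "R powr (2 - 4 * s) * R powr (2 * (2 * s + 1)) = R ^ 4"
      using R unfolding powr_add[symmetric] by (simp add: algebra_simps)
    then have "R powr (2 - 4 * s) * R powr (2 * (2 * s + 1)) \<le> K * R powr (2 * (2 * s + 1))" using le[OF R] by simp
    then show ?thesis using R by (simp add: mult_le_cancel_right_pos)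
  qed
  moreover have "filterlim (\<lambda>R::real. R powr (2 - 4 * s)) at_top at_top"
  proof -
    define p where "p = 2 - 4 * s"
    have "p > 0" using assms by (simp add: p_def)
    then show ?thesis unfolding p_def[symmetric] by real_asymp
  qed
  then have "\<forall>\<^sub>F R::real in at_top. R powr (2 - 4 * s) \<ge> K + 1" by (simp add: filterlim_at_top)
  with eventually_ge_at_top[of 1] have "\<forall>\<^sub>F R::real in at_top. R \<ge> 1 \<and> R powr (2 - 4 * s) \<ge> K + 1"
    by (rule eventually_conj)
  then obtain R :: real where "R \<ge> 1" "R powr (2 - 4 * s) \<ge> K + 1"
    using eventually_happens'[OF trivial_limit_at_top_linorder] by blast
  ultimately show False by fastforce
qed

subsection \<open>Van der Corput estimates\<close>

text \<open>Integration by parts, with E = e^(i \<phi>) \<psi> / \<phi>' as boundary term. Convexity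
  of the phase and monotonicity of the amplitude give the derivative of \<psi> / \<phi>' a majorant
  \<open>k\<close> with the explicit antiderivative -\<psi>/\<mu> - 1/\<phi>'; its integral is at
  most 3/\<mu>, and the boundary terms add 2/\<mu>.\<close>

lemma van_der_corput_first:
  fixes \<phi> \<phi>' \<phi>'' \<psi> \<psi>' :: "real \<Rightarrow> real"
  assumes "a \<le> b" and \<mu>: "\<mu> > 0"
    and d\<phi>: "\<And>x. x \<in> {a..b} \<Longrightarrow> (\<phi> has_real_derivative \<phi>' x) (at x)"
    and d\<phi>': "\<And>x. x \<in> {a..b} \<Longrightarrow> (\<phi>' has_real_derivative \<phi>'' x) (at x)"
    and d\<psi>: "\<And>x. x \<in> {a..b} \<Longrightarrow> (\<psi> has_real_derivative \<psi>' x) (at x)"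
    and conv: "\<And>x. x \<in> {a..b} \<Longrightarrow> \<phi>'' x \<ge> 0"
    and low: "\<And>x. x \<in> {a..b} \<Longrightarrow> \<bar>\<phi>' x\<bar> \<ge> \<mu>"
    and decr: "\<And>x. x \<in> {a..b} \<Longrightarrow> \<psi>' x \<le> 0"
    and \<psi>: "\<And>x. x \<in> {a..b} \<Longrightarrow> 0 \<le> \<psi> x \<and> \<psi> x \<le> 1"
  shows "norm (integral {a..b} (\<lambda>x. cis (\<phi> x) * of_real (\<psi> x))) \<le> 5 / \<mu>"
proof -
  define f where "f = (\<lambda>x. cis (\<phi> x) * of_real (\<psi> x))"
  define q' where "q' = (\<lambda>x. \<psi>' x / \<phi>' x - \<psi> x * \<phi>'' x / (\<phi>' x)\<^sup>2)"
  define E where "E = (\<lambda>x. cis (\<phi> x) * of_real (\<psi> x / \<phi>' x))"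
  define g where "g = (\<lambda>x. cis (\<phi> x) * of_real (q' x))"
  define k where "k = (\<lambda>x. - \<psi>' x / \<mu> + \<phi>'' x / (\<phi>' x)\<^sup>2)"
  have nz: "\<phi>' x \<noteq> 0" if "x \<in> {a..b}" for x using low[OF that] \<mu> by auto
  have inv: "1 / \<bar>\<phi>' x\<bar> \<le> 1 / \<mu>" if "x \<in> {a..b}" for x
    using low[OF that] \<mu> by (intro divide_left_mono) (auto simp: nz[OF that])
  have dcis: "((\<lambda>x. cis (\<phi> x)) has_vector_derivative \<i> * of_real (\<phi>' x) * cis (\<phi> x)) (at x)" if "x \<in> {a..b}" for x
    using d\<phi>[OF that] unfolding has_vector_derivative_def has_field_derivative_def
    by (auto intro!: derivative_eq_intros simp: scaleR_conv_of_real algebra_simps)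
  have E: "((\<lambda>x. \<i> * f x + g x) has_integral E b - E a) {a..b}"
  proof (rule fundamental_theorem_of_calculus[OF \<open>a \<le> b\<close>])
    fix x assume x: "x \<in> {a..b}"
    have "((\<lambda>x. \<psi> x / \<phi>' x) has_real_derivative q' x) (at x)"
      unfolding q'_def using nz[OF x]
      by (auto intro!: derivative_eq_intros d\<psi>[OF x] d\<phi>'[OF x] simp: field_simps power2_eq_square)
    then have "((\<lambda>x. complex_of_real (\<psi> x / \<phi>' x)) has_vector_derivative of_real (q' x)) (at x)"
      by (intro has_vector_derivative_of_real) (simp add: has_real_derivative_iff_has_vector_derivative)
    from has_vector_derivative_mult[OF dcis[OF x] this]
    have "(E has_vector_derivative \<i> * f x + g x) (at x)"
      unfolding E_def f_def g_def using nz[OF x]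
      by (rule_tac back_subst[where P = "\<lambda>d. (_ has_vector_derivative d) (at x)"]) (assumption, simp add: field_simps)
    then show "(E has_vector_derivative \<i> * f x + g x) (at x within {a..b})"
      by (rule has_vector_derivative_at_within)
  qed
  have "continuous_on {a..b} f"
    unfolding f_def using d\<phi> d\<psi>
    by (intro continuous_intros continuous_at_imp_continuous_on ballI) (auto intro: DERIV_isCont)
  then have f: "f integrable_on {a..b}" by (rule integrable_continuous_interval)
  have "((\<lambda>x. (\<i> * f x + g x) - \<i> * f x) has_integral (E b - E a) - \<i> * integral {a..b} f) {a..b}"
    by (intro has_integral_diff E has_integral_mult_right integrable_integral f)
  then have g: "(g has_integral (E b - E a) - \<i> * integral {a..b} f) {a..b}" by simp
  have k: "(k has_integral (- \<psi> b / \<mu> - 1 / \<phi>' b) - (- \<psi> a / \<mu> - 1 / \<phi>' a)) {a..b}"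
  proof (rule fundamental_theorem_of_calculus[OF \<open>a \<le> b\<close>])
    fix x assume x: "x \<in> {a..b}"
    have "((\<lambda>x. - \<psi> x / \<mu> - 1 / \<phi>' x) has_real_derivative k x) (at x)"
      unfolding k_def using nz[OF x] \<mu>
      by (auto intro!: derivative_eq_intros d\<psi>[OF x] d\<phi>'[OF x] simp: field_simps power2_eq_square)
    then show "((\<lambda>x. - \<psi> x / \<mu> - 1 / \<phi>' x) has_vector_derivative k x) (at x within {a..b})"
      by (simp add: has_real_derivative_iff_has_vector_derivative has_vector_derivative_at_within)
  qed
  have gk: "norm (g x) \<le> k x" if x: "x \<in> {a..b}" for x
  proof -
    have "norm (g x) \<le> \<bar>\<psi>' x / \<phi>' x\<bar> + \<bar>\<psi> x * \<phi>'' x / (\<phi>' x)\<^sup>2\<bar>"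
      unfolding g_def q'_def norm_mult norm_cis norm_of_real mult_1 by (rule abs_triangle_ineq4)
    also have "\<bar>\<psi>' x / \<phi>' x\<bar> = (- \<psi>' x) * (1 / \<bar>\<phi>' x\<bar>)" using decr[OF x] by (simp add: abs_divide)
    also have "\<dots> \<le> (- \<psi>' x) * (1 / \<mu>)" using decr[OF x] inv[OF x] by (intro mult_left_mono) auto
    also have "\<bar>\<psi> x * \<phi>'' x / (\<phi>' x)\<^sup>2\<bar> = \<psi> x * (\<phi>'' x / (\<phi>' x)\<^sup>2)" using \<psi>[OF x] conv[OF x] by simp
    also have "\<dots> \<le> 1 * (\<phi>'' x / (\<phi>' x)\<^sup>2)" using \<psi>[OF x] conv[OF x] by (intro mult_right_mono) auto
    finally show ?thesis by (simp add: k_def)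
  qed
  have ab: "a \<in> {a..b}" "b \<in> {a..b}" using \<open>a \<le> b\<close> by auto
  have "norm (E b - E a - \<i> * integral {a..b} f) \<le> (- \<psi> b / \<mu> - 1 / \<phi>' b) - (- \<psi> a / \<mu> - 1 / \<phi>' a)"
    using integral_norm_bound_integral[OF has_integral_integrable[OF g] has_integral_integrable[OF k] gk]
      integral_unique[OF g] integral_unique[OF k] by simp
  also have "\<dots> \<le> \<psi> a / \<mu> + 1 / \<bar>\<phi>' b\<bar> + 1 / \<bar>\<phi>' a\<bar>"
  proof -
    have r: "- (1 / y) \<le> 1 / \<bar>y\<bar>" "1 / y \<le> 1 / \<bar>y\<bar>" for y :: real by (cases "y \<ge> 0"; simp)+
    have "\<psi> b / \<mu> \<ge> 0" using \<psi>[OF ab(2)] \<mu> by auto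
    then show ?thesis using r[of "\<phi>' a"] r[of "\<phi>' b"] by simp
  qed
  also have "\<dots> \<le> 1 / \<mu> + 1 / \<mu> + 1 / \<mu>"
    using \<psi>[OF ab(1)] \<mu> inv ab by (intro add_mono) (auto intro: divide_right_mono)
  finally have 1: "norm (E b - E a - \<i> * integral {a..b} f) \<le> 3 / \<mu>" by simp
  have 2: "norm (E x) \<le> 1 / \<mu>" if "x \<in> {a..b}" for x
  proof -
    have "norm (E x) = \<psi> x * (1 / \<bar>\<phi>' x\<bar>)" unfolding E_def norm_mult norm_cis norm_of_real using \<psi>[OF that] by (simp add: abs_divide)
    also have "\<dots> \<le> 1 * (1 / \<mu>)" using \<psi>[OF that] inv[OF that] by (intro mult_mono) auto
    finally show ?thesis by simp
  qed
  have "norm (integral {a..b} f) = norm (\<i> * integral {a..b} f)" by (simp add: norm_mult)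
  also have "\<i> * integral {a..b} f = (E b - E a) - (E b - E a - \<i> * integral {a..b} f)" by simp
  also have "norm \<dots> \<le> norm (E b - E a) + norm (E b - E a - \<i> * integral {a..b} f)" by (rule norm_triangle_ineq4)
  also have "\<dots> \<le> (norm (E b) + norm (E a)) + 3 / \<mu>" by (intro add_mono norm_triangle_ineq4 1)
  also have "\<dots> \<le> 1 / \<mu> + 1 / \<mu> + 3 / \<mu>" using 2 ab by (intro add_mono) auto
  finally show ?thesis unfolding f_def by simp
qed

text \<open>Around the point \<open>c\<close> where the phase is flattest an interval of radius
  \<eta> = \<mu>^(-1/2) is cut out and estimated by its length 2 \<eta>. Outside it the slope is at
  least \<mu> \<eta>, so the first-derivative bound gives 5 \<eta> on either side; the sum is 12
  \<eta>.\<close>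

lemma van_der_corput_second:
  fixes \<phi> \<phi>' \<phi>'' \<psi> \<psi>' :: "real \<Rightarrow> real"
  assumes "a \<le> b" and \<mu>: "\<mu> > 0"
    and d\<phi>: "\<And>x. x \<in> {a..b} \<Longrightarrow> (\<phi> has_real_derivative \<phi>' x) (at x)"
    and d\<phi>': "\<And>x. x \<in> {a..b} \<Longrightarrow> (\<phi>' has_real_derivative \<phi>'' x) (at x)"
    and d\<psi>: "\<And>x. x \<in> {a..b} \<Longrightarrow> (\<psi> has_real_derivative \<psi>' x) (at x)"
    and conv: "\<And>x. x \<in> {a..b} \<Longrightarrow> \<phi>'' x \<ge> \<mu>"
    and decr: "\<And>x. x \<in> {a..b} \<Longrightarrow> \<psi>' x \<le> 0"
    and \<psi>: "\<And>x. x \<in> {a..b} \<Longrightarrow> 0 \<le> \<psi> x \<and> \<psi> x \<le> 1"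
  shows "norm (integral {a..b} (\<lambda>x. cis (\<phi> x) * of_real (\<psi> x))) \<le> 12 / sqrt \<mu>"
proof -
  define f where "f = (\<lambda>x. cis (\<phi> x) * of_real (\<psi> x))"
  have mono: "\<phi>' y - \<phi>' x \<ge> \<mu> * (y - x)" if "x \<in> {a..b}" "y \<in> {a..b}" "x \<le> y" for x y
  proof -
    have "\<phi>' x - \<mu> * x \<le> \<phi>' y - \<mu> * y"
    proof (rule DERIV_nonneg_imp_nondecreasing[OF \<open>x \<le> y\<close>])
      fix z assume "x \<le> z" "z \<le> y"
      then have z: "z \<in> {a..b}" using that by auto
      show "\<exists>d. ((\<lambda>x. \<phi>' x - \<mu> * x) has_real_derivative d) (at z) \<and> 0 \<le> d"
        using conv[OF z] by (intro exI[of _ "\<phi>'' z - \<mu>"]) (auto intro!: derivative_eq_intros d\<phi>'[OF z])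
    qed
    then show ?thesis by (simp add: algebra_simps)
  qed
  have ab: "a \<in> {a..b}" "b \<in> {a..b}" using \<open>a \<le> b\<close> by auto
  \<comment> \<open>\<open>c\<close> is a zero of \<open>\<phi>'\<close> if the slope changes sign,
    and otherwise the endpoint where the slope is closest to zero.\<close>
  obtain c where c: "c \<in> {a..b}" "\<And>x. x \<in> {a..b} \<Longrightarrow> \<bar>\<phi>' x\<bar> \<ge> \<mu> * \<bar>x - c\<bar>"
  proof -
    consider "\<phi>' a \<ge> 0" | "\<phi>' b \<le> 0" | "\<phi>' a < 0" "\<phi>' b > 0" by linarith
    then show thesis
    proof cases
      case 1
      have "\<bar>\<phi>' x\<bar> \<ge> \<mu> * \<bar>x - a\<bar>" if "x \<in> {a..b}" for x
        using mono[OF ab(1) that] 1 that by auto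
      then show thesis using that ab by blast
    next
      case 2
      have "\<bar>\<phi>' x\<bar> \<ge> \<mu> * \<bar>x - b\<bar>" if "x \<in> {a..b}" for x
        using mono[OF that ab(2)] 2 that by (auto simp: abs_if)
      then show thesis using that ab by blast
    next
      case 3
      have "\<exists>c\<ge>a. c \<le> b \<and> \<phi>' c = 0"
        using 3 \<open>a \<le> b\<close> d\<phi>' by (intro IVT) (auto intro: DERIV_isCont)
      then obtain c where c: "c \<in> {a..b}" "\<phi>' c = 0" by auto
      have "\<bar>\<phi>' x\<bar> \<ge> \<mu> * \<bar>x - c\<bar>" if "x \<in> {a..b}" for x
        using mono[OF that c(1)] mono[OF c(1) that] c(2) by (cases "x \<le> c") (auto simp: abs_if)
      then show thesis using that c by blast
    qed
  qed
  define \<eta> where "\<eta> = 1 / sqrt \<mu>"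
  have \<eta>: "\<eta> > 0" "\<mu> * \<eta> = sqrt \<mu>" using \<mu> by (simp_all add: \<eta>_def real_div_sqrt)
  define u where "u = max a (c - \<eta>)"
  define v where "v = min b (c + \<eta>)"
  have uv: "a \<le> u" "u \<le> v" "v \<le> b" "v - u \<le> 2 * \<eta>" using c(1) \<eta> by (auto simp: u_def v_def)
  have ci: "continuous_on {a..b} f"
    unfolding f_def using d\<phi> d\<psi>
    by (intro continuous_intros continuous_at_imp_continuous_on ballI) (auto intro: DERIV_isCont)
  have fi: "f integrable_on {x..y}" if "a \<le> x" "y \<le> b" for x y
    using that by (intro integrable_continuous_interval continuous_on_subset[OF ci]) auto
  have outer: "norm (integral {x..y} f) \<le> 5 * \<eta>"
    if "x \<le> y" "{x..y} \<subseteq> {a..b}" "\<And>z. z \<in> {x..y} \<Longrightarrow> \<bar>z - c\<bar> \<ge> \<eta>" for x y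
  proof -
    have "norm (integral {x..y} f) \<le> 5 / (\<mu> * \<eta>)"
      unfolding f_def
    proof (rule van_der_corput_first[where \<phi>' = \<phi>' and \<phi>'' = \<phi>'' and \<psi>' = \<psi>'])
      show "\<mu> * \<eta> \<le> \<bar>\<phi>' z\<bar>" if z: "z \<in> {x..y}" for z
      proof -
        have "\<mu> * \<eta> \<le> \<mu> * \<bar>z - c\<bar>" using \<open>z \<in> {x..y} \<Longrightarrow> \<eta> \<le> \<bar>z - c\<bar>\<close> z \<mu> by (intro mult_left_mono) auto
        also have "\<dots> \<le> \<bar>\<phi>' z\<bar>" using c(2) z \<open>{x..y} \<subseteq> {a..b}\<close> by auto
        finally show ?thesis .
      qed
      show "0 \<le> \<phi>'' z" if "z \<in> {x..y}" for z using conv[of z] \<mu> that \<open>{x..y} \<subseteq> {a..b}\<close> by force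
    qed (use that \<mu> \<eta> d\<phi> d\<phi>' d\<psi> decr \<psi> in auto)
    also have "\<dots> = 5 * \<eta>" unfolding \<eta>(2) by (simp add: \<eta>_def)
    finally show ?thesis .
  qed
  have 1: "norm (integral {a..u} f) \<le> 5 * \<eta>"
  proof (cases "u = a")
    case False
    then have "u = c - \<eta>" "a \<le> u" by (auto simp: u_def)
    then show ?thesis using c(1) \<eta> by (intro outer) auto
  qed (use \<eta> in auto)
  have 2: "norm (integral {v..b} f) \<le> 5 * \<eta>"
  proof (cases "v = b")
    case False
    then have "v = c + \<eta>" "v \<le> b" by (auto simp: v_def)
    then show ?thesis using c(1) \<eta> by (intro outer) auto
  qed (use \<eta> in auto)
  have 3: "norm (integral {u..v} f) \<le> 2 * \<eta>"
  proof -
    have "norm (integral {u..v} f) \<le> integral {u..v} (\<lambda>_. 1 :: real)"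
      using uv \<psi> by (intro integral_norm_bound_integral fi) (auto simp: f_def norm_mult)
    then show ?thesis using uv by simp
  qed
  have "integral {a..b} f = integral {a..u} f + (integral {u..v} f + integral {v..b} f)"
    using uv by (simp add: Henstock_Kurzweil_Integration.integral_combine fi)
  then have "norm (integral {a..b} f) \<le> 5 * \<eta> + (2 * \<eta> + 5 * \<eta>)"
    using 1 2 3 by (metis add_mono norm_triangle_le)
  then show ?thesis unfolding f_def \<eta>_def by simp
qed

lemma power_phase_derivs:
  fixes \<xi> :: real
  assumes "\<xi> > 0"
  shows "((\<lambda>\<xi>. A * \<xi> + \<tau> * \<xi> powr m) has_real_derivative A + \<tau> * m * \<xi> powr (m - 1)) (at \<xi>)"
    and "((\<lambda>\<xi>. A + \<tau> * m * \<xi> powr (m - 1)) has_real_derivative \<tau> * m * (m - 1) * \<xi> powr (m - 2)) (at \<xi>)"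
    and "((\<lambda>\<xi>. exp (- (\<nu> * \<xi>\<^sup>2))) has_real_derivative - (2 * \<nu> * \<xi>) * exp (- (\<nu> * \<xi>\<^sup>2))) (at \<xi>)"
proof -
  show "((\<lambda>\<xi>. A * \<xi> + \<tau> * \<xi> powr m) has_real_derivative A + \<tau> * m * \<xi> powr (m - 1)) (at \<xi>)"
    using assms by (auto intro!: derivative_eq_intros simp: powr_diff field_simps)
  show "((\<lambda>\<xi>. A + \<tau> * m * \<xi> powr (m - 1)) has_real_derivative \<tau> * m * (m - 1) * \<xi> powr (m - 2)) (at \<xi>)"
    using assms by (auto intro!: derivative_eq_intros)
qed (auto intro!: derivative_eq_intros)

text \<open>The regimes are: short separation (trivial bound), small time difference (no stationary
  point), and large time difference (curvature of the phase).\<close>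

lemma dyadic_kernel_bound_aux:
  fixes m M R a A \<tau> \<nu> :: real
  assumes m: "0 < m" "m < 1" and M: "M \<ge> 1" and R: "R \<ge> 2" and "\<nu> \<ge> 0" and "\<tau> \<le> 0"
    and sep: "\<bar>a\<bar> \<le> \<bar>A\<bar> + M * \<bar>\<tau>\<bar> + R powr (- m)"
  shows "(norm (integral {R/2..R} (\<lambda>\<xi>. cis (A * \<xi> + \<tau> * \<xi> powr m) * of_real (exp (- (\<nu> * \<xi>\<^sup>2))))))\<^sup>2
     \<le> 1152 * M / (m * (1 - m)) * (R powr (2 - m) / (\<bar>a\<bar> + R powr (- m)))"
proof -
  define f where "f = (\<lambda>\<xi>. cis (A * \<xi> + \<tau> * \<xi> powr m) * of_real (exp (- (\<nu> * \<xi>\<^sup>2))))"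
  define \<delta> where "\<delta> = R powr (- m)"
  \<comment> \<open>The number 1152 is 144 * 4 * 2: the square of the constant 12 in the curvature
    bound, the 4 from the threshold |a| / (4 M) on |\<tau>|, and 2 from replacing 2 |a| by |a| +
    \<delta>. The other regimes need far less.\<close>
  define C where "C = 1152 * M / (m * (1 - m))"
  have \<delta>: "\<delta> > 0" using R by (simp add: \<delta>_def)
  have mm: "m * (1 - m) > 0" "m * (1 - m) \<le> 1" using m by (auto intro: mult_le_one)
  have C: "C \<ge> 1152"
  proof -
    have "1152 * (m * (1 - m)) \<le> 1152 * M" using mm M by linarith
    then show ?thesis unfolding C_def using mm by (simp add: pos_le_divide_eq)
  qed
  have R2m: "R powr (2 - m) = R\<^sup>2 * \<delta>" using R by (simp add: \<delta>_def powr_diff powr_minus field_simps)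
  have \<psi>d: "- (2 * \<nu> * \<xi>) * exp (- (\<nu> * \<xi>\<^sup>2)) \<le> 0" "0 \<le> exp (- (\<nu> * \<xi>\<^sup>2)) \<and> exp (- (\<nu> * \<xi>\<^sup>2)) \<le> 1" if "\<xi> \<in> {R/2..R}" for \<xi>
    using \<open>\<nu> \<ge> 0\<close> that R by auto
  have pos: "\<xi> > 0" if "\<xi> \<in> {R/2..R}" for \<xi> using that R by auto
  \<comment> \<open>The sign assumption on \<open>\<tau>\<close> together with m < 1 makes the phase
    convex, as both van der Corput bounds require.\<close>
  have conv: "\<tau> * m * (m - 1) * \<xi> powr (m - 2) \<ge> 0" for \<xi>
  proof -
    have "\<tau> * m * (m - 1) = (- \<tau>) * (m * (1 - m))" by (simp add: algebra_simps)
    then have "\<tau> * m * (m - 1) \<ge> 0" using mm \<open>\<tau> \<le> 0\<close> by (simp add: mult_nonpos_nonneg)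
    then show ?thesis by (rule mult_nonneg_nonneg) simp
  qed
  \<comment> \<open>If |a| <= 4 \<delta>, the claimed bound exceeds R^2. In the second case \<delta>
    and M |\<tau>| are each at most |a|/4, so \<open>sep\<close> gives |A| >= |a|/2; the power term
    contributes slope at most |a|/4, and slope |a|/4 survives. In the last case the second
    derivative is at least \<open>\<mu>\<close>.\<close>
  consider "\<bar>a\<bar> \<le> 4 * \<delta>" | "\<bar>a\<bar> > 4 * \<delta>" "\<bar>\<tau>\<bar> \<le> \<bar>a\<bar> / (4 * M)" | "\<bar>a\<bar> > 4 * \<delta>" "\<bar>\<tau>\<bar> > \<bar>a\<bar> / (4 * M)" by linarith
  then have "(norm (integral {R/2..R} f))\<^sup>2 \<le> C * (R powr (2 - m) / (\<bar>a\<bar> + \<delta>))"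
  proof cases
    case 1
    have "norm (integral {R/2..R} f) \<le> integral {R/2..R} (\<lambda>_. 1 :: real)"
    proof (rule integral_norm_bound_integral)
      show "f integrable_on {R/2..R}" unfolding f_def
        using pos by (intro integrable_continuous_interval continuous_intros) force+
    qed (auto simp: f_def norm_mult \<open>\<nu> \<ge> 0\<close>)
    also have "\<dots> \<le> R" using R by simp
    finally have "(norm (integral {R/2..R} f))\<^sup>2 \<le> R\<^sup>2" by (intro power_mono) auto
    also have "R\<^sup>2 \<le> C * (R\<^sup>2 * \<delta> / (\<bar>a\<bar> + \<delta>))"
    proof -
      have "\<bar>a\<bar> + \<delta> \<le> C * \<delta>" using 1 C \<delta> mult_right_mono[OF C, of \<delta>] by linarith
      then have "R\<^sup>2 * (\<bar>a\<bar> + \<delta>) \<le> R\<^sup>2 * (C * \<delta>)" by (intro mult_left_mono) auto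
      then show ?thesis using \<delta> by (simp add: pos_le_divide_eq mult_ac)
    qed
    finally show ?thesis unfolding R2m .
  next
    case 2
    have a0: "\<bar>a\<bar> > 0" using 2 \<delta> by linarith
    have "\<bar>a\<bar> / (4 * M) \<le> \<bar>a\<bar> / 4" using M by (intro divide_left_mono) auto
    then have \<tau>: "\<bar>\<tau>\<bar> \<le> \<bar>a\<bar> / 4" using 2 by linarith
    have "M * \<bar>\<tau>\<bar> \<le> M * (\<bar>a\<bar> / (4 * M))" using 2 M by (intro mult_left_mono) auto
    then have "M * \<bar>\<tau>\<bar> \<le> \<bar>a\<bar> / 4" using M by simp
    then have A: "\<bar>A\<bar> \<ge> \<bar>a\<bar> / 2" using sep 2 unfolding \<delta>_def[symmetric] by linarith
    have "norm (integral {R/2..R} f) \<le> 5 / (\<bar>a\<bar> / 4)"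
      unfolding f_def
    proof (rule van_der_corput_first[where \<phi>' = "\<lambda>\<xi>. A + \<tau> * m * \<xi> powr (m - 1)"
        and \<phi>'' = "\<lambda>\<xi>. \<tau> * m * (m - 1) * \<xi> powr (m - 2)" and \<psi>' = "\<lambda>\<xi>. - (2 * \<nu> * \<xi>) * exp (- (\<nu> * \<xi>\<^sup>2))"])
      fix \<xi> assume \<xi>: "\<xi> \<in> {R/2..R}"
      have "\<xi> powr (m - 1) \<le> 1" using powr_mono[of "m - 1" 0 \<xi>] \<xi> R m by auto
      then have "m * \<xi> powr (m - 1) \<le> 1" using m by (intro mult_le_one) auto
      then have "\<bar>\<tau>\<bar> * (m * \<xi> powr (m - 1)) \<le> \<bar>\<tau>\<bar>" using mult_left_mono[of "m * \<xi> powr (m - 1)" 1 "\<bar>\<tau>\<bar>"] by simp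
      then have "\<bar>\<tau> * m * \<xi> powr (m - 1)\<bar> \<le> \<bar>a\<bar> / 4" using \<tau> m by (simp add: abs_mult mult.assoc)
      then show "\<bar>a\<bar> / 4 \<le> \<bar>A + \<tau> * m * \<xi> powr (m - 1)\<bar>" using A by linarith
      show "((\<lambda>\<xi>. A * \<xi> + \<tau> * \<xi> powr m) has_real_derivative A + \<tau> * m * \<xi> powr (m - 1)) (at \<xi>)"
        by (rule power_phase_derivs(1)[OF pos[OF \<xi>]])
      show "((\<lambda>\<xi>. A + \<tau> * m * \<xi> powr (m - 1)) has_real_derivative \<tau> * m * (m - 1) * \<xi> powr (m - 2)) (at \<xi>)"
        by (rule power_phase_derivs(2)[OF pos[OF \<xi>]])
      show "((\<lambda>\<xi>. exp (- (\<nu> * \<xi>\<^sup>2))) has_real_derivative - (2 * \<nu> * \<xi>) * exp (- (\<nu> * \<xi>\<^sup>2))) (at \<xi>)"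
        by (rule power_phase_derivs(3)[OF pos[OF \<xi>]])
      show "- (2 * \<nu> * \<xi>) * exp (- (\<nu> * \<xi>\<^sup>2)) \<le> 0" "0 \<le> exp (- (\<nu> * \<xi>\<^sup>2)) \<and> exp (- (\<nu> * \<xi>\<^sup>2)) \<le> 1"
        by (rule \<psi>d[OF \<xi>])+
      show "0 \<le> \<tau> * m * (m - 1) * \<xi> powr (m - 2)" by (rule conv)
    qed (use R a0 in auto)
    then have "(norm (integral {R/2..R} f))\<^sup>2 \<le> (5 / (\<bar>a\<bar> / 4))\<^sup>2" by (intro power_mono) auto
    also have "\<dots> = 400 / \<bar>a\<bar> * (1 / \<bar>a\<bar>)" by (simp add: power2_eq_square field_simps)
    \<comment> \<open>The inverse square of |a| is converted to the common form: |a| > 4 R^-m and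
      R^(2-2m) >= 1 give R^(2-m) |a| >= 4. This conversion uses m < 1.\<close>
    also have "\<dots> \<le> (C * R powr (2 - m) / 2) * (1 / \<bar>a\<bar>)"
    proof (intro mult_right_mono)
      have "R powr (2 - m) * (4 * \<delta>) \<le> R powr (2 - m) * \<bar>a\<bar>" using 2 by (intro mult_left_mono) auto
      moreover have "R powr (2 - m) * \<delta> = R powr (2 - 2 * m)" unfolding \<delta>_def by (simp flip: powr_add)
      moreover have "R powr (2 - 2 * m) \<ge> 1" using R m by (intro ge_one_powr_ge_zero) auto
      ultimately have "4 \<le> R powr (2 - m) * \<bar>a\<bar>" by linarith
      then have "1152 * 4 \<le> C * (R powr (2 - m) * \<bar>a\<bar>)" using C by (intro mult_mono) auto
      then show "400 / \<bar>a\<bar> \<le> C * R powr (2 - m) / 2" using a0 by (simp add: pos_divide_le_eq mult_ac)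
    qed auto
    also have "\<dots> = C * (R powr (2 - m) / (2 * \<bar>a\<bar>))" by simp
    also have "\<dots> \<le> C * (R powr (2 - m) / (\<bar>a\<bar> + \<delta>))"
      using C 2 \<delta> by (intro mult_left_mono divide_left_mono mult_pos_pos) auto
    finally show ?thesis .
  next
    case 3
    have a0: "\<bar>a\<bar> > 0" using 3 \<delta> by linarith
    define \<mu> where "\<mu> = \<bar>\<tau>\<bar> * (m * (1 - m)) * R powr (m - 2)"
    have "0 \<le> \<bar>a\<bar> / (4 * M)" using M by simp
    then have "\<bar>\<tau>\<bar> > 0" using 3 by linarith
    then have \<mu>: "\<mu> > 0" unfolding \<mu>_def using mm R by simp
    have "norm (integral {R/2..R} f) \<le> 12 / sqrt \<mu>"
      unfolding f_def
    proof (rule van_der_corput_second[where \<phi>' = "\<lambda>\<xi>. A + \<tau> * m * \<xi> powr (m - 1)"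
        and \<phi>'' = "\<lambda>\<xi>. \<tau> * m * (m - 1) * \<xi> powr (m - 2)" and \<psi>' = "\<lambda>\<xi>. - (2 * \<nu> * \<xi>) * exp (- (\<nu> * \<xi>\<^sup>2))"])
      fix \<xi> assume \<xi>: "\<xi> \<in> {R/2..R}"
      have "R powr (m - 2) \<le> \<xi> powr (m - 2)" using \<xi> R m by (intro powr_mono2') auto
      then have "\<mu> \<le> \<bar>\<tau>\<bar> * (m * (1 - m)) * \<xi> powr (m - 2)" unfolding \<mu>_def using mm by (intro mult_left_mono) auto
      also have "\<dots> = \<tau> * m * (m - 1) * \<xi> powr (m - 2)" using \<open>\<tau> \<le> 0\<close> by (simp add: algebra_simps)
      finally show "\<mu> \<le> \<tau> * m * (m - 1) * \<xi> powr (m - 2)" .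
      show "((\<lambda>\<xi>. A * \<xi> + \<tau> * \<xi> powr m) has_real_derivative A + \<tau> * m * \<xi> powr (m - 1)) (at \<xi>)"
        by (rule power_phase_derivs(1)[OF pos[OF \<xi>]])
      show "((\<lambda>\<xi>. A + \<tau> * m * \<xi> powr (m - 1)) has_real_derivative \<tau> * m * (m - 1) * \<xi> powr (m - 2)) (at \<xi>)"
        by (rule power_phase_derivs(2)[OF pos[OF \<xi>]])
      show "((\<lambda>\<xi>. exp (- (\<nu> * \<xi>\<^sup>2))) has_real_derivative - (2 * \<nu> * \<xi>) * exp (- (\<nu> * \<xi>\<^sup>2))) (at \<xi>)"
        by (rule power_phase_derivs(3)[OF pos[OF \<xi>]])
      show "- (2 * \<nu> * \<xi>) * exp (- (\<nu> * \<xi>\<^sup>2)) \<le> 0" "0 \<le> exp (- (\<nu> * \<xi>\<^sup>2)) \<and> exp (- (\<nu> * \<xi>\<^sup>2)) \<le> 1"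
        by (rule \<psi>d[OF \<xi>])+
    qed (use R \<mu> in auto)
    then have "(norm (integral {R/2..R} f))\<^sup>2 \<le> (12 / sqrt \<mu>)\<^sup>2" by (intro power_mono) auto
    also have "\<dots> = 144 / \<mu>" using \<mu> by (simp add: power_divide)
    also have "\<dots> \<le> 144 / ((\<bar>a\<bar> / (4 * M)) * (m * (1 - m)) * R powr (m - 2))"
    proof (rule frac_le)
      have p: "\<bar>a\<bar> / (4 * M) > 0" "R powr (m - 2) > 0" using a0 M R by auto
      show "0 < (\<bar>a\<bar> / (4 * M)) * (m * (1 - m)) * R powr (m - 2)" by (intro mult_pos_pos p mm)
      show "(\<bar>a\<bar> / (4 * M)) * (m * (1 - m)) * R powr (m - 2) \<le> \<mu>"
        unfolding \<mu>_def using 3 mm p by (intro mult_right_mono) linarith+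
    qed auto
    also have "\<dots> = C * (R powr (2 - m) / (2 * \<bar>a\<bar>))"
    proof -
      have "R powr (m - 2) * R powr (2 - m) = 1" using R by (simp flip: powr_add)
      then have r: "R powr (2 - m) = 1 / R powr (m - 2)" using R by (simp add: field_simps)
      have "144 / (x / (4 * M) * q * r) = 1152 * M / q * (1 / r / (2 * x))" if "x > 0" "q > 0" for x q r
        using that M by (simp add: field_simps)
      from this[OF a0 mm(1)] show ?thesis unfolding C_def r .
    qed
    also have "\<dots> \<le> C * (R powr (2 - m) / (\<bar>a\<bar> + \<delta>))"
      using C 3 \<delta> by (intro mult_left_mono divide_left_mono mult_pos_pos) auto
    finally show ?thesis .
  qed
  then show ?thesis unfolding f_def C_def \<delta>_def .
qed

text \<open>\<open>a\<close> is the true separation of two points and \<open>A\<close> the linear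
  coefficient after the shifts by \<theta> t; \<open>sep\<close> is the only link between them.
  Conjugation reverses the sign of \<open>\<tau>\<close>, which reduces the claim to a convex
  phase.\<close>

lemma dyadic_kernel_bound:
  fixes m M R a A \<tau> \<nu> :: real
  assumes m: "0 < m" "m < 1" and M: "M \<ge> 1" and R: "R \<ge> 2" and "\<nu> \<ge> 0"
    and sep: "\<bar>a\<bar> \<le> \<bar>A\<bar> + M * \<bar>\<tau>\<bar> + R powr (- m)"
  shows "(norm (integral {R/2..R} (\<lambda>\<xi>. cis (A * \<xi> + \<tau> * \<xi> powr m) * of_real (exp (- (\<nu> * \<xi>\<^sup>2))))))\<^sup>2
     \<le> 1152 * M / (m * (1 - m)) * (R powr (2 - m) / (\<bar>a\<bar> + R powr (- m)))"
proof (cases "\<tau> \<le> 0")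
  case True
  then show ?thesis using assms by (intro dyadic_kernel_bound_aux)
next
  case False
  have "norm (integral {R/2..R} (\<lambda>\<xi>. cis (A * \<xi> + \<tau> * \<xi> powr m) * of_real (exp (- (\<nu> * \<xi>\<^sup>2))))) =
     norm (cnj (integral {R/2..R} (\<lambda>\<xi>. cis (A * \<xi> + \<tau> * \<xi> powr m) * of_real (exp (- (\<nu> * \<xi>\<^sup>2))))))" by simp
  also have "\<dots> = norm (integral {R/2..R} (\<lambda>\<xi>. cis ((- A) * \<xi> + (- \<tau>) * \<xi> powr m) * of_real (exp (- (\<nu> * \<xi>\<^sup>2)))))"
    unfolding integral_cnj by (simp add: cis_cnj)
  finally show ?thesis using dyadic_kernel_bound_aux[of m M R \<nu> "- \<tau>" a "- A"] assms False by simp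
qed

subsection \<open>A $TT^*$ bound from $L^2$ to $L^4$\<close>

text \<open>The diagonal case of Young's convolution inequality $L^{4/3} * L^2 \to L^4$ by
  Cauchy--Schwarz: $F(x)^3 F(y)^3 k(x-y) = F(x)^2F(y)^2 \cdot F(x)F(y)k(x-y)$.\<close>

lemma young_diagonal:
  fixes F k :: "real \<Rightarrow> ennreal"
  assumes [measurable]: "F \<in> borel_measurable borel" "k \<in> borel_measurable borel"
    and F: "\<And>x. x \<notin> {0<..<1} \<Longrightarrow> F x = 0"
    and k: "(\<integral>\<^sup>+z\<in>{-1<..<1}. k z ^ 2 \<partial>lborel) \<le> B"
  shows "(\<integral>\<^sup>+x. \<integral>\<^sup>+y. F x ^ 3 * F y ^ 3 * k (x - y) \<partial>lborel \<partial>lborel)\<^sup>2 \<le> (\<integral>\<^sup>+x. F x ^ 4 \<partial>lborel) ^ 3 * B"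
proof -
  define I where "I = (\<integral>\<^sup>+x. F x ^ 4 \<partial>lborel)"
  define M where "M = (lborel \<Otimes>\<^sub>M lborel :: (real \<times> real) measure)"
  define p where "p = (\<lambda>(x, y). F x ^ 2 * F y ^ 2)"
  define q where "q = (\<lambda>(x, y). F x * F y * k (x - y))"
  have [measurable]: "p \<in> borel_measurable M" "q \<in> borel_measurable M" unfolding p_def q_def M_def by measurable
  have qI: "(\<integral>\<^sup>+z. q z ^ 2 \<partial>M) \<le> I * B"
  proof -
    \<comment> \<open>\<open>F\<close> lives on the unit interval, so only differences inside (-1,
      1) occur and the kernel may be cut off there.\<close>
    define \<kappa> where "\<kappa> = (\<lambda>z. k z ^ 2 * indicator {-1<..<1} z)"
    have [measurable]: "\<kappa> \<in> borel_measurable borel" unfolding \<kappa>_def by measurable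
    have \<kappa>: "(\<integral>\<^sup>+z. \<kappa> z \<partial>lborel) \<le> B" using k by (simp add: \<kappa>_def)
    have \<kappa>x: "(\<integral>\<^sup>+y. \<kappa> (x - y) \<partial>lborel) \<le> B" for x
      using nn_integral_real_affine[of \<kappa> "-1" x] \<kappa> by simp
    have \<kappa>y: "(\<integral>\<^sup>+x. \<kappa> (x - y) \<partial>lborel) \<le> B" for y
      using nn_integral_real_affine[of \<kappa> 1 "-y"] \<kappa> by simp
    have le: "(F x * F y * k (x - y))\<^sup>2 \<le> (F x ^ 4 + F y ^ 4) / 2 * \<kappa> (x - y)" for x y
    proof (cases "x \<in> {0<..<1} \<and> y \<in> {0<..<1}")
      case True
      then have "\<kappa> (x - y) = k (x - y) ^ 2" by (auto simp: \<kappa>_def)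
      moreover have "F x ^ 2 * F y ^ 2 \<le> (F x ^ 4 + F y ^ 4) / 2"
      proof (cases "F x = \<top> \<or> F y = \<top>")
        case True
        then have "F x ^ 4 + F y ^ 4 = \<top>" by auto
        then have "(F x ^ 4 + F y ^ 4) / 2 = \<top>" by (simp only: ennreal_divide_eq_top_iff) simp
        then show ?thesis by (simp only: top_greatest)
      next
        case False
        then obtain a b where ab: "F x = ennreal a" "F y = ennreal b" "a \<ge> 0" "b \<ge> 0"
          by (metis ennreal_cases)
        have "a\<^sup>2 * b\<^sup>2 \<le> (a ^ 4 + b ^ 4) / 2"
          using sum_squares_bound[of "a\<^sup>2" "b\<^sup>2"] by simp
        then have "ennreal (a\<^sup>2 * b\<^sup>2) \<le> ennreal ((a ^ 4 + b ^ 4) / 2)" by (rule ennreal_leI)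
        then show ?thesis using ab
          by (simp add: ennreal_power ennreal_mult ennreal_plus divide_ennreal[symmetric])
      qed
      ultimately show ?thesis by (simp add: power_mult_distrib mult_right_mono)
    next
      case False
      then have "F x * F y = 0" using F by auto
      then have "(F x * F y * k (x - y))\<^sup>2 = 0" by (simp only: mult_zero_left) simp
      then show ?thesis by (simp only: zero_le)
    qed
    have "(\<integral>\<^sup>+z. q z ^ 2 \<partial>M) = (\<integral>\<^sup>+x. \<integral>\<^sup>+y. (F x * F y * k (x - y))\<^sup>2 \<partial>lborel \<partial>lborel)"
      unfolding M_def q_def by (subst lborel.nn_integral_fst[symmetric]) auto
    also have "\<dots> \<le> (\<integral>\<^sup>+x. \<integral>\<^sup>+y. (F x ^ 4 + F y ^ 4) / 2 * \<kappa> (x - y) \<partial>lborel \<partial>lborel)"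
      by (intro nn_integral_mono le)
    also have "\<dots> = (\<integral>\<^sup>+x. \<integral>\<^sup>+y. F x ^ 4 / 2 * \<kappa> (x - y) + F y ^ 4 / 2 * \<kappa> (x - y) \<partial>lborel \<partial>lborel)"
      by (intro nn_integral_cong) (simp add: add_divide_distrib_ennreal distrib_right)
    also have "\<dots> = (\<integral>\<^sup>+x. \<integral>\<^sup>+y. F x ^ 4 / 2 * \<kappa> (x - y) \<partial>lborel \<partial>lborel) + (\<integral>\<^sup>+x. \<integral>\<^sup>+y. F y ^ 4 / 2 * \<kappa> (x - y) \<partial>lborel \<partial>lborel)"
      by (simp add: nn_integral_add)
    also have "(\<integral>\<^sup>+x. \<integral>\<^sup>+y. F y ^ 4 / 2 * \<kappa> (x - y) \<partial>lborel \<partial>lborel) = (\<integral>\<^sup>+y. \<integral>\<^sup>+x. F y ^ 4 / 2 * \<kappa> (x - y) \<partial>lborel \<partial>lborel)"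
      by (rule lborel_pair.Fubini') measurable
    also have "\<dots> \<le> (\<integral>\<^sup>+y. F y ^ 4 / 2 * B \<partial>lborel)"
      by (intro nn_integral_mono) (subst nn_integral_cmult, auto intro: mult_left_mono \<kappa>y)
    also have "(\<integral>\<^sup>+x. \<integral>\<^sup>+y. F x ^ 4 / 2 * \<kappa> (x - y) \<partial>lborel \<partial>lborel) \<le> (\<integral>\<^sup>+x. F x ^ 4 / 2 * B \<partial>lborel)"
      by (intro nn_integral_mono) (subst nn_integral_cmult, auto intro: mult_left_mono \<kappa>x)
    also have "(\<integral>\<^sup>+x. F x ^ 4 / 2 * B \<partial>lborel) = I / 2 * B"
      by (simp add: nn_integral_multc nn_integral_divide I_def)
    also have "I / 2 * B + I / 2 * B = I * B"
      unfolding distrib_right[symmetric] add_divide_distrib_ennreal[symmetric] unfolding mult_2_right[symmetric] by (simp add: ennreal_mult_divide_eq)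
    finally show ?thesis by (simp add: add_right_mono)
  qed
  have "(\<integral>\<^sup>+x. \<integral>\<^sup>+y. F x ^ 3 * F y ^ 3 * k (x - y) \<partial>lborel \<partial>lborel) = (\<integral>\<^sup>+z. p z * q z \<partial>M)"
    unfolding M_def p_def q_def
    by (subst lborel.nn_integral_fst[symmetric]) (auto simp: power2_eq_square power3_eq_cube mult_ac intro!: nn_integral_cong)
  then have "(\<integral>\<^sup>+x. \<integral>\<^sup>+y. F x ^ 3 * F y ^ 3 * k (x - y) \<partial>lborel \<partial>lborel)\<^sup>2 \<le> (\<integral>\<^sup>+z. p z ^ 2 \<partial>M) * (\<integral>\<^sup>+z. q z ^ 2 \<partial>M)"
    using Cauchy_Schwarz_nn_integral[of p M q] by simp
  also have "(\<integral>\<^sup>+z. p z ^ 2 \<partial>M) = (\<integral>\<^sup>+x. \<integral>\<^sup>+y. F x ^ 4 * F y ^ 4 \<partial>lborel \<partial>lborel)"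
    unfolding M_def p_def
    by (subst lborel.nn_integral_fst[symmetric]) (auto simp: power_mult_distrib simp flip: power_mult intro!: nn_integral_cong)
  also have "\<dots> = I * I" by (simp add: nn_integral_cmult nn_integral_multc I_def)
  also have "I * I * (\<integral>\<^sup>+z. q z ^ 2 \<partial>M) \<le> I * I * (I * B)" by (intro mult_left_mono qI) auto
  finally show ?thesis unfolding I_def[symmetric] power3_eq_cube by (simp only: mult.assoc)
qed

text \<open>With I the integral of |T|^4, duality and Cauchy-Schwarz give I^2 <= |G|^2 J, where |G|
  is the \<open>L^2\<close> norm and J bounds the quadratic form of the kernel. The diagonal Young
  inequality gives J^2 <= I^3 B. Hence I^4 <= |G|^4 I^3 B, and I^3 cancels.\<close>

theorem TT_star_L2_L4:
  fixes e :: "real \<times> real \<Rightarrow> complex" and G :: "real \<Rightarrow> complex" and k :: "real \<Rightarrow> real"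
  assumes e [measurable]: "e \<in> borel_measurable (lborel \<Otimes>\<^sub>M lborel)" and e1: "\<And>z. norm (e z) \<le> 1"
    and E [measurable]: "E \<in> sets borel" "emeasure lborel E < \<infinity>"
    and G: "integrable lborel G" "\<And>\<xi>. \<xi> \<notin> E \<Longrightarrow> G \<xi> = 0"
    and k [measurable]: "k \<in> borel_measurable borel"
    and kernel: "\<And>x y. x \<in> {0<..<1} \<Longrightarrow> y \<in> {0<..<1} \<Longrightarrow>
       norm (LINT \<xi>|lborel. e (x, \<xi>) * (cnj (e (y, \<xi>)) * of_real (indicator E \<xi>))) \<le> k (x - y)"
    and kB: "(\<integral>\<^sup>+z\<in>{-1<..<1}. ennreal (k z) ^ 2 \<partial>lborel) \<le> B"
  shows "(\<integral>\<^sup>+x\<in>{0<..<1}. ennreal (norm (LINT \<xi>|lborel. e (x, \<xi>) * G \<xi>)) ^ 4 \<partial>lborel) \<le> B * (l2sq G)\<^sup>2"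
proof -
  have [measurable]: "G \<in> borel_measurable borel" using G(1) by auto
  define T where "T = (\<lambda>x. LINT \<xi>|lborel. e (x, \<xi>) * G \<xi>)"
  have [measurable]: "T \<in> borel_measurable borel" unfolding T_def by measurable
  define b where "b = (LINT \<xi>|lborel. norm (G \<xi>))"
  have b: "norm (T x) \<le> b" for x
  proof -
    have "norm (T x) \<le> (LINT \<xi>|lborel. norm (e (x, \<xi>) * G \<xi>))" unfolding T_def by (rule integral_norm_bound)
    also have "\<dots> \<le> b" unfolding b_def
      using G(1) e1 by (intro integral_mono integrable_norm integrable_bounded_mult[where B = 1])
        (auto simp: norm_mult intro!: mult_left_le_one_le)
    finally show ?thesis .
  qed
  have b0: "b \<ge> 0" using b[of 0] norm_ge_zero order_trans by blast
  define \<chi>01 :: "real \<Rightarrow> complex" where "\<chi>01 = (\<lambda>x. of_real (indicator {0<..<1} x))"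
  \<comment> \<open>The extremal function of \<open>L^4\<close> duality: paired with
    \<open>T\<close> it reproduces the integral of |T|^4, and its own modulus is |T|^3.\<close>
  define w where "w = (\<lambda>x. (cnj (T x) * of_real ((norm (T x))\<^sup>2)) * \<chi>01 x)"
  have \<chi>int: "integrable lborel \<chi>01" unfolding \<chi>01_def by (intro integrable_of_real integrable_real_indicator) auto
  have w_int: "integrable lborel w" unfolding w_def
  proof (rule integrable_bounded_mult[OF \<chi>int, where B = "b ^ 3"])
    show "norm (cnj (T x) * of_real ((norm (T x))\<^sup>2)) \<le> b ^ 3" for x
      using power_mono[OF b[of x], of 3] by (simp add: norm_mult norm_power power2_eq_square power3_eq_cube)
  qed measurable
  have [measurable]: "w \<in> borel_measurable borel" using w_int by auto
  define F where "F = (\<lambda>x. ennreal (norm (T x)) * indicator {0<..<1} x)"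
  have [measurable]: "F \<in> borel_measurable borel" unfolding F_def by measurable
  have wF: "ennreal (norm (w x)) = F x ^ 3" for x
    by (auto simp: w_def F_def \<chi>01_def indicator_def norm_mult norm_power ennreal_power power2_eq_square power3_eq_cube ennreal_mult mult_ac)
  define I where "I = (\<integral>\<^sup>+x. F x ^ 4 \<partial>lborel)"
  have I_eq: "I = (\<integral>\<^sup>+x\<in>{0<..<1}. ennreal (norm (T x)) ^ 4 \<partial>lborel)"
    unfolding I_def F_def by (intro nn_integral_cong) (auto simp: indicator_def)
  \<comment> \<open>Finiteness is secured in advance from the crude bound \<open>b\<close>, because
    the last step divides by a power of \<open>I\<close>.\<close>
  have "I \<le> (\<integral>\<^sup>+x. ennreal (b ^ 4) * indicator {0<..<1::real} x \<partial>lborel)"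
    unfolding I_def F_def
  proof (rule nn_integral_mono)
    show "(ennreal (norm (T x)) * indicator {0<..<1} x) ^ 4 \<le> ennreal (b ^ 4) * indicator {0<..<1} x" for x
      using b[of x] by (auto simp: indicator_def ennreal_power intro!: ennreal_leI power_mono)
  qed
  also have "\<dots> < \<infinity>" by (subst nn_integral_cmult_indicator) (auto simp: ennreal_mult_less_top)
  finally have I_fin: "I < \<infinity>" .
  define W where "W = (\<lambda>\<xi>. LINT x|lborel. e (x, \<xi>) * w x)"
  have [measurable]: "W \<in> borel_measurable borel" unfolding W_def by measurable
  define b' where "b' = (LINT x|lborel. norm (w x))"
  have W_le: "norm (W \<xi>) \<le> b'" for \<xi>
  proof -
    have "norm (W \<xi>) \<le> (LINT x|lborel. norm (e (x, \<xi>) * w x))" unfolding W_def by (rule integral_norm_bound)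
    also have "\<dots> \<le> b'" unfolding b'_def
      using w_int e1 by (intro integral_mono integrable_norm integrable_bounded_mult[where B = 1])
        (auto simp: norm_mult intro!: mult_left_le_one_le)
    finally show ?thesis .
  qed
  define \<chi>E :: "real \<Rightarrow> complex" where "\<chi>E = (\<lambda>\<xi>. of_real (indicator E \<xi>))"
  have \<chi>E: "integrable lborel \<chi>E" unfolding \<chi>E_def by (intro integrable_of_real integrable_real_indicator) (use E in auto)
  have [measurable]: "\<chi>E \<in> borel_measurable borel" using \<chi>E by auto
  have WE: "integrable lborel (\<lambda>\<xi>. W \<xi> * \<chi>E \<xi>)"
    by (rule integrable_bounded_mult[OF \<chi>E _ W_le]) simp
  have step1: "(LINT x|lborel. w x * T x) = (LINT \<xi>|lborel. G \<xi> * (W \<xi> * \<chi>E \<xi>))"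
  proof -
    have "(LINT x|lborel. w x * T x) = (LINT \<xi>|lborel. G \<xi> * W \<xi>)"
      unfolding T_def W_def by (rule fubini_kernel(2)[OF G(1) w_int e e1])
    also have "\<dots> = (LINT \<xi>|lborel. G \<xi> * (W \<xi> * \<chi>E \<xi>))"
      using G(2) by (intro Bochner_Integration.integral_cong) (auto simp: \<chi>E_def indicator_def)
    finally show ?thesis .
  qed
  have I_T: "I = ennreal (norm (LINT x|lborel. w x * T x))"
  proof -
    have eq: "w x * T x = of_real ((norm (T x)) ^ 4 * indicator {0<..<1} x)" for x
    proof -
      have "w x * T x = (T x * cnj (T x)) * of_real ((norm (T x))\<^sup>2 * indicator {0<..<1} x)"
        by (simp add: w_def \<chi>01_def)
      also have "\<dots> = of_real ((norm (T x))\<^sup>2 * ((norm (T x))\<^sup>2 * indicator {0<..<1} x))"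
        unfolding complex_norm_square[symmetric] by simp
      finally show ?thesis by (simp add: mult.assoc[symmetric] flip: power_add)
    qed
    have "integrable lborel (\<lambda>x. T x * w x)" by (rule integrable_bounded_mult[OF w_int _ b]) simp
    then have i: "integrable lborel (\<lambda>x. (norm (T x)) ^ 4 * indicator {0<..<1} x :: real)"
      unfolding complex_of_real_integrable_eq[symmetric] eq[symmetric] by (simp add: mult.commute)
    have "I = (\<integral>\<^sup>+x. ennreal ((norm (T x)) ^ 4 * indicator {0<..<1} x) \<partial>lborel)"
      unfolding I_eq by (intro nn_integral_cong) (auto simp: ennreal_power indicator_def)
    also have "\<dots> = ennreal (LINT x|lborel. (norm (T x)) ^ 4 * indicator {0<..<1} x)"
      by (rule nn_integral_eq_integral[OF i]) auto
    also have "\<dots> = ennreal (norm (complex_of_real (LINT x|lborel. (norm (T x)) ^ 4 * indicator {0<..<1} x)))"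
      unfolding norm_of_real by (subst abs_of_nonneg) (auto intro!: Bochner_Integration.integral_nonneg)
    finally show ?thesis unfolding eq integral_complex_of_real .
  qed
  have I1: "I\<^sup>2 \<le> l2sq G * l2sq (\<lambda>\<xi>. W \<xi> * \<chi>E \<xi>)"
  proof -
    have "I \<le> (\<integral>\<^sup>+\<xi>. ennreal (norm (G \<xi> * (W \<xi> * \<chi>E \<xi>))) \<partial>lborel)"
      unfolding I_T step1 by (rule norm_integral_le_nn_integral)
    then have "I\<^sup>2 \<le> (\<integral>\<^sup>+\<xi>. ennreal (norm (G \<xi> * (W \<xi> * \<chi>E \<xi>))) \<partial>lborel)\<^sup>2" by (rule power_mono) simp
    also have "\<dots> \<le> l2sq G * l2sq (\<lambda>\<xi>. W \<xi> * \<chi>E \<xi>)" by (rule l2_Cauchy_Schwarz) measurable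
    finally show ?thesis .
  qed
  define K where "K = (\<lambda>x y. LINT \<xi>|lborel. e (x, \<xi>) * (cnj (e (y, \<xi>)) * \<chi>E \<xi>))"
  have W_K: "l2sq (\<lambda>\<xi>. W \<xi> * \<chi>E \<xi>) = ennreal (norm (LINT y|lborel. cnj (w y) * (LINT x|lborel. w x * K x y)))"
  proof -
    have eq: "(W \<xi> * \<chi>E \<xi>) * cnj (W \<xi>) = of_real ((norm (W \<xi> * \<chi>E \<xi>))\<^sup>2)" for \<xi>
      unfolding complex_norm_square by (auto simp: \<chi>E_def indicator_def)
    have "integrable lborel (\<lambda>\<xi>. cnj (W \<xi>) * (W \<xi> * \<chi>E \<xi>))"
      by (rule integrable_bounded_mult[OF WE, where B = b']) (use W_le in auto)
    then have i: "integrable lborel (\<lambda>\<xi>. (norm (W \<xi> * \<chi>E \<xi>))\<^sup>2)"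
      unfolding complex_of_real_integrable_eq[symmetric] eq[symmetric] by (simp add: mult.commute)
    have "l2sq (\<lambda>\<xi>. W \<xi> * \<chi>E \<xi>) = ennreal (LINT \<xi>|lborel. (norm (W \<xi> * \<chi>E \<xi>))\<^sup>2)"
      by (rule nn_integral_eq_integral[OF i]) auto
    also have "\<dots> = ennreal (norm (complex_of_real (LINT \<xi>|lborel. (norm (W \<xi> * \<chi>E \<xi>))\<^sup>2)))"
      unfolding norm_of_real by (subst abs_of_nonneg) (auto intro!: Bochner_Integration.integral_nonneg)
    also have "complex_of_real (LINT \<xi>|lborel. (norm (W \<xi> * \<chi>E \<xi>))\<^sup>2) = (LINT \<xi>|lborel. (W \<xi> * \<chi>E \<xi>) * cnj (W \<xi>))"
      unfolding eq integral_complex_of_real ..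
    also have "\<dots> = (LINT \<xi>|lborel. (W \<xi> * \<chi>E \<xi>) * (LINT y|lborel. cnj (e (y, \<xi>)) * cnj (w y)))"
      unfolding W_def Bochner_Integration.integral_cnj[symmetric] by simp
    also have "\<dots> = (LINT y|lborel. cnj (w y) * (LINT \<xi>|lborel. cnj (e (y, \<xi>)) * (W \<xi> * \<chi>E \<xi>)))"
      using fubini_kernel(2)[of "\<lambda>y. cnj (w y)" "\<lambda>\<xi>. W \<xi> * \<chi>E \<xi>" "\<lambda>z. cnj (e (snd z, fst z))" 1]
        w_int WE e1 by simp
    also have "(\<lambda>y. LINT \<xi>|lborel. cnj (e (y, \<xi>)) * (W \<xi> * \<chi>E \<xi>)) = (\<lambda>y. LINT x|lborel. w x * K x y)"
    proof
      fix y
      have i: "integrable lborel (\<lambda>\<xi>. cnj (e (y, \<xi>)) * \<chi>E \<xi>)"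
        by (rule integrable_bounded_mult[OF \<chi>E, where B = 1]) (use e1 in auto)
      have "(LINT \<xi>|lborel. cnj (e (y, \<xi>)) * (W \<xi> * \<chi>E \<xi>)) = (LINT \<xi>|lborel. (cnj (e (y, \<xi>)) * \<chi>E \<xi>) * (LINT x|lborel. e (x, \<xi>) * w x))"
        unfolding W_def by (simp add: mult_ac)
      also have "\<dots> = (LINT x|lborel. w x * K x y)"
        unfolding K_def using fubini_kernel(2)[OF w_int i, of "\<lambda>z. e (snd z, fst z)" 1] e1 by simp
      finally show "(LINT \<xi>|lborel. cnj (e (y, \<xi>)) * (W \<xi> * \<chi>E \<xi>)) = (LINT x|lborel. w x * K x y)" .
    qed
    finally show ?thesis .
  qed
  define J where "J = (\<integral>\<^sup>+x. \<integral>\<^sup>+y. F x ^ 3 * F y ^ 3 * ennreal (k (x - y)) \<partial>lborel \<partial>lborel)"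
  have W_J: "l2sq (\<lambda>\<xi>. W \<xi> * \<chi>E \<xi>) \<le> J"
  proof -
    have "l2sq (\<lambda>\<xi>. W \<xi> * \<chi>E \<xi>) \<le> (\<integral>\<^sup>+y. ennreal (norm (cnj (w y) * (LINT x|lborel. w x * K x y))) \<partial>lborel)"
      unfolding W_K by (rule norm_integral_le_nn_integral)
    also have "\<dots> \<le> (\<integral>\<^sup>+y. \<integral>\<^sup>+x. F x ^ 3 * F y ^ 3 * ennreal (k (x - y)) \<partial>lborel \<partial>lborel)"
    proof (rule nn_integral_mono)
      fix y
      have "ennreal (norm (cnj (w y) * (LINT x|lborel. w x * K x y))) = ennreal (norm (LINT x|lborel. cnj (w y) * (w x * K x y)))"
        by simp
      also have "\<dots> \<le> (\<integral>\<^sup>+x. ennreal (norm (cnj (w y) * (w x * K x y))) \<partial>lborel)" by (rule norm_integral_le_nn_integral)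
      also have "\<dots> \<le> (\<integral>\<^sup>+x. F x ^ 3 * F y ^ 3 * ennreal (k (x - y)) \<partial>lborel)"
      proof (rule nn_integral_mono)
        fix x
        have "ennreal (norm (cnj (w y) * (w x * K x y))) = F x ^ 3 * F y ^ 3 * ennreal (norm (K x y))"
          by (simp add: norm_mult ennreal_mult wF mult_ac)
        also have "\<dots> \<le> F x ^ 3 * F y ^ 3 * ennreal (k (x - y))"
        proof (cases "x \<in> {0<..<1} \<and> y \<in> {0<..<1}")
          case True
          then show ?thesis using kernel[of x y] unfolding K_def \<chi>E_def by (intro mult_left_mono ennreal_leI) auto
        next
          case False
          then have "F x ^ 3 * F y ^ 3 = 0" by (auto simp: F_def)
          then show ?thesis by (simp only: mult_zero_left order_refl)
        qed
        finally show "ennreal (norm (cnj (w y) * (w x * K x y))) \<le> F x ^ 3 * F y ^ 3 * ennreal (k (x - y))" .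
      qed
      finally show "ennreal (norm (cnj (w y) * (LINT x|lborel. w x * K x y))) \<le> (\<integral>\<^sup>+x. F x ^ 3 * F y ^ 3 * ennreal (k (x - y)) \<partial>lborel)" .
    qed
    also have "\<dots> = J" unfolding J_def by (rule lborel_pair.Fubini'[symmetric]) measurable
    finally show ?thesis .
  qed
  have "J\<^sup>2 \<le> I ^ 3 * B"
    unfolding J_def I_def
    by (rule young_diagonal) (use kB in \<open>auto simp: F_def\<close>)
  moreover have "(I\<^sup>2)\<^sup>2 \<le> (l2sq G * J)\<^sup>2"
    by (rule power_mono[OF order_trans[OF I1 mult_left_mono[OF W_J]]]) auto
  ultimately have main: "I ^ 3 * I \<le> I ^ 3 * (B * (l2sq G)\<^sup>2)"
  proof -
    have "I ^ 3 * I = (I\<^sup>2)\<^sup>2" by (simp add: power3_eq_cube power2_eq_square mult_ac)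
    also have "\<dots> \<le> (l2sq G)\<^sup>2 * J\<^sup>2" using \<open>(I\<^sup>2)\<^sup>2 \<le> (l2sq G * J)\<^sup>2\<close> by (simp add: power_mult_distrib)
    also have "\<dots> \<le> (l2sq G)\<^sup>2 * (I ^ 3 * B)" using \<open>J\<^sup>2 \<le> I ^ 3 * B\<close> by (intro mult_left_mono) auto
    finally show ?thesis by (simp add: mult_ac)
  qed
  have "I \<le> B * (l2sq G)\<^sup>2"
  proof (cases "I = 0")
    case False
    then have "I ^ 3 \<noteq> 0" "I ^ 3 < \<top>" using I_fin by (auto simp: power_less_top_ennreal)
    then show ?thesis using main by (simp add: ennreal_mult_le_mult_iff)
  qed simp
  then show ?thesis unfolding I_eq T_def .
qed

subsection \<open>The maximal function of a dyadic frequency piece\<close>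

text \<open>\<open>\<sigma>\<close> is 1 or -1 and reflects negative frequencies to positive ones,
  so every phase has the form t \<xi>^m with \<xi> > 0. The third parameter is the strength of the
  Gaussian regularisation, 1/N^2 in \<open>evolution_reg\<close>; the value 0 is allowed.\<close>

definition osc :: "real \<Rightarrow> real \<Rightarrow> (real \<times> real \<times> real) \<Rightarrow> real \<Rightarrow> real \<Rightarrow> complex" where
  "osc m \<sigma> = (\<lambda>(t, \<theta>, \<nu>) x \<xi>. cis (\<sigma> * (x - \<theta> * t) * \<xi> + t * \<xi> powr m) * of_real (exp (- (\<nu> * \<xi>\<^sup>2))))"

definition osc_int :: "real \<Rightarrow> real \<Rightarrow> (real \<Rightarrow> complex) \<Rightarrow> (real \<times> real \<times> real) \<Rightarrow> real \<Rightarrow> complex" where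
  "osc_int m \<sigma> G p x = (LINT \<xi>|lborel. osc m \<sigma> p x \<xi> * G \<xi>)"

text \<open>All frequencies up to 1 form the block 0, so that the blocks partition the positive
  half-line and R = 2^j is always at least 1.\<close>

definition dyadic :: "nat \<Rightarrow> real set" where
  "dyadic j = (if j = 0 then {0<..1} else {2 ^ (j - 1)<..2 ^ j})"

lemma dyadic_sets [measurable]: "dyadic j \<in> sets borel"
  by (simp add: dyadic_def)

lemma dyadic_pos: "\<xi> \<in> dyadic j \<Longrightarrow> \<xi> > 0"
  unfolding dyadic_def by (auto split: if_splits intro: less_trans[of 0 "2 ^ (j - 1) :: real"])

lemma dyadic_subset: "dyadic j \<subseteq> {0..2 ^ j}"
  using dyadic_pos[of _ j] by (force simp: dyadic_def split: if_splits)

lemma dyadic_emeasure: "emeasure lborel (dyadic j) < \<infinity>"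
  by (rule le_less_trans[OF emeasure_mono[OF dyadic_subset]]) auto

text \<open>The bound for the squared kernel integrated over (-1, 1): with \<delta> = R^-m the
  integral of 1 / (|z| + \<delta>) is at most 2 ln ((1 + \<delta>) / \<delta>), and (1 + \<delta>) /
  \<delta> = 1 + R^m.\<close>

definition dyadic_const :: "real \<Rightarrow> real \<Rightarrow> nat \<Rightarrow> real" where
  "dyadic_const m M j = 2 * (1152 * M / (m * (1 - m))) * (2 ^ j) powr (2 - m) * ln (1 + (2 ^ j) powr m)"

lemma norm_osc: "\<nu> \<ge> 0 \<Longrightarrow> norm (osc m \<sigma> (t, \<theta>, \<nu>) x \<xi>) \<le> 1"
  by (simp add: osc_def norm_mult)

lemma inverse_abs_integral:
  fixes \<delta> :: real
  assumes "\<delta> > 0"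
  shows "(\<integral>\<^sup>+z\<in>{-1<..<1}. ennreal (1 / (\<bar>z\<bar> + \<delta>)) \<partial>lborel) \<le> ennreal (2 * ln ((1 + \<delta>) / \<delta>))"
proof -
  have 1: "(\<integral>\<^sup>+z\<in>{0..1}. ennreal (1 / (z + \<delta>)) \<partial>lborel) = ennreal (ln (1 + \<delta>) - ln (0 + \<delta>))"
    using assms by (intro nn_integral_FTC_Icc) (auto intro!: derivative_eq_intros)
  have 2: "(\<integral>\<^sup>+z\<in>{-1..0}. ennreal (1 / (\<delta> - z)) \<partial>lborel) = ennreal (- ln (\<delta> - 0) - (- ln (\<delta> - (-1))))"
    using assms by (intro nn_integral_FTC_Icc) (auto intro!: derivative_eq_intros)
  have "(\<integral>\<^sup>+z\<in>{-1<..<1}. ennreal (1 / (\<bar>z\<bar> + \<delta>)) \<partial>lborel) \<le>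
     (\<integral>\<^sup>+z. ennreal (1 / (z + \<delta>)) * indicator {0..1} z + ennreal (1 / (\<delta> - z)) * indicator {-1..0} z \<partial>lborel)"
    by (intro nn_integral_mono) (auto simp: indicator_def abs_if add.commute)
  also have "\<dots> = (\<integral>\<^sup>+z\<in>{0..1}. ennreal (1 / (z + \<delta>)) \<partial>lborel) + (\<integral>\<^sup>+z\<in>{-1..0}. ennreal (1 / (\<delta> - z)) \<partial>lborel)"
    by (intro nn_integral_add) measurable
  also have "\<dots> = ennreal (ln (1 + \<delta>) - ln \<delta>) + ennreal (ln (1 + \<delta>) - ln \<delta>)"
    unfolding 1 2 by (simp add: add.commute)
  also have "\<dots> = ennreal ((ln (1 + \<delta>) - ln \<delta>) + (ln (1 + \<delta>) - ln \<delta>))"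
    using assms by (intro ennreal_plus[symmetric]) auto
  also have "(ln (1 + \<delta>) - ln \<delta>) + (ln (1 + \<delta>) - ln \<delta>) = 2 * ln ((1 + \<delta>) / \<delta>)"
    using assms by (simp add: ln_div)
  finally show ?thesis .
qed

text \<open>The right side does not depend on the selections \<open>t\<close>,
  \<open>\<theta>\<close>, \<open>\<nu>\<close>, which is what later controls a supremum. The kernel
  bound is available for the square, so \<open>k\<close> is a square root and the squared
  \<open>L^2\<close> norm required by the \<open>TT*\<close> theorem is at most
  \<open>dyadic_const\<close>.\<close>

theorem linearised_dyadic_bound:
  fixes m M c \<sigma> :: real and j :: nat and t \<theta> \<nu> :: "real \<Rightarrow> real" and G :: "real \<Rightarrow> complex"
  assumes m: "0 < m" "m < 1" and M: "M \<ge> 1" and \<sigma>: "\<bar>\<sigma>\<bar> = 1"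
    and [measurable]: "t \<in> borel_measurable borel" "\<theta> \<in> borel_measurable borel" "\<nu> \<in> borel_measurable borel"
    and t: "\<And>x. t x \<in> {0<..<1}" and \<theta>: "\<And>x. \<theta> x \<in> {c..c + (2 ^ j) powr (- m)}" "\<And>x. \<bar>\<theta> x\<bar> \<le> M"
    and \<nu>: "\<And>x. \<nu> x \<ge> 0"
    and G: "integrable lborel G" "\<And>\<xi>. \<xi> \<notin> dyadic j \<Longrightarrow> G \<xi> = 0"
  shows "(\<integral>\<^sup>+x\<in>{0<..<1}. ennreal (norm (osc_int m \<sigma> G (t x, \<theta> x, \<nu> x) x) ^ 4) \<partial>lborel)
     \<le> ennreal (dyadic_const m M j) * (l2sq G)\<^sup>2"
proof -
  define R :: real where "R = 2 ^ j"
  define \<delta> where "\<delta> = R powr (- m)"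
  define C where "C = 1152 * M / (m * (1 - m))"
  define k where "k = (\<lambda>z. sqrt (C * (R powr (2 - m) / (\<bar>z\<bar> + \<delta>))))"
  define e where "e = (\<lambda>(x, \<xi>). osc m \<sigma> (t x, \<theta> x, \<nu> x) x \<xi>)"
  have R: "R \<ge> 1" by (simp add: R_def)
  have \<delta>: "\<delta> > 0" using R by (simp add: \<delta>_def)
  have mm: "m * (1 - m) > 0" "m * (1 - m) \<le> 1" using m by (auto intro: mult_le_one)
  have C: "C \<ge> 1152"
  proof -
    have "1152 * (m * (1 - m)) \<le> 1152 * M" using mm M by linarith
    then show ?thesis unfolding C_def using mm by (simp add: pos_le_divide_eq)
  qed
  \<comment> \<open>Conjugation subtracts phases but adds Gaussian exponents, so the amplitude of
    the kernel is again a decreasing Gaussian, as the van der Corput bounds need.\<close>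
  have kernel_eq: "osc m \<sigma> (t x, \<theta> x, \<nu> x) x \<xi> * cnj (osc m \<sigma> (t y, \<theta> y, \<nu> y) y \<xi>) =
      cis (\<sigma> * ((x - y) - (\<theta> x * t x - \<theta> y * t y)) * \<xi> + (t x - t y) * \<xi> powr m) * of_real (exp (- ((\<nu> x + \<nu> y) * \<xi>\<^sup>2)))" for x y \<xi>
  proof -
    have "osc m \<sigma> (t x, \<theta> x, \<nu> x) x \<xi> * cnj (osc m \<sigma> (t y, \<theta> y, \<nu> y) y \<xi>) =
      (cis (\<sigma> * (x - \<theta> x * t x) * \<xi> + t x * \<xi> powr m) * cis (- (\<sigma> * (y - \<theta> y * t y) * \<xi> + t y * \<xi> powr m))) *
      of_real (exp (- (\<nu> x * \<xi>\<^sup>2)) * exp (- (\<nu> y * \<xi>\<^sup>2)))"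
      by (simp add: osc_def cis_cnj mult_ac)
    also have "exp (- (\<nu> x * \<xi>\<^sup>2)) * exp (- (\<nu> y * \<xi>\<^sup>2)) = exp (- ((\<nu> x + \<nu> y) * \<xi>\<^sup>2))"
      unfolding exp_add[symmetric] by (simp add: algebra_simps)
    also have "cis (\<sigma> * (x - \<theta> x * t x) * \<xi> + t x * \<xi> powr m) * cis (- (\<sigma> * (y - \<theta> y * t y) * \<xi> + t y * \<xi> powr m)) =
       cis (\<sigma> * ((x - y) - (\<theta> x * t x - \<theta> y * t y)) * \<xi> + (t x - t y) * \<xi> powr m)"
      unfolding cis_mult by (simp add: algebra_simps)
    finally show ?thesis .
  qed
  have kernel: "norm (LINT \<xi>|lborel. e (x, \<xi>) * (cnj (e (y, \<xi>)) * of_real (indicator (dyadic j) \<xi>))) \<le> k (x - y)"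
    if x: "x \<in> {0<..<1}" and y: "y \<in> {0<..<1}" for x y
  proof -
    define A where "A = \<sigma> * ((x - y) - (\<theta> x * t x - \<theta> y * t y))"
    define f where "f = (\<lambda>\<xi>. cis (A * \<xi> + (t x - t y) * \<xi> powr m) * of_real (exp (- ((\<nu> x + \<nu> y) * \<xi>\<^sup>2))))"
    have [measurable]: "f \<in> borel_measurable borel" unfolding f_def by measurable
    have f1: "norm (f \<xi>) \<le> 1" for \<xi> using \<nu>[of x] \<nu>[of y] by (simp add: f_def norm_mult)
    have K: "(LINT \<xi>|lborel. e (x, \<xi>) * (cnj (e (y, \<xi>)) * of_real (indicator (dyadic j) \<xi>))) = (LINT \<xi>:dyadic j|lborel. f \<xi>)"
      unfolding set_lebesgue_integral_def e_def f_def A_def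
    proof (intro Bochner_Integration.integral_cong refl)
      fix \<xi>
      show "(case (x, \<xi>) of (x, \<xi>) \<Rightarrow> osc m \<sigma> (t x, \<theta> x, \<nu> x) x \<xi>) *
          (cnj (case (y, \<xi>) of (x, \<xi>) \<Rightarrow> osc m \<sigma> (t x, \<theta> x, \<nu> x) x \<xi>) * complex_of_real (indicator (dyadic j) \<xi>)) =
        indicator (dyadic j) \<xi> *\<^sub>R (cis (\<sigma> * (x - y - (\<theta> x * t x - \<theta> y * t y)) * \<xi> + (t x - t y) * \<xi> powr m) *
          complex_of_real (exp (- ((\<nu> x + \<nu> y) * \<xi>\<^sup>2))))"
        unfolding prod.case mult.assoc[symmetric, of "osc m \<sigma> (t x, \<theta> x, \<nu> x) x \<xi>"] kernel_eq scaleR_conv_of_real by (rule mult.commute)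
    qed
    have "(norm (LINT \<xi>:dyadic j|lborel. f \<xi>))\<^sup>2 \<le> C * (R powr (2 - m) / (\<bar>x - y\<bar> + \<delta>))"
    \<comment> \<open>The lowest block has no oscillation to exploit, but there R = \<delta> = 1 and
      the trivial bound 1 lies below the claim because C >= 1152.\<close>
    proof (cases "j = 0")
      case True
      have d: "dyadic j = {0<..1}" using True by (simp add: dyadic_def)
      have "norm (LINT \<xi>:dyadic j|lborel. f \<xi>) \<le> (LINT \<xi>|lborel. norm (indicator (dyadic j) \<xi> *\<^sub>R f \<xi>))"
        unfolding set_lebesgue_integral_def by (rule integral_norm_bound)
      also have "\<dots> \<le> (LINT \<xi>|lborel. indicator {0<..1::real} \<xi>)"
      proof (rule integral_mono)
        show i: "integrable lborel (indicator {0<..1::real} :: real \<Rightarrow> real)" by (rule integrable_real_indicator) auto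
        show "norm (indicator (dyadic j) \<xi> *\<^sub>R f \<xi>) \<le> indicator {0<..1} \<xi>" for \<xi>
          unfolding d using f1[of \<xi>] by (auto simp: indicator_def)
        then show "integrable lborel (\<lambda>\<xi>. norm (indicator (dyadic j) \<xi> *\<^sub>R f \<xi>))"
          by (intro Bochner_Integration.integrable_bound[OF i]) auto
      qed
      also have "\<dots> = 1" by simp
      finally have "(norm (LINT \<xi>:dyadic j|lborel. f \<xi>))\<^sup>2 \<le> 1" by (simp add: power_le_one)
      also have "1 \<le> C * (1 / (\<bar>x - y\<bar> + 1))"
      proof -
        have "\<bar>x - y\<bar> + 1 \<le> C" using x y C by (auto simp: abs_if)
        then show ?thesis by (simp add: pos_le_divide_eq)
      qed
      also have "C * (1 / (\<bar>x - y\<bar> + 1)) = C * (R powr (2 - m) / (\<bar>x - y\<bar> + \<delta>))"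
        using True by (simp add: R_def \<delta>_def)
      finally show ?thesis .
    next
      case False
      then have R2: "R \<ge> 2" unfolding R_def using power_increasing[of 1 j "2::real"] by simp
      have d: "dyadic j = {R/2<..R}" using False unfolding dyadic_def R_def by (simp add: power_diff)
      have cf: "continuous_on {R/2..R} f"
        unfolding f_def using R2 by (intro continuous_intros) auto
      have "(LINT \<xi>:dyadic j|lborel. f \<xi>) = (LINT \<xi>:{R/2..R}|lborel. f \<xi>)"
        unfolding d set_lebesgue_integral_def
      proof (rule integral_cong_AE)
        have "AE \<xi> in lborel. \<xi> \<noteq> R/2" by (rule AE_lborel_singleton)
        then show "AE \<xi> in lborel. indicator {R/2<..R} \<xi> *\<^sub>R f \<xi> = indicator {R/2..R} \<xi> *\<^sub>R f \<xi>"
          by eventually_elim (auto simp: indicator_def)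
      qed auto
      also have "\<dots> = integral {R/2..R} f"
        by (rule set_borel_integral_eq_integral(2)[OF borel_integrable_compact[OF compact_Icc cf, folded set_integrable_def]])
      finally have eq: "(LINT \<xi>:dyadic j|lborel. f \<xi>) = integral {R/2..R} f" .
      have "\<bar>\<theta> x * t x - \<theta> y * t y\<bar> \<le> M * \<bar>t x - t y\<bar> + \<delta>"
      proof -
        have "\<theta> x * t x - \<theta> y * t y = \<theta> x * (t x - t y) + (\<theta> x - \<theta> y) * t y" by (simp add: algebra_simps)
        then have "\<bar>\<theta> x * t x - \<theta> y * t y\<bar> \<le> \<bar>\<theta> x\<bar> * \<bar>t x - t y\<bar> + \<bar>\<theta> x - \<theta> y\<bar> * \<bar>t y\<bar>"
          using abs_triangle_ineq[of "\<theta> x * (t x - t y)" "(\<theta> x - \<theta> y) * t y"] by (simp add: abs_mult)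
        also have "\<bar>\<theta> x - \<theta> y\<bar> \<le> \<delta>" using \<theta>(1)[of x] \<theta>(1)[of y] unfolding \<delta>_def R_def by (auto simp: abs_if)
        then have "\<bar>\<theta> x - \<theta> y\<bar> * \<bar>t y\<bar> \<le> \<delta> * 1" using t[of y] \<delta> by (intro mult_mono) auto
        also have "\<bar>\<theta> x\<bar> * \<bar>t x - t y\<bar> \<le> M * \<bar>t x - t y\<bar>" using \<theta>(2) by (intro mult_right_mono) auto
        finally show ?thesis by simp
      qed
      moreover have "\<bar>A\<bar> = \<bar>(x - y) - (\<theta> x * t x - \<theta> y * t y)\<bar>" unfolding A_def abs_mult \<sigma> by simp
      ultimately have sep: "\<bar>x - y\<bar> \<le> \<bar>A\<bar> + M * \<bar>t x - t y\<bar> + R powr (- m)" unfolding \<delta>_def by linarith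
      have "(norm (integral {R/2..R} f))\<^sup>2 \<le> C * (R powr (2 - m) / (\<bar>x - y\<bar> + \<delta>))"
        unfolding f_def C_def \<delta>_def
        by (rule dyadic_kernel_bound[OF m M R2 _ sep]) (use \<nu>[of x] \<nu>[of y] in auto)
      then show ?thesis unfolding eq .
    qed
    then show ?thesis unfolding K k_def by (rule real_le_rsqrt)
  qed
  have [measurable]: "k \<in> borel_measurable borel" unfolding k_def by measurable
  have "(\<integral>\<^sup>+z\<in>{-1<..<1}. ennreal (k z) ^ 2 \<partial>lborel) = (\<integral>\<^sup>+z. ennreal (C * R powr (2 - m)) * (ennreal (1 / (\<bar>z\<bar> + \<delta>)) * indicator {-1<..<1} z) \<partial>lborel)"
  proof (rule nn_integral_cong)
    fix z
    have "ennreal (k z) ^ 2 = ennreal ((k z)\<^sup>2)" by (rule ennreal_power) (use C \<delta> in \<open>simp add: k_def\<close>)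
    also have "(k z)\<^sup>2 = C * R powr (2 - m) * (1 / (\<bar>z\<bar> + \<delta>))" unfolding k_def using C \<delta> by simp
    also have "ennreal \<dots> = ennreal (C * R powr (2 - m)) * ennreal (1 / (\<bar>z\<bar> + \<delta>))"
      by (rule ennreal_mult) (use C \<delta> in auto)
    finally show "ennreal (k z) ^ 2 * indicator {-1<..<1} z = ennreal (C * R powr (2 - m)) * (ennreal (1 / (\<bar>z\<bar> + \<delta>)) * indicator {-1<..<1} z)"
      by (simp only: mult.assoc)
  qed
  also have "\<dots> = ennreal (C * R powr (2 - m)) * (\<integral>\<^sup>+z\<in>{-1<..<1}. ennreal (1 / (\<bar>z\<bar> + \<delta>)) \<partial>lborel)"
    by (rule nn_integral_cmult) measurable
  also have "\<dots> \<le> ennreal (C * R powr (2 - m)) * ennreal (2 * ln ((1 + \<delta>) / \<delta>))"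
    by (intro mult_left_mono inverse_abs_integral \<delta>) auto
  also have "\<dots> = ennreal (C * R powr (2 - m) * (2 * ln ((1 + \<delta>) / \<delta>)))"
    using C \<delta> by (intro ennreal_mult[symmetric]) auto
  also have "(1 + \<delta>) / \<delta> = 1 + R powr m" using R by (simp add: \<delta>_def powr_minus field_simps)
  also have "C * R powr (2 - m) * (2 * ln (1 + R powr m)) = dyadic_const m M j"
    by (simp add: dyadic_const_def C_def R_def)
  finally have kB: "(\<integral>\<^sup>+z\<in>{-1<..<1}. ennreal (k z) ^ 2 \<partial>lborel) \<le> ennreal (dyadic_const m M j)" .
  have e_meas: "e \<in> borel_measurable (lborel \<Otimes>\<^sub>M lborel)"
    unfolding e_def osc_def by simp
  have e1: "norm (e z) \<le> 1" for z unfolding e_def by (cases z) (simp add: norm_osc \<nu>)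
  have "(\<integral>\<^sup>+x\<in>{0<..<1}. ennreal (norm (LINT \<xi>|lborel. e (x, \<xi>) * G \<xi>)) ^ 4 \<partial>lborel) \<le> ennreal (dyadic_const m M j) * (l2sq G)\<^sup>2"
    by (rule TT_star_L2_L4[OF e_meas e1 dyadic_sets dyadic_emeasure G _ kernel kB]) auto
  then show ?thesis unfolding osc_int_def e_def by (simp add: ennreal_power)
qed

section \<open>From measurable selections to the supremum over all parameters\<close>

lemma osc_int_measurable [measurable]:
  assumes [measurable]: "G \<in> borel_measurable borel"
  shows "osc_int m \<sigma> G p \<in> borel_measurable borel"
  unfolding osc_int_def osc_def by (cases p) simp

text \<open>Continuity in time, direction and width, including width parameter 0; integrability of
  the block provides the dominating function.\<close>

lemma osc_int_tendsto:
  assumes G: "integrable lborel G" and p: "\<And>n. snd (snd (q n)) \<ge> 0" and q: "q \<longlonglongrightarrow> p"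
  shows "(\<lambda>n. osc_int m \<sigma> G (q n) x) \<longlonglongrightarrow> osc_int m \<sigma> G p x"
  unfolding osc_int_def
proof (rule integral_dominated_convergence)
  have [measurable]: "G \<in> borel_measurable borel" using G by auto
  show "(\<lambda>\<xi>. osc m \<sigma> p x \<xi> * G \<xi>) \<in> borel_measurable lborel"
    unfolding osc_def by (cases p) simp
  show "(\<lambda>\<xi>. osc m \<sigma> (q n) x \<xi> * G \<xi>) \<in> borel_measurable lborel" for n
    unfolding osc_def by (cases "q n") simp
  show "integrable lborel (\<lambda>\<xi>. norm (G \<xi>))" using G by auto
  show "AE \<xi> in lborel. norm (osc m \<sigma> (q n) x \<xi> * G \<xi>) \<le> norm (G \<xi>)" for n
    using p[of n] norm_osc[of "snd (snd (q n))" m \<sigma> "fst (q n)" "fst (snd (q n))" x]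
    by (auto simp: norm_mult intro!: mult_left_le_one_le)
  show "AE \<xi> in lborel. (\<lambda>n. osc m \<sigma> (q n) x \<xi> * G \<xi>) \<longlonglongrightarrow> osc m \<sigma> p x \<xi> * G \<xi>"
    using tendsto_fst[OF q] tendsto_fst[OF tendsto_snd[OF q]] tendsto_snd[OF tendsto_snd[OF q]]
    unfolding osc_def case_prod_beta by (auto intro!: AE_I2 tendsto_intros tendsto_cis)
qed

text \<open>By continuity a countable dense set of parameters already gives the supremum
  \<open>Q\<close>, which is therefore measurable even though \<open>\<Theta>\<close> is arbitrary.
  For finitely many parameters the supremum is one linearised operator; the bound is uniform, so
  monotone convergence concludes.\<close>

theorem dyadic_maximal_bound:
  fixes m M c \<sigma> :: real and j :: nat and \<Theta> :: "real set" and G :: "real \<Rightarrow> complex"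
  assumes m: "0 < m" "m < 1" and M: "M \<ge> 1" and \<sigma>: "\<bar>\<sigma>\<bar> = 1"
    and \<Theta>: "\<Theta> \<subseteq> {c..c + (2 ^ j) powr (- m)}" "\<And>\<theta>. \<theta> \<in> \<Theta> \<Longrightarrow> \<bar>\<theta>\<bar> \<le> M"
    and G: "integrable lborel G" "\<And>\<xi>. \<xi> \<notin> dyadic j \<Longrightarrow> G \<xi> = 0"
  obtains Q where "Q \<in> borel_measurable borel"
    "\<And>x p. p \<in> {0<..<1} \<times> \<Theta> \<times> {0..} \<Longrightarrow> ennreal (norm (osc_int m \<sigma> G p x) ^ 4) \<le> Q x"
    "(\<integral>\<^sup>+x\<in>{0<..<1}. Q x \<partial>lborel) \<le> ennreal (dyadic_const m M j) * (l2sq G)\<^sup>2"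
proof (cases "\<Theta> = {}")
  case True
  then show thesis by (intro that[of "\<lambda>_. 0"]) auto
next
  case False
  define P where "P = {0<..<1::real} \<times> \<Theta> \<times> {0::real..}"
  have [measurable]: "G \<in> borel_measurable borel" using G by auto
  obtain D where D: "countable D" "D \<subseteq> P" "P \<subseteq> closure D" using separable[of P] by metis
  have "P \<noteq> {}" using False by (auto simp: P_def intro!: exI[of _ "1/2"])
  then have "D \<noteq> {}" using D(3) by auto
  define d where "d = from_nat_into D"
  have d: "d i \<in> D" for i unfolding d_def using from_nat_into[OF \<open>D \<noteq> {}\<close>] .
  have dP: "d i \<in> P" for i using d D(2) by auto
  have ran: "range d = D" unfolding d_def by (rule range_from_nat_into[OF \<open>D \<noteq> {}\<close> D(1)])
  define N where "N = (\<lambda>i x. norm (osc_int m \<sigma> G (d i) x))"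
  have [measurable]: "N i \<in> borel_measurable borel" for i unfolding N_def by measurable
  define Q where "Q = (\<lambda>x. SUP i. ennreal (N i x ^ 4))"
  have Qm: "Q \<in> borel_measurable borel" unfolding Q_def by measurable
  have Q_ge: "ennreal (norm (osc_int m \<sigma> G p x) ^ 4) \<le> Q x" if "p \<in> P" for p x
  proof -
    have "p \<in> closure D" using that D(3) by auto
    then obtain q where q: "\<And>n. q n \<in> D" "q \<longlonglongrightarrow> p"
      unfolding closure_sequential by blast
    have "snd (snd (q n)) \<ge> 0" for n using q(1)[of n] D(2) by (auto simp: P_def)
    then have "(\<lambda>n. osc_int m \<sigma> G (q n) x) \<longlonglongrightarrow> osc_int m \<sigma> G p x"
      by (intro osc_int_tendsto G q(2))
    then have lim: "(\<lambda>n. ennreal (norm (osc_int m \<sigma> G (q n) x) ^ 4)) \<longlonglongrightarrow> ennreal (norm (osc_int m \<sigma> G p x) ^ 4)"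
      by (intro tendsto_ennrealI tendsto_power tendsto_norm)
    have le: "ennreal (norm (osc_int m \<sigma> G (q n) x) ^ 4) \<le> Q x" for n
    proof -
      obtain i where "q n = d i" using q(1)[of n] ran by (metis imageE)
      then show ?thesis unfolding Q_def N_def by (intro SUP_upper2[of i]) auto
    qed
    show ?thesis by (rule LIMSEQ_le_const2[OF lim]) (auto intro: le)
  qed
  define S where "S = (\<lambda>n x. SUP i\<in>{..n}. ennreal (N i x ^ 4))"
  have [measurable]: "S n \<in> borel_measurable borel" for n unfolding S_def by measurable
  have S_int: "(\<integral>\<^sup>+x\<in>{0<..<1}. S n x \<partial>lborel) \<le> ennreal (dyadic_const m M j) * (l2sq G)\<^sup>2" for n
  proof -
    \<comment> \<open>Taking the least maximising index makes the selection measurable and the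
      maximum attained.\<close>
    define \<pi> where "\<pi> = (\<lambda>x. LEAST i. i \<le> n \<and> (\<forall>l\<in>{..n}. N l x \<le> N i x))"
    have ex: "\<exists>i. i \<le> n \<and> (\<forall>l\<in>{..n}. N l x \<le> N i x)" for x
    proof -
      have "Max ((\<lambda>i. N i x) ` {..n}) \<in> (\<lambda>i. N i x) ` {..n}" by (intro Max_in) auto
      then obtain i where i: "Max ((\<lambda>i. N i x) ` {..n}) = N i x" "i \<in> {..n}" by (rule imageE)
      have "N l x \<le> N i x" if "l \<in> {..n}" for l
        unfolding i(1)[symmetric] using that by (intro Max_ge) auto
      then show ?thesis using i(2) by auto
    qed
    have \<pi>: "\<pi> x \<le> n" "\<And>l. l \<le> n \<Longrightarrow> N l x \<le> N (\<pi> x) x" for x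
      using LeastI_ex[OF ex[of x]] unfolding \<pi>_def by auto
    have [measurable]: "\<pi> \<in> measurable borel (count_space UNIV)"
      unfolding \<pi>_def by measurable
    have meas: "(\<lambda>x. g (d (\<pi> x))) \<in> borel_measurable borel" for g :: "_ \<Rightarrow> real"
      by (rule measurable_compose[of \<pi> borel "count_space UNIV"]) auto
    have S_eq: "S n x \<le> ennreal (norm (osc_int m \<sigma> G (fst (d (\<pi> x)), fst (snd (d (\<pi> x))), snd (snd (d (\<pi> x)))) x) ^ 4)" for x
    proof -
      have "N l x ^ 4 \<le> N (\<pi> x) x ^ 4" if "l \<le> n" for l
        using \<pi>(2)[OF that, of x] by (intro power_mono) (auto simp: N_def)
      then have "S n x \<le> ennreal (N (\<pi> x) x ^ 4)"
        unfolding S_def by (intro SUP_least ennreal_leI) auto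
      then show ?thesis by (simp add: N_def)
    qed
    have "(\<integral>\<^sup>+x\<in>{0<..<1}. S n x \<partial>lborel) \<le>
       (\<integral>\<^sup>+x\<in>{0<..<1}. ennreal (norm (osc_int m \<sigma> G (fst (d (\<pi> x)), fst (snd (d (\<pi> x))), snd (snd (d (\<pi> x)))) x) ^ 4) \<partial>lborel)"
      by (intro nn_integral_mono mult_right_mono S_eq) auto
    also have "\<dots> \<le> ennreal (dyadic_const m M j) * (l2sq G)\<^sup>2"
    proof (rule linearised_dyadic_bound[OF m M \<sigma> _ _ _ _ _ _ _ G])
      show "(\<lambda>x. fst (d (\<pi> x))) \<in> borel_measurable borel" by (rule meas)
      show "(\<lambda>x. fst (snd (d (\<pi> x)))) \<in> borel_measurable borel" by (rule meas[of "\<lambda>p. fst (snd p)"])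
      show "(\<lambda>x. snd (snd (d (\<pi> x)))) \<in> borel_measurable borel" by (rule meas[of "\<lambda>p. snd (snd p)"])
      fix x
      have "d (\<pi> x) \<in> P" by (rule dP)
      then show "fst (d (\<pi> x)) \<in> {0<..<1}" "fst (snd (d (\<pi> x))) \<in> {c..c + (2 ^ j) powr (- m)}"
        "\<bar>fst (snd (d (\<pi> x)))\<bar> \<le> M" "snd (snd (d (\<pi> x))) \<ge> 0"
        using \<Theta> by (auto simp: P_def)
    qed
    finally show ?thesis .
  qed
  have "(\<integral>\<^sup>+x\<in>{0<..<1}. Q x \<partial>lborel) = (\<integral>\<^sup>+x. (SUP n. S n x * indicator {0<..<1} x) \<partial>lborel)"
  proof (rule nn_integral_cong)
    fix x :: real
    have "Q x = (SUP n. S n x)"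
    proof (rule antisym)
      show "Q x \<le> (SUP n. S n x)"
        unfolding Q_def
      proof (rule SUP_least)
        fix i
        have "ennreal (N i x ^ 4) \<le> S i x" unfolding S_def by (rule SUP_upper) auto
        then show "ennreal (N i x ^ 4) \<le> (SUP n. S n x)" by (rule SUP_upper2[OF UNIV_I])
      qed
      show "(SUP n. S n x) \<le> Q x"
        unfolding Q_def S_def by (intro SUP_least SUP_upper) auto
    qed
    then show "Q x * indicator {0<..<1} x = (SUP n. S n x * indicator {0<..<1} x)"
      by (auto simp: indicator_def)
  qed
  also have "\<dots> = (SUP n. \<integral>\<^sup>+x\<in>{0<..<1}. S n x \<partial>lborel)"
  proof (rule nn_integral_monotone_convergence_SUP)
    show "incseq (\<lambda>n x. S n x * indicator {0<..<1} x)"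
      unfolding incseq_def le_fun_def S_def by (auto intro!: mult_right_mono SUP_subset_mono)
  qed measurable
  also have "\<dots> \<le> ennreal (dyadic_const m M j) * (l2sq G)\<^sup>2"
    by (intro SUP_least S_int)
  finally show thesis using that[OF Qm] Q_ge unfolding P_def by blast
qed

subsection \<open>Summing the dyadic pieces\<close>

text \<open>The upper dimension controls only small scales, that is, large \<open>j\<close>. The
  finitely many remaining covering numbers are absorbed into \<open>K\<close>.\<close>

lemma covering_number_growth:
  fixes m \<beta> \<epsilon> :: real
  assumes dim: "upper_minkowski_dim \<Theta> = ereal \<beta>" and "\<beta> \<ge> 0" "\<epsilon> > 0" "m > 0"
  obtains K where "K \<ge> 0" "\<And>j::nat. real (covering_number \<Theta> ((2 ^ j) powr (- m))) \<le> K * (2 ^ j) powr (m * (\<beta> + \<epsilon>))"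
proof -
  define \<delta> where "\<delta> = (\<lambda>j::nat. (2 ^ j :: real) powr (- m))"
  define n where "n = (\<lambda>j. real (covering_number \<Theta> (\<delta> j)))"
  have "Limsup (at_right 0) (\<lambda>\<delta>. ereal (ln (real (covering_number \<Theta> \<delta>)) / ln (1 / \<delta>))) < ereal (\<beta> + \<epsilon>)"
    using dim \<open>\<epsilon> > 0\<close> unfolding upper_minkowski_dim_def by simp
  from Limsup_lessD[OF this]
  have ev: "\<forall>\<^sub>F \<delta> in at_right 0. ln (real (covering_number \<Theta> \<delta>)) / ln (1 / \<delta>) < \<beta> + \<epsilon>" by simp
  have "filterlim \<delta> (at_right 0) sequentially"
    unfolding \<delta>_def using \<open>m > 0\<close> by real_asymp
  from eventually_compose_filterlim[OF ev this]
  have "\<forall>\<^sub>F j in sequentially. ln (n j) / ln (1 / \<delta> j) < \<beta> + \<epsilon>" by (simp add: n_def)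
  then obtain J where J: "\<And>j. j \<ge> J \<Longrightarrow> ln (n j) / ln (1 / \<delta> j) < \<beta> + \<epsilon>"
    unfolding eventually_sequentially by blast
  define K where "K = 1 + (\<Sum>j\<le>J. n j)"
  have n0: "n j \<ge> 0" for j by (simp add: n_def)
  have K1: "K \<ge> 1" unfolding K_def using n0 by (simp add: sum_nonneg)
  have p1: "1 \<le> (2 ^ j :: real) powr (m * (\<beta> + \<epsilon>))" for j
    using assms by (intro ge_one_powr_ge_zero) auto
  have "n j \<le> K * (2 ^ j) powr (m * (\<beta> + \<epsilon>))" for j
  proof (cases "j \<le> J")
    case True
    have "n j \<le> (\<Sum>j\<le>J. n j)" using True n0 by (intro member_le_sum) auto
    also have "\<dots> \<le> K * 1" by (simp add: K_def)
    also have "\<dots> \<le> K * (2 ^ j) powr (m * (\<beta> + \<epsilon>))" using K1 p1 by (intro mult_left_mono) auto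
    finally show ?thesis .
  next
    case False
    have "1 / \<delta> j = (2 ^ j) powr m" by (simp add: \<delta>_def powr_minus field_simps)
    then have l: "ln (1 / \<delta> j) = m * ln (2 ^ j)" by (simp add: ln_powr)
    have lpos: "m * ln (2 ^ j :: real) > 0" using False \<open>m > 0\<close> by simp
    have "ln (n j) \<le> (\<beta> + \<epsilon>) * (m * ln (2 ^ j))"
      using J[of j] False lpos unfolding l by (simp add: pos_divide_less_eq)
    then have "ln (n j) \<le> ln ((2 ^ j) powr (m * (\<beta> + \<epsilon>)))" by (simp add: ln_powr mult_ac)
    then have "n j \<le> (2 ^ j) powr (m * (\<beta> + \<epsilon>))"
    \<comment> \<open>Since \<open>ln 0\<close> is 0, comparing logarithms says nothing when the
      covering number vanishes.\<close>
    proof (cases "n j = 0")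
      case False
      then have "0 < n j" using n0[of j] by simp
      then show ?thesis using \<open>ln (n j) \<le> ln ((2 ^ j) powr (m * (\<beta> + \<epsilon>)))\<close>
        by (subst (asm) ln_le_cancel_iff) auto
    qed simp
    also have "\<dots> \<le> K * (2 ^ j) powr (m * (\<beta> + \<epsilon>))" using K1 by (simp add: mult_le_cancel_right1)
    finally show ?thesis .
  qed
  then show thesis using that[of K] K1 unfolding n_def \<delta>_def by auto
qed

text \<open>The logarithm from the kernel is exchanged for an arbitrarily small power through ln y
  <= y^\<eta> / \<eta>.\<close>

lemma dyadic_const_growth:
  assumes m: "0 < m" "m < 1" and M: "M \<ge> 1" and \<eta>: "\<eta> > 0"
  shows "dyadic_const m M j \<le> 2 * (1152 * M / (m * (1 - m))) * (2 powr \<eta> / \<eta>) * (2 ^ j) powr (2 - m + \<eta>)"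
proof -
  define R :: real where "R = 2 ^ j"
  have R: "R \<ge> 1" by (simp add: R_def)
  have "R powr m \<le> R powr 1" using R m by (intro powr_mono) auto
  then have "1 + R powr m \<le> 2 * R" using R by simp
  moreover have "R powr m \<ge> 0" by simp
  ultimately have "(1 + R powr m) powr \<eta> \<le> (2 * R) powr \<eta>" using \<eta> by (intro powr_mono2) auto
  moreover have "ln (1 + R powr m) \<le> (1 + R powr m) powr \<eta> / \<eta>" using \<eta> by (intro ln_powr_bound) auto
  ultimately have "ln (1 + R powr m) \<le> (2 * R) powr \<eta> / \<eta>"
    using \<eta> by (meson divide_right_mono less_imp_le order_trans)
  also have "\<dots> = 2 powr \<eta> / \<eta> * R powr \<eta>" using R by (simp add: powr_mult)
  finally have l: "ln (1 + R powr m) \<le> 2 powr \<eta> / \<eta> * R powr \<eta>" .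
  have c: "0 \<le> 2 * (1152 * M / (m * (1 - m))) * R powr (2 - m)" using m M by simp
  have "dyadic_const m M j = 2 * (1152 * M / (m * (1 - m))) * R powr (2 - m) * ln (1 + R powr m)"
    by (simp add: dyadic_const_def R_def)
  also have "\<dots> \<le> 2 * (1152 * M / (m * (1 - m))) * R powr (2 - m) * (2 powr \<eta> / \<eta> * R powr \<eta>)"
    by (rule mult_left_mono[OF l c])
  also have "\<dots> = 2 * (1152 * M / (m * (1 - m))) * (2 powr \<eta> / \<eta>) * R powr (2 - m + \<eta>)"
    by (simp only: powr_add mult_ac)
  finally show ?thesis unfolding R_def .
qed

text \<open>A block with j >= 1 starts at R/2, so 1 + \<xi>^2 >= R^2/4, and the constant 4^s
  results; for \<open>j = 0\<close> this is trivial. The form 1 <= ... allows multiplication by the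
  data.\<close>

lemma dyadic_weight_lower:
  assumes "s \<ge> 0" "\<xi> \<in> dyadic j"
  shows "1 \<le> 4 powr s * (2 ^ j) powr (- (2 * s)) * bessel_weight s \<xi>"
proof -
  define R :: real where "R = 2 ^ j"
  have R: "R > 0" by (simp add: R_def)
  have "R\<^sup>2 / 4 \<le> 1 + \<xi>\<^sup>2"
  proof (cases "j = 0")
    case True
    then show ?thesis by (simp add: R_def add_increasing2)
  next
    case False
    then have "R / 2 \<le> \<xi>" using assms(2) by (auto simp: dyadic_def R_def power_diff)
    then have "(R / 2)\<^sup>2 \<le> \<xi>\<^sup>2" using R by (intro power_mono) auto
    then show ?thesis by (simp add: power_divide)
  qed
  then have "(R\<^sup>2 / 4) powr s \<le> bessel_weight s \<xi>" using assms(1) by (intro powr_mono2) auto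
  moreover have "(R\<^sup>2 / 4) powr s = R powr (2 * s) / 4 powr s"
    using R powr_powr[of R 2 s] by (simp add: powr_divide)
  ultimately have "R powr (2 * s) \<le> 4 powr s * bessel_weight s \<xi>" by (simp add: field_simps)
  then have "R powr (- (2 * s)) * R powr (2 * s) \<le> R powr (- (2 * s)) * (4 powr s * bessel_weight s \<xi>)"
    by (intro mult_left_mono) auto
  moreover have "R powr (- (2 * s)) * R powr (2 * s) = 1" using R by (simp flip: powr_add)
  ultimately have "1 \<le> R powr (- (2 * s)) * (4 powr s * bessel_weight s \<xi>)" by (simp only:)
  then show ?thesis unfolding R_def by (simp only: mult_ac)
qed

text \<open>The piece of \<open>g\<close> on the block with sign \<open>\<sigma>\<close>,
  transported to positive frequencies to match \<open>osc\<close>.\<close>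

definition freq_piece :: "(real \<Rightarrow> complex) \<Rightarrow> nat \<Rightarrow> real \<Rightarrow> real \<Rightarrow> complex" where
  "freq_piece g j \<sigma> \<xi> = of_real (indicator (dyadic j) \<xi>) * g (\<sigma> * \<xi>)"

lemma freq_piece_measurable [measurable]:
  assumes [measurable]: "g \<in> borel_measurable borel"
  shows "freq_piece g j \<sigma> \<in> borel_measurable borel"
  unfolding freq_piece_def by measurable

lemma freq_piece_l2:
  assumes [measurable]: "g \<in> borel_measurable borel" and s: "s \<ge> 0" and \<sigma>: "\<bar>\<sigma>\<bar> = 1"
  shows "l2sq (freq_piece g j \<sigma>) \<le>
     ennreal (4 powr s * (2 ^ j) powr (- (2 * s))) * (\<integral>\<^sup>+\<xi>. ennreal (bessel_weight s \<xi> * (norm (g \<xi>))\<^sup>2) \<partial>lborel)"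
proof -
  have \<sigma>2: "\<sigma>\<^sup>2 = 1" "\<sigma> \<noteq> 0" using \<sigma> by (auto simp: power2_eq_1_iff abs_if split: if_splits)
  have "l2sq (freq_piece g j \<sigma>) \<le> (\<integral>\<^sup>+\<xi>. ennreal (4 powr s * (2 ^ j) powr (- (2 * s))) * ennreal (bessel_weight s (\<sigma> * \<xi>) * (norm (g (\<sigma> * \<xi>)))\<^sup>2) \<partial>lborel)"
  proof (rule nn_integral_mono)
    fix \<xi>
    have w: "bessel_weight s (\<sigma> * \<xi>) = bessel_weight s \<xi>" by (simp add: power_mult_distrib \<sigma>2)
    have "(norm (freq_piece g j \<sigma> \<xi>))\<^sup>2 \<le> 4 powr s * (2 ^ j) powr (- (2 * s)) * (bessel_weight s \<xi> * (norm (g (\<sigma> * \<xi>)))\<^sup>2)"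
    proof (cases "\<xi> \<in> dyadic j")
      case True
      then show ?thesis using mult_right_mono[OF dyadic_weight_lower[OF s True], of "(norm (g (\<sigma> * \<xi>)))\<^sup>2"]
        by (simp add: freq_piece_def mult.assoc)
    qed (simp add: freq_piece_def)
    then show "ennreal ((norm (freq_piece g j \<sigma> \<xi>))\<^sup>2) \<le> ennreal (4 powr s * (2 ^ j) powr (- (2 * s))) * ennreal (bessel_weight s (\<sigma> * \<xi>) * (norm (g (\<sigma> * \<xi>)))\<^sup>2)"
      unfolding w by (subst ennreal_mult[symmetric]) (auto intro: ennreal_leI)
  qed
  also have "\<dots> = ennreal (4 powr s * (2 ^ j) powr (- (2 * s))) * (\<integral>\<^sup>+\<xi>. ennreal (bessel_weight s (\<sigma> * \<xi>) * (norm (g (\<sigma> * \<xi>)))\<^sup>2) \<partial>lborel)"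
    by (rule nn_integral_cmult) measurable
  also have "(\<integral>\<^sup>+\<xi>. ennreal (bessel_weight s (\<sigma> * \<xi>) * (norm (g (\<sigma> * \<xi>)))\<^sup>2) \<partial>lborel) = (\<integral>\<^sup>+\<xi>. ennreal (bessel_weight s \<xi> * (norm (g \<xi>))\<^sup>2) \<partial>lborel)"
    using nn_integral_real_affine[of "\<lambda>\<xi>. ennreal (bessel_weight s \<xi> * (norm (g \<xi>))\<^sup>2)" \<sigma> 0] \<sigma>2(2) \<sigma> by simp
  finally show ?thesis .
qed

lemma freq_piece_integrable:
  assumes [measurable]: "g \<in> borel_measurable borel" and fin: "l2sq (freq_piece g j \<sigma>) < \<infinity>"
  shows "integrable lborel (freq_piece g j \<sigma>)"
proof -
  have "l2sq (\<lambda>\<xi>. of_real (indicator (dyadic j) \<xi>) :: complex) = (\<integral>\<^sup>+\<xi>. indicator (dyadic j) \<xi> \<partial>lborel)"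
    by (intro nn_integral_cong) (auto simp: indicator_def)
  also have "\<dots> < \<infinity>" using dyadic_emeasure[of j] by simp
  finally have "integrable lborel (\<lambda>\<xi>. of_real (indicator (dyadic j) \<xi>) * freq_piece g j \<sigma> \<xi>)"
    by (intro l2_mult_integrable fin) auto
  moreover have "(\<lambda>\<xi>. of_real (indicator (dyadic j) \<xi>) * freq_piece g j \<sigma> \<xi>) = freq_piece g j \<sigma>"
    by (auto simp: freq_piece_def indicator_def)
  ultimately show ?thesis by simp
qed

text \<open>The first blocks tile (0, 2^J] exactly, so every partial integral is a finite sum below
  the geometric series; dominated convergence then passes to the half-line.\<close>

lemma half_line_dyadic_bound:
  fixes h :: "real \<Rightarrow> complex"
  assumes h: "integrable lborel h" and c: "0 \<le> c" "c < 1" and b: "b \<ge> 0"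
    and le: "\<And>j. norm (LINT \<xi>:dyadic j|lborel. h \<xi>) \<le> b * c ^ j"
  shows "norm (LINT \<xi>:{0<..}|lborel. h \<xi>) \<le> b / (1 - c)"
proof -
  have [measurable]: "h \<in> borel_measurable borel" using h by auto
  have si: "set_integrable lborel A h" if "A \<in> sets borel" for A
    using integrable_mult_indicator[of A lborel h] that h by (simp add: set_integrable_def)
  have eq: "(LINT \<xi>:{0<..2 ^ J}|lborel. h \<xi>) = (\<Sum>j\<le>J. LINT \<xi>:dyadic j|lborel. h \<xi>)" for J :: nat
  proof (induction J)
    case 0
    then show ?case by (simp add: dyadic_def)
  next
    case (Suc J)
    have u: "{0<..2 ^ Suc J} = {0<..2 ^ J} \<union> dyadic (Suc J)"
      by (auto simp: dyadic_def intro: less_trans[of 0 "2 ^ J :: real"] order_trans[of _ "2 ^ J :: real"])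
    have "(LINT \<xi>:{0<..2 ^ Suc J}|lborel. h \<xi>) = (LINT \<xi>:{0<..2 ^ J}|lborel. h \<xi>) + (LINT \<xi>:dyadic (Suc J)|lborel. h \<xi>)"
      unfolding u by (rule set_integral_Un) (auto simp: dyadic_def intro!: si)
    then show ?case using Suc by simp
  qed
  have fin: "norm (LINT \<xi>:{0<..2 ^ J}|lborel. h \<xi>) \<le> b / (1 - c)" for J :: nat
  proof -
    have "norm (LINT \<xi>:{0<..2 ^ J}|lborel. h \<xi>) \<le> (\<Sum>j\<le>J. b * c ^ j)"
      unfolding eq by (rule sum_norm_le) (rule le)
    also have "\<dots> \<le> (\<Sum>j. b * c ^ j)"
      using c b by (intro sum_le_suminf summable_mult summable_geometric) auto
    also have "\<dots> = b * (\<Sum>j. c ^ j)" using c by (intro suminf_mult summable_geometric) auto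
    also have "\<dots> = b / (1 - c)" using c by (simp add: suminf_geometric)
    finally show ?thesis .
  qed
  have "(\<lambda>J::nat. LINT \<xi>:{0<..2 ^ J}|lborel. h \<xi>) \<longlonglongrightarrow> (LINT \<xi>:{0<..}|lborel. h \<xi>)"
    unfolding set_lebesgue_integral_def
  proof (rule integral_dominated_convergence)
    show "integrable lborel (\<lambda>\<xi>. norm (h \<xi>))" using h by auto
    show "AE \<xi> in lborel. (\<lambda>J::nat. indicator {0<..2 ^ J} \<xi> *\<^sub>R h \<xi>) \<longlonglongrightarrow> indicator {0<..} \<xi> *\<^sub>R h \<xi>"
    proof (rule AE_I2)
      fix \<xi> :: real
      obtain n :: nat where n: "\<xi> < 2 ^ n" using real_arch_pow[of 2 \<xi>] by auto
      have "\<forall>\<^sub>F J in sequentially. indicator {0<..2 ^ J} \<xi> *\<^sub>R h \<xi> = indicator {0<..} \<xi> *\<^sub>R h \<xi>"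
        using eventually_ge_at_top[of n]
      proof eventually_elim
        case (elim J)
        have "(2::real) ^ n \<le> 2 ^ J" using elim by (intro power_increasing) auto
        then have "\<xi> \<le> 2 ^ J" using n by linarith
        then show ?case by (auto simp: indicator_def)
      qed
      then show "(\<lambda>J::nat. indicator {0<..2 ^ J} \<xi> *\<^sub>R h \<xi>) \<longlonglongrightarrow> indicator {0<..} \<xi> *\<^sub>R h \<xi>"
        by (rule tendsto_eventually)
    qed
    show "AE \<xi> in lborel. norm (indicator {0<..2 ^ J} \<xi> *\<^sub>R h \<xi>) \<le> norm (h \<xi>)" for J :: nat
      by (auto simp: indicator_def)
  qed auto
  from tendsto_norm[OF this] show ?thesis by (rule LIMSEQ_le_const2) (auto intro: fin)
qed

lemma integral_split_sign:
  fixes h :: "real \<Rightarrow> complex"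
  assumes h: "integrable lborel h"
  shows "(LINT \<xi>|lborel. h \<xi>) = (LINT \<xi>:{0<..}|lborel. h \<xi>) + (LINT \<xi>:{0<..}|lborel. h (- \<xi>))"
proof -
  have [measurable]: "h \<in> borel_measurable borel" using h by auto
  have si: "set_integrable lborel A h" if "A \<in> sets borel" for A
    using integrable_mult_indicator[of A lborel h] that h by (simp add: set_integrable_def)
  have "(LINT \<xi>|lborel. h \<xi>) = (LINT \<xi>:{0<..} \<union> {..<0}|lborel. h \<xi>)"
    unfolding set_lebesgue_integral_def
  proof (rule integral_cong_AE)
    have "AE \<xi> in lborel. \<xi> \<noteq> (0::real)" by (rule AE_lborel_singleton)
    then show "AE \<xi> in lborel. h \<xi> = indicator ({0<..} \<union> {..<0}) \<xi> *\<^sub>R h \<xi>"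
      by eventually_elim (auto simp: indicator_def)
  qed auto
  also have "\<dots> = (LINT \<xi>:{0<..}|lborel. h \<xi>) + (LINT \<xi>:{..<0}|lborel. h \<xi>)"
    by (rule set_integral_Un) (auto intro!: si)
  also have "(LINT \<xi>:{..<0}|lborel. h \<xi>) = (LINT \<xi>:{0<..}|lborel. h (- \<xi>))"
    unfolding set_lebesgue_integral_def
    by (subst lborel_integral_real_affine[where c = "-1" and t = 0]) (auto simp: indicator_def intro!: Bochner_Integration.integral_cong)
  finally show ?thesis .
qed

text \<open>The product of a Gaussian with square integrable data is integrable, so the regularised
  evolution integrals converge absolutely.\<close>

lemma gaussian_l2: "\<nu> > 0 \<Longrightarrow> l2sq (\<lambda>\<xi>. of_real (exp (- (\<nu> * \<xi>\<^sup>2)))) < \<infinity>"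
proof -
  assume \<nu>: "\<nu> > 0"
  have eq: "(norm (complex_of_real (exp (- (\<nu> * \<xi>\<^sup>2)))))\<^sup>2 = gauss (1 / sqrt (4 * \<nu>)) \<xi>" for \<xi>
    using \<nu> by (simp add: gauss_def power_mult_distrib flip: exp_double)
  have "integrable lborel (gauss (1 / sqrt (4 * \<nu>)))" by (rule integrable_gauss) (use \<nu> in simp)
  then show ?thesis unfolding eq by (simp add: integrable_iff_bounded)
qed

text \<open>Pointwise domination: if $Z$ controls $c^{-4j}$ times the fourth power of every dyadic
  piece, then each piece is at most $Z^{1/4} c^j$ and the geometric series can be summed.\<close>

lemma evolution_reg_bound:
  fixes g :: "real \<Rightarrow> complex"
  assumes [measurable]: "g \<in> borel_measurable borel" and g: "l2sq g < \<infinity>" and \<nu>: "\<nu> > 0"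
    and c: "0 < c" "c < 1" and z: "z \<ge> 0"
    and le: "\<And>j \<sigma>. \<sigma> \<in> {1, -1} \<Longrightarrow> norm (osc_int m \<sigma> (freq_piece g j \<sigma>) (t, \<theta>, \<nu>) x) ^ 4 \<le> z * c ^ (4 * j)"
  shows "norm (LINT \<xi>|lborel. cis ((x - \<theta> * t) * \<xi> + t * \<bar>\<xi>\<bar> powr m) * of_real (exp (- (\<nu> * \<xi>\<^sup>2))) * g \<xi>)
     \<le> 2 * z powr (1/4) / (1 - c)"
proof -
  define h where "h = (\<lambda>\<xi>. cis ((x - \<theta> * t) * \<xi> + t * \<bar>\<xi>\<bar> powr m) * of_real (exp (- (\<nu> * \<xi>\<^sup>2))) * g \<xi>)"
  have h: "integrable lborel h"
  proof -
    have "integrable lborel (\<lambda>\<xi>. of_real (exp (- (\<nu> * \<xi>\<^sup>2))) * g \<xi>)"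
      by (intro l2_mult_integrable gaussian_l2 \<nu> g) auto
    then have "integrable lborel (\<lambda>\<xi>. cis ((x - \<theta> * t) * \<xi> + t * \<bar>\<xi>\<bar> powr m) * (of_real (exp (- (\<nu> * \<xi>\<^sup>2))) * g \<xi>))"
      by (rule integrable_cis_mult) simp
    then show ?thesis unfolding h_def by (simp add: mult.assoc)
  qed
  have piece: "(LINT \<xi>:dyadic j|lborel. h (\<sigma> * \<xi>)) = osc_int m \<sigma> (freq_piece g j \<sigma>) (t, \<theta>, \<nu>) x"
    if \<sigma>: "\<sigma> \<in> {1, -1}" for j \<sigma>
    unfolding set_lebesgue_integral_def osc_int_def
  proof (intro Bochner_Integration.integral_cong refl)
    fix \<xi>
    show "indicator (dyadic j) \<xi> *\<^sub>R h (\<sigma> * \<xi>) = osc m \<sigma> (t, \<theta>, \<nu>) x \<xi> * freq_piece g j \<sigma> \<xi>"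
    proof (cases "\<xi> \<in> dyadic j")
      case True
      have "\<bar>\<sigma> * \<xi>\<bar> = \<xi>" "(\<sigma> * \<xi>)\<^sup>2 = \<xi>\<^sup>2" using dyadic_pos[OF True] \<sigma> by auto
      then have "h (\<sigma> * \<xi>) = cis (\<sigma> * (x - \<theta> * t) * \<xi> + t * \<xi> powr m) * of_real (exp (- (\<nu> * \<xi>\<^sup>2))) * g (\<sigma> * \<xi>)"
        unfolding h_def by (simp add: mult_ac)
      then show ?thesis using True by (simp add: osc_def freq_piece_def)
    qed (simp add: freq_piece_def)
  qed
  have le': "norm (LINT \<xi>:dyadic j|lborel. h (\<sigma> * \<xi>)) \<le> z powr (1/4) * c ^ j" if \<sigma>: "\<sigma> \<in> {1, -1}" for j \<sigma>
  proof (rule power_le_imp_le_base)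
    have "norm (LINT \<xi>:dyadic j|lborel. h (\<sigma> * \<xi>)) ^ 4 \<le> z * c ^ (4 * j)" unfolding piece[OF \<sigma>] by (rule le[OF \<sigma>])
    also have "z * c ^ (4 * j) = (z powr (1/4) * c ^ j) ^ 4"
    proof -
      have "(z powr (1/4)) ^ 4 = z" using z by (simp add: powr_powr flip: powr_numeral)
      then show ?thesis by (simp add: power_mult_distrib power_mult[symmetric] mult.commute)
    qed
    finally show "norm (LINT \<xi>:dyadic j|lborel. h (\<sigma> * \<xi>)) ^ Suc 3 \<le> (z powr (1/4) * c ^ j) ^ Suc 3" by simp
    show "0 \<le> z powr (1/4) * c ^ j" using c by simp
  qed
  have "norm (LINT \<xi>:{0<..}|lborel. h \<xi>) \<le> z powr (1/4) / (1 - c)"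
    by (rule half_line_dyadic_bound[OF h]) (use c le'[of 1] in auto)
  moreover have "norm (LINT \<xi>:{0<..}|lborel. h (- \<xi>)) \<le> z powr (1/4) / (1 - c)"
  proof (rule half_line_dyadic_bound)
    show "integrable lborel (\<lambda>\<xi>. h (- \<xi>))" using lborel_integrable_real_affine[OF h, of "-1" 0] by simp
  qed (use c le'[of "-1"] in auto)
  ultimately have "norm ((LINT \<xi>:{0<..}|lborel. h \<xi>) + (LINT \<xi>:{0<..}|lborel. h (- \<xi>))) \<le> z powr (1/4) / (1 - c) + z powr (1/4) / (1 - c)"
    by (rule norm_triangle_mono)
  then show ?thesis unfolding integral_split_sign[OF h, symmetric] unfolding h_def by simp
qed

subsection \<open>The maximal estimate\<close>

text \<open>The bound on the regularised integrals is uniform in \<open>N\<close> and hence passes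
  to every limit that exists. For this \<open>le\<close> has to hold for all widths. The factor 2
  from the two half-lines is outweighed by the prefactor 1 / (2 pi).\<close>

lemma maximal_fun_pointwise:
  fixes f :: distr and z :: real
  defines "g \<equiv> distr_fun (distr_fourier f)"
  assumes g [measurable]: "g \<in> borel_measurable borel" and fin: "l2sq g < \<infinity>"
    and c: "0 < c" "c < 1" and z: "z \<ge> 0"
    and le: "\<And>j \<sigma> p. \<sigma> \<in> {1, -1} \<Longrightarrow> p \<in> {0<..<1} \<times> \<Theta> \<times> {0..} \<Longrightarrow>
       norm (osc_int m \<sigma> (freq_piece g j \<sigma>) p x) ^ 4 \<le> z * c ^ (4 * j)"
  shows "maximal_fun m \<Theta> f x ^ 4 \<le> ennreal (z / (1 - c) ^ 4)"
proof -
  define b where "b = z powr (1/4) / (1 - c)"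
  have b: "b \<ge> 0" using c by (simp add: b_def)
  have "(z powr (1/4)) ^ 4 = z" using z by (simp add: powr_powr flip: powr_numeral)
  then have b4: "b ^ 4 = z / (1 - c) ^ 4" by (simp add: b_def power_divide)
  have "maximal_fun m \<Theta> f x \<le> ennreal b"
    unfolding maximal_fun_def
  proof (rule SUP_least, clarify)
    fix t \<theta> assume t: "t \<in> {0<..<1}" and \<theta>: "\<theta> \<in> \<Theta>" and d: "evolution_defined m f (x - \<theta> * t) t"
    have lim: "(\<lambda>N. evolution_reg m f N (x - \<theta> * t) t) \<longlonglongrightarrow> evolution m f (x - \<theta> * t) t"
      using d unfolding evolution_defined_def evolution_def by (simp add: convergent_LIMSEQ_iff)
    \<comment> \<open>The index 0 is left out: there the division convention turns the Gaussian
      factor into 1.\<close>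
    have "norm (evolution_reg m f N (x - \<theta> * t) t) \<le> b" if N: "N \<ge> 1" for N
    proof -
      define \<nu> where "\<nu> = 1 / (real N)\<^sup>2"
      have \<nu>: "\<nu> > 0" using N by (simp add: \<nu>_def)
      define I where "I = (LINT \<xi>|lborel. cis ((x - \<theta> * t) * \<xi> + t * \<bar>\<xi>\<bar> powr m) * of_real (exp (- (\<nu> * \<xi>\<^sup>2))) * g \<xi>)"
      have I: "norm I \<le> 2 * z powr (1/4) / (1 - c)"
        unfolding I_def by (rule evolution_reg_bound[OF g fin \<nu> c z]) (rule le, use t \<theta> \<nu> in auto)
      have eq: "evolution_reg m f N (x - \<theta> * t) t = of_real (1 / (2 * pi)) * I"
        unfolding evolution_reg_def g_def \<nu>_def I_def by simp
      have "norm (evolution_reg m f N (x - \<theta> * t) t) = 1 / (2 * pi) * norm I"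
        unfolding eq norm_mult norm_of_real by simp
      also have "\<dots> \<le> 1 / (2 * pi) * (2 * z powr (1/4) / (1 - c))"
        by (intro mult_left_mono I) simp
      also have "\<dots> = (1 / pi) * b" by (simp add: b_def)
      also have "\<dots> \<le> 1 * b" using b pi_gt3 by (intro mult_right_mono) auto
      finally show ?thesis by simp
    qed
    then have "norm (evolution m f (x - \<theta> * t) t) \<le> b"
      by (intro LIMSEQ_le_const2[OF tendsto_norm[OF lim]]) blast
    then show "ennreal (norm (evolution m f (x - \<theta> * t) t)) \<le> ennreal b" by (rule ennreal_leI)
  qed
  then have "maximal_fun m \<Theta> f x ^ 4 \<le> ennreal b ^ 4" by (rule power_mono) simp
  also have "\<dots> = ennreal (z / (1 - c) ^ 4)" unfolding ennreal_power[OF b] b4 ..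
  finally show ?thesis .
qed

text \<open>A supremum of fourth powers over the cover and both signs is at most their sum. Thus the
  covering number enters to the first power at the level of fourth powers, and the signs give the
  factor 2.\<close>

lemma dyadic_piece_total:
  fixes m M s :: real and \<Theta> :: "real set" and g :: "real \<Rightarrow> complex"
  assumes m: "0 < m" "m < 1" and M: "M \<ge> 1" "\<Theta> \<subseteq> {-M..M}" and s: "s \<ge> 0"
    and [measurable]: "g \<in> borel_measurable borel"
    and W: "(\<integral>\<^sup>+\<xi>. ennreal (bessel_weight s \<xi> * (norm (g \<xi>))\<^sup>2) \<partial>lborel) \<le> ennreal W" "W \<ge> 0"
  obtains Q where "Q \<in> borel_measurable borel"
    "\<And>x p \<sigma>. \<sigma> \<in> {1, -1} \<Longrightarrow> p \<in> {0<..<1} \<times> \<Theta> \<times> {0..} \<Longrightarrow>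
       ennreal (norm (osc_int m \<sigma> (freq_piece g j \<sigma>) p x) ^ 4) \<le> Q x"
    "(\<integral>\<^sup>+x\<in>{0<..<1}. Q x \<partial>lborel) \<le> ennreal (2 * real (covering_number \<Theta> ((2 ^ j) powr (- m))) *
        dyadic_const m M j * (4 powr s * (2 ^ j) powr (- (2 * s)) * W)\<^sup>2)"
proof -
  define \<delta> where "\<delta> = (2 ^ j :: real) powr (- m)"
  define V where "V = 4 powr s * (2 ^ j) powr (- (2 * s)) * W"
  have \<delta>: "\<delta> > 0" by (simp add: \<delta>_def)
  have V0: "V \<ge> 0" using W by (simp add: V_def)
  have dc: "dyadic_const m M j \<ge> 0"
    unfolding dyadic_const_def using m M by (intro mult_nonneg_nonneg ln_ge_zero) auto
  obtain B where B: "finite B" "card B = covering_number \<Theta> \<delta>" "\<Theta> \<subseteq> (\<Union>a\<in>B. {a..a + \<delta>})"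
  proof (rule covering_number_attained)
    show "finite ((\<lambda>i. - M + real i * \<delta>) ` {..nat \<lfloor>(M - - M) / \<delta>\<rfloor>})" by simp
    show "\<Theta> \<subseteq> (\<Union>c\<in>(\<lambda>i. - M + real i * \<delta>) ` {..nat \<lfloor>(M - - M) / \<delta>\<rfloor>}. {c..c + \<delta>})"
      using M(2) interval_cover[OF \<delta>, of "- M" M] by (rule order_trans)
  qed blast
  define S :: "real set" where "S = {1, -1}"
  have l2: "l2sq (freq_piece g j \<sigma>) \<le> ennreal V" if "\<sigma> \<in> S" for \<sigma>
  proof -
    have "l2sq (freq_piece g j \<sigma>) \<le> ennreal (4 powr s * (2 ^ j) powr (- (2 * s))) * (\<integral>\<^sup>+\<xi>. ennreal (bessel_weight s \<xi> * (norm (g \<xi>))\<^sup>2) \<partial>lborel)"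
      by (rule freq_piece_l2) (use s that in \<open>auto simp: S_def\<close>)
    also have "\<dots> \<le> ennreal (4 powr s * (2 ^ j) powr (- (2 * s))) * ennreal W" by (intro mult_left_mono W) auto
    also have "\<dots> = ennreal V" unfolding V_def using W by (intro ennreal_mult[symmetric]) auto
    finally show ?thesis .
  qed
  define good where "good = (\<lambda>\<sigma> a Q. Q \<in> borel_measurable borel \<and>
     (\<forall>x p. p \<in> {0<..<1} \<times> (\<Theta> \<inter> {a..a + \<delta>}) \<times> {0..} \<longrightarrow> ennreal (norm (osc_int m \<sigma> (freq_piece g j \<sigma>) p x) ^ 4) \<le> Q x) \<and>
     (\<integral>\<^sup>+x\<in>{0<..<1}. Q x \<partial>lborel) \<le> ennreal (dyadic_const m M j * V\<^sup>2))"
  have ex: "\<exists>Q. good \<sigma> a Q" if \<sigma>: "\<sigma> \<in> S" for \<sigma> a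
  proof -
    have i: "integrable lborel (freq_piece g j \<sigma>)"
      by (rule freq_piece_integrable) (use le_less_trans[OF l2[OF \<sigma>] ennreal_less_top] in auto)
    have \<Theta>1: "\<Theta> \<inter> {a..a + \<delta>} \<subseteq> {a..a + (2 ^ j) powr (- m)}" by (auto simp: \<delta>_def)
    have \<Theta>2: "\<bar>\<theta>\<bar> \<le> M" if "\<theta> \<in> \<Theta> \<inter> {a..a + \<delta>}" for \<theta> using that M(2) by (auto simp: abs_le_iff)
    have \<sigma>1: "\<bar>\<sigma>\<bar> = 1" using \<sigma> by (auto simp: S_def)
    have z: "freq_piece g j \<sigma> \<xi> = 0" if "\<xi> \<notin> dyadic j" for \<xi> using that by (simp add: freq_piece_def)
    obtain Q where Q: "Q \<in> borel_measurable borel"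
      "\<And>x p. p \<in> {0<..<1} \<times> (\<Theta> \<inter> {a..a + \<delta>}) \<times> {0..} \<Longrightarrow> ennreal (norm (osc_int m \<sigma> (freq_piece g j \<sigma>) p x) ^ 4) \<le> Q x"
      "(\<integral>\<^sup>+x\<in>{0<..<1}. Q x \<partial>lborel) \<le> ennreal (dyadic_const m M j) * (l2sq (freq_piece g j \<sigma>))\<^sup>2"
      by (rule dyadic_maximal_bound[OF m M(1) \<sigma>1 \<Theta>1 \<Theta>2 i z]) blast+
    have "ennreal (dyadic_const m M j) * (l2sq (freq_piece g j \<sigma>))\<^sup>2 \<le> ennreal (dyadic_const m M j) * (ennreal V)\<^sup>2"
      by (intro mult_left_mono power_mono l2 \<sigma>) auto
    also have "\<dots> = ennreal (dyadic_const m M j * V\<^sup>2)"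
      using dc V0 by (subst ennreal_mult) (auto simp: ennreal_power)
    finally have "(\<integral>\<^sup>+x\<in>{0<..<1}. Q x \<partial>lborel) \<le> ennreal (dyadic_const m M j * V\<^sup>2)"
      by (rule order_trans[OF Q(3)])
    then show ?thesis unfolding good_def using Q(1,2) by blast
  qed
  define Q where "Q = (\<lambda>\<sigma> a. SOME Q. good \<sigma> a Q)"
  have "good \<sigma> a (Q \<sigma> a)" if "\<sigma> \<in> S" for \<sigma> a
    unfolding Q_def by (rule someI_ex[OF ex[OF that]])
  then have Q: "\<And>\<sigma> a. \<sigma> \<in> S \<Longrightarrow> Q \<sigma> a \<in> borel_measurable borel"
    "\<And>\<sigma> a x p. \<sigma> \<in> S \<Longrightarrow> p \<in> {0<..<1} \<times> (\<Theta> \<inter> {a..a + \<delta>}) \<times> {0..} \<Longrightarrow>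
       ennreal (norm (osc_int m \<sigma> (freq_piece g j \<sigma>) p x) ^ 4) \<le> Q \<sigma> a x"
    "\<And>\<sigma> a. \<sigma> \<in> S \<Longrightarrow> (\<integral>\<^sup>+x\<in>{0<..<1}. Q \<sigma> a x \<partial>lborel) \<le> ennreal (dyadic_const m M j * V\<^sup>2)"
    unfolding good_def by blast+
  define T where "T = (\<lambda>x. \<Sum>\<sigma>\<in>S. \<Sum>a\<in>B. Q \<sigma> a x)"
  have finS: "finite S" "card S = 2" by (simp_all add: S_def)
  show thesis
  proof (rule that[of T])
    show "T \<in> borel_measurable borel" unfolding T_def using Q(1) by (intro borel_measurable_sum) auto
  next
    fix x \<sigma> :: real and p :: "real \<times> real \<times> real" assume \<sigma>: "\<sigma> \<in> {1, - 1}" and p: "p \<in> {0<..<1} \<times> \<Theta> \<times> {0..}"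
    have "\<sigma> \<in> S" using \<sigma> by (simp add: S_def)
    obtain t \<theta> \<nu> where p_eq: "p = (t, \<theta>, \<nu>)" by (cases p)
    then obtain a where a: "a \<in> B" "\<theta> \<in> {a..a + \<delta>}" using p B(3) by auto
    have "ennreal (norm (osc_int m \<sigma> (freq_piece g j \<sigma>) p x) ^ 4) \<le> Q \<sigma> a x"
      using p a by (intro Q(2) \<open>\<sigma> \<in> S\<close>) (auto simp: p_eq)
    also have "\<dots> \<le> (\<Sum>a\<in>B. Q \<sigma> a x)" using a B by (intro member_le_sum) auto
    also have "\<dots> \<le> T x" unfolding T_def using \<open>\<sigma> \<in> S\<close> finS by (intro member_le_sum[of \<sigma> S "\<lambda>\<sigma>. \<Sum>a\<in>B. Q \<sigma> a x"]) auto
    finally show "ennreal (norm (osc_int m \<sigma> (freq_piece g j \<sigma>) p x) ^ 4) \<le> T x" .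
  next
    have "(\<integral>\<^sup>+x\<in>{0<..<1}. T x \<partial>lborel) = (\<Sum>\<sigma>\<in>S. \<Sum>a\<in>B. \<integral>\<^sup>+x\<in>{0<..<1}. Q \<sigma> a x \<partial>lborel)"
    proof -
      have "(\<integral>\<^sup>+x\<in>{0<..<1}. T x \<partial>lborel) = (\<integral>\<^sup>+x. (\<Sum>\<sigma>\<in>S. \<Sum>a\<in>B. Q \<sigma> a x * indicator {0<..<1} x) \<partial>lborel)"
        by (simp add: T_def sum_distrib_right)
      also have "\<dots> = (\<Sum>\<sigma>\<in>S. \<integral>\<^sup>+x. (\<Sum>a\<in>B. Q \<sigma> a x * indicator {0<..<1} x) \<partial>lborel)"
        using Q(1) by (intro nn_integral_sum borel_measurable_sum borel_measurable_times_ennreal) auto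
      also have "\<dots> = (\<Sum>\<sigma>\<in>S. \<Sum>a\<in>B. \<integral>\<^sup>+x\<in>{0<..<1}. Q \<sigma> a x \<partial>lborel)"
        using Q(1) by (intro sum.cong refl nn_integral_sum borel_measurable_times_ennreal) auto
      finally show ?thesis .
    qed
    also have "\<dots> \<le> (\<Sum>\<sigma>\<in>S. \<Sum>a\<in>B. ennreal (dyadic_const m M j * V\<^sup>2))"
      by (intro sum_mono Q(3))
    also have "\<dots> = ennreal (2 * real (covering_number \<Theta> \<delta>) * (dyadic_const m M j * V\<^sup>2))"
      using dc V0 finS B(2) by (simp add: ennreal_of_nat_eq_real_of_nat flip: ennreal_mult ennreal_numeral)
    also have "2 * real (covering_number \<Theta> \<delta>) * (dyadic_const m M j * V\<^sup>2) = 2 * real (covering_number \<Theta> \<delta>) * dyadic_const m M j * V\<^sup>2" by simp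
    finally show "(\<integral>\<^sup>+x\<in>{0<..<1}. T x \<partial>lborel) \<le> ennreal (2 * real (covering_number \<Theta> ((2 ^ j) powr (- m))) *
        dyadic_const m M j * (4 powr s * (2 ^ j) powr (- (2 * s)) * W)\<^sup>2)"
      unfolding \<delta>_def V_def .
  qed
qed

theorem maximal_estimate_compact:
  fixes m \<beta> s :: real
  assumes m: "0 < m" "m < 1" and \<Theta>: "compact \<Theta>"
    and dim: "upper_minkowski_dim \<Theta> = ereal \<beta>" "0 \<le> \<beta>" "\<beta> \<le> 1"
    and s: "s > 1 / 2 - m / 4 + m * \<beta> / 4"
  shows "\<exists>C>0. maximal_estimate m \<Theta> s C"
proof -
  \<comment> \<open>\<open>\<kappa>\<close> is four times the distance of \<open>s\<close> to the
    threshold. A quarter of it is spent on the covering number and a quarter on the logarithm; since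
    m < 1 the total exponent is still at most -\<kappa> / 2.\<close>
  define \<kappa> where "\<kappa> = 4 * s - 2 + m - m * \<beta>"
  have \<kappa>: "\<kappa> > 0" using s by (simp add: \<kappa>_def field_simps)
  \<comment> \<open>The threshold is positive, so \<open>s\<close> is nonnegative; the Sobolev
    weight is then at least 1, which puts the transform of the data in \<open>L^2\<close> and
    permits the lower weight bound on blocks.\<close>
  have "m * \<beta> \<ge> 0" using m dim by simp
  then have s0: "s \<ge> 0" using s m by linarith
  obtain M0 where "\<And>x. x \<in> \<Theta> \<Longrightarrow> norm x \<le> M0" using compact_imp_bounded[OF \<Theta>] unfolding bounded_iff by blast
  then have M: "max 1 M0 \<ge> 1" "\<Theta> \<subseteq> {- max 1 M0..max 1 M0}" by (auto simp: abs_le_iff max_def) (smt (verit) abs_le_iff real_norm_def)+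
  define M where "M = max 1 M0"
  note M = M[folded M_def]
  obtain K1 where K1: "K1 \<ge> 0" "\<And>j::nat. real (covering_number \<Theta> ((2 ^ j) powr (- m))) \<le> K1 * (2 ^ j) powr (m * (\<beta> + \<kappa> / 4))"
    using covering_number_growth[OF dim(1,2), of "\<kappa> / 4" m] \<kappa> m by auto
  define K2 where "K2 = 2 * (1152 * M / (m * (1 - m))) * (2 powr (\<kappa> / 4) / (\<kappa> / 4))"
  have K2: "K2 \<ge> 0" "\<And>j. dyadic_const m M j \<le> K2 * (2 ^ j) powr (2 - m + \<kappa> / 4)"
    using dyadic_const_growth[OF m M(1), of "\<kappa> / 4"] m M \<kappa> unfolding K2_def by auto
  define K3 where "K3 = 2 * K1 * K2 * (4 powr s)\<^sup>2 * (2 * pi)\<^sup>2"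
  have K3: "K3 \<ge> 0" using K1 K2 by (simp add: K3_def)
  define c where "c = 2 powr (- (\<kappa> / 16))"
  have c: "0 < c" "c < 1" using \<kappa> by (auto simp: c_def powr_less_one)
  define r where "r = 2 powr (- (\<kappa> / 4))"
  have r: "0 < r" "r < 1" using \<kappa> by (auto simp: r_def powr_less_one)
  define L where "L = K3 / (1 - r) / (1 - c) ^ 4"
  have L: "L \<ge> 0" using K3 r c by (simp add: L_def)
  have growth: "2 * real (covering_number \<Theta> ((2 ^ j) powr (- m))) * dyadic_const m M j * (4 powr s * (2 ^ j) powr (- (2 * s)) * (2 * pi * A\<^sup>2))\<^sup>2
      \<le> K3 * A ^ 4 * r ^ j * c ^ (4 * j)" for j A
  proof -
    define R :: real where "R = 2 ^ j"
    have R: "R \<ge> 1" by (simp add: R_def)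
    have dc: "dyadic_const m M j \<ge> 0"
      unfolding dyadic_const_def using m M by (intro mult_nonneg_nonneg ln_ge_zero) auto
    have "2 * real (covering_number \<Theta> (R powr (- m))) * dyadic_const m M j * (4 powr s * R powr (- (2 * s)) * (2 * pi * A\<^sup>2))\<^sup>2
      \<le> 2 * (K1 * R powr (m * (\<beta> + \<kappa> / 4))) * (K2 * R powr (2 - m + \<kappa> / 4)) * (4 powr s * R powr (- (2 * s)) * (2 * pi * A\<^sup>2))\<^sup>2"
      using K1 K2 dc unfolding R_def by (intro mult_right_mono mult_mono mult_nonneg_nonneg) auto
    also have "\<dots> = K3 * A ^ 4 * (R powr (m * (\<beta> + \<kappa> / 4)) * R powr (2 - m + \<kappa> / 4) * (R powr (- (2 * s)))\<^sup>2)"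
      by (simp add: K3_def power_mult_distrib mult_ac flip: power_mult)
    also have "R powr (m * (\<beta> + \<kappa> / 4)) * R powr (2 - m + \<kappa> / 4) * (R powr (- (2 * s)))\<^sup>2 = R powr (m * (\<beta> + \<kappa> / 4) + (2 - m + \<kappa> / 4) + (- (2 * s) + - (2 * s)))"
      by (simp only: powr_add power2_eq_square)
    also have "K3 * A ^ 4 * \<dots> \<le> K3 * A ^ 4 * R powr (- (\<kappa> / 2))"
    proof (intro mult_left_mono powr_mono R)
      have "m * \<kappa> \<le> 1 * \<kappa>" using m \<kappa> by (intro mult_right_mono) auto
      then show "m * (\<beta> + \<kappa> / 4) + (2 - m + \<kappa> / 4) + (- (2 * s) + - (2 * s)) \<le> - (\<kappa> / 2)"
      proof -
        assume "m * \<kappa> \<le> 1 * \<kappa>"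
        moreover have "m * (\<beta> + \<kappa> / 4) = m * \<beta> + m * \<kappa> / 4" by (simp add: distrib_left)
        moreover have "m * \<beta> = 4 * s - 2 + m - \<kappa>" by (simp add: \<kappa>_def)
        ultimately show ?thesis by linarith
      qed
    qed (use K3 in simp)
    \<comment> \<open>The remaining decay is divided evenly: r^j makes the integrals of the
      majorants summable, and c^(4j), a fourth power, makes the pieces summable at each
      point.\<close>
    also have "R powr (- (\<kappa> / 2)) = r ^ j * c ^ (4 * j)"
    proof -
      have "R powr (- (\<kappa> / 2)) = 2 powr (real j * (- (\<kappa> / 2)))"
        unfolding R_def by (simp add: powr_powr mult.commute flip: powr_realpow)
      also have "\<dots> = 2 powr (real j * (- (\<kappa> / 4)) + real (4 * j) * (- (\<kappa> / 16)))" by (simp add: algebra_simps)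
      also have "\<dots> = r ^ j * c ^ (4 * j)"
        unfolding r_def c_def powr_add by (simp add: powr_power mult.commute)
      finally show ?thesis .
    qed
    finally show ?thesis unfolding R_def by (simp only: mult.assoc)
  qed
  \<comment> \<open>The added 1 keeps the constant strictly positive even if \<open>L\<close> is
    0.\<close>
  have "maximal_estimate m \<Theta> s (L powr (1/4) + 1)"
    unfolding maximal_estimate_def
  proof
    fix f assume f: "f \<in> sobolev s"
    define A where "A = sobolev_norm s f"
    have A: "A \<ge> 0" unfolding A_def by (rule sobolev_norm_nonneg)
    define g where "g = distr_fun (distr_fourier f)"
    have [measurable]: "g \<in> borel_measurable borel" unfolding g_def by (rule sobolev_fourier(1)[OF f])
    have W: "(\<integral>\<^sup>+\<xi>. ennreal (bessel_weight s \<xi> * (norm (g \<xi>))\<^sup>2) \<partial>lborel) \<le> ennreal (2 * pi * A\<^sup>2)"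
      unfolding g_def A_def by (rule sobolev_fourier(2)[OF f])
    have g_fin: "l2sq g < \<infinity>"
    proof -
      have "l2sq g \<le> (\<integral>\<^sup>+\<xi>. ennreal (bessel_weight s \<xi> * (norm (g \<xi>))\<^sup>2) \<partial>lborel)"
      proof (intro nn_integral_mono ennreal_leI)
        fix \<xi>
        have "1 \<le> bessel_weight s \<xi>" using s0 by (intro ge_one_powr_ge_zero) auto
        from mult_right_mono[OF this, of "(norm (g \<xi>))\<^sup>2"] show "(norm (g \<xi>))\<^sup>2 \<le> bessel_weight s \<xi> * (norm (g \<xi>))\<^sup>2" by simp
      qed
      also have "\<dots> < \<infinity>" using le_less_trans[OF W ennreal_less_top] by simp
      finally show ?thesis .
    qed
    define good where "good = (\<lambda>j Q. Q \<in> borel_measurable borel \<and>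
      (\<forall>x p. \<forall>\<sigma>\<in>{1, -1}. p \<in> {0<..<1} \<times> \<Theta> \<times> {0..} \<longrightarrow> ennreal (norm (osc_int m \<sigma> (freq_piece g j \<sigma>) p x) ^ 4) \<le> Q x) \<and>
      (\<integral>\<^sup>+x\<in>{0<..<1}. Q x \<partial>lborel) \<le> ennreal (K3 * A ^ 4 * r ^ j * c ^ (4 * j)))"
    have ex: "\<exists>Q. good j Q" for j
    proof -
      obtain Q where Q: "Q \<in> borel_measurable borel"
        "\<And>x p \<sigma>. \<sigma> \<in> {1, -1} \<Longrightarrow> p \<in> {0<..<1} \<times> \<Theta> \<times> {0..} \<Longrightarrow>
           ennreal (norm (osc_int m \<sigma> (freq_piece g j \<sigma>) p x) ^ 4) \<le> Q x"
        "(\<integral>\<^sup>+x\<in>{0<..<1}. Q x \<partial>lborel) \<le> ennreal (2 * real (covering_number \<Theta> ((2 ^ j) powr (- m))) *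
            dyadic_const m M j * (4 powr s * (2 ^ j) powr (- (2 * s)) * (2 * pi * A\<^sup>2))\<^sup>2)"
        using dyadic_piece_total[OF m M s0 _ W, of j] by auto
      show ?thesis unfolding good_def using Q(1,2) order_trans[OF Q(3) ennreal_leI[OF growth]] by blast
    qed
    define Q where "Q = (\<lambda>j. SOME Q. good j Q)"
    have "good j (Q j)" for j
      unfolding Q_def by (rule someI_ex[OF ex])
    then have [measurable]: "\<And>j. Q j \<in> borel_measurable borel" and
      Q: "\<And>j x p \<sigma>. \<sigma> \<in> {1, -1} \<Longrightarrow> p \<in> {0<..<1} \<times> \<Theta> \<times> {0..} \<Longrightarrow>
           ennreal (norm (osc_int m \<sigma> (freq_piece g j \<sigma>) p x) ^ 4) \<le> Q j x"
      and QI: "\<And>j. (\<integral>\<^sup>+x\<in>{0<..<1}. Q j x \<partial>lborel) \<le> ennreal (K3 * A ^ 4 * r ^ j * c ^ (4 * j))"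
      unfolding good_def by blast+
    \<comment> \<open>One function that controls all blocks simultaneously: where it is finite, the
      fourth power of each piece is at most Z c^(4j); where it is infinite, the pointwise bound is
      trivial.\<close>
    define Z where "Z = (\<lambda>x. \<Sum>j. ennreal (1 / c ^ (4 * j)) * Q j x)"
    have [measurable]: "Z \<in> borel_measurable borel" unfolding Z_def by measurable
    have pw: "maximal_fun m \<Theta> f x ^ 4 \<le> ennreal (1 / (1 - c) ^ 4) * Z x" for x
    proof (cases "Z x")
      case top
      then show ?thesis using c by (simp add: ennreal_mult_top)
    next
      case (real z)
      have "norm (osc_int m \<sigma> (freq_piece g j \<sigma>) p x) ^ 4 \<le> z * c ^ (4 * j)"
        if "\<sigma> \<in> {1, -1}" "p \<in> {0<..<1} \<times> \<Theta> \<times> {0..}" for j \<sigma> p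
      proof -
        have "ennreal (1 / c ^ (4 * j) * norm (osc_int m \<sigma> (freq_piece g j \<sigma>) p x) ^ 4) = ennreal (1 / c ^ (4 * j)) * ennreal (norm (osc_int m \<sigma> (freq_piece g j \<sigma>) p x) ^ 4)"
          using c by (intro ennreal_mult) auto
        also have "\<dots> \<le> ennreal (1 / c ^ (4 * j)) * Q j x" by (intro mult_left_mono Q that) auto
        also have "\<dots> = (\<Sum>j\<in>{j}. ennreal (1 / c ^ (4 * j)) * Q j x)" by simp
        also have "\<dots> \<le> Z x" unfolding Z_def by (intro sum_le_suminf summableI) auto
        finally have "1 / c ^ (4 * j) * norm (osc_int m \<sigma> (freq_piece g j \<sigma>) p x) ^ 4 \<le> z"
          using real by (simp only: ennreal_le_iff)
        then show ?thesis using c by (simp add: pos_divide_le_eq)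
      qed
      then have "maximal_fun m \<Theta> f x ^ 4 \<le> ennreal (z / (1 - c) ^ 4)"
        using g_fin c real unfolding g_def by (intro maximal_fun_pointwise) (auto simp: sobolev_fourier(1)[OF f])
      also have "\<dots> = ennreal (1 / (1 - c) ^ 4) * Z x"
        using c real by (simp flip: ennreal_mult)
      finally show ?thesis .
    qed
    have ZI: "(\<integral>\<^sup>+x\<in>{0<..<1}. Z x \<partial>lborel) \<le> ennreal (K3 * A ^ 4 / (1 - r))"
    proof -
      have "(\<integral>\<^sup>+x\<in>{0<..<1}. Z x \<partial>lborel) = (\<integral>\<^sup>+x. (\<Sum>j. ennreal (1 / c ^ (4 * j)) * (Q j x * indicator {0<..<1} x)) \<partial>lborel)"
        unfolding Z_def by (intro nn_integral_cong) (simp add: mult.assoc flip: ennreal_suminf_multc)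
      also have "\<dots> = (\<Sum>j. \<integral>\<^sup>+x. ennreal (1 / c ^ (4 * j)) * (Q j x * indicator {0<..<1} x) \<partial>lborel)"
        by (rule nn_integral_suminf) measurable
      also have "\<dots> = (\<Sum>j. ennreal (1 / c ^ (4 * j)) * (\<integral>\<^sup>+x\<in>{0<..<1}. Q j x \<partial>lborel))"
        by (intro suminf_cong nn_integral_cmult) measurable
      also have "\<dots> \<le> (\<Sum>j. ennreal (K3 * A ^ 4 * r ^ j))"
      proof (intro suminf_le summableI)
        fix j
        have "ennreal (1 / c ^ (4 * j)) * (\<integral>\<^sup>+x\<in>{0<..<1}. Q j x \<partial>lborel) \<le> ennreal (1 / c ^ (4 * j)) * ennreal (K3 * A ^ 4 * r ^ j * c ^ (4 * j))"
          by (intro mult_left_mono QI) auto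
        also have "\<dots> = ennreal (1 / c ^ (4 * j) * (K3 * A ^ 4 * r ^ j * c ^ (4 * j)))"
          using c r K3 A by (intro ennreal_mult[symmetric]) auto
        also have "1 / c ^ (4 * j) * (K3 * A ^ 4 * r ^ j * c ^ (4 * j)) = K3 * A ^ 4 * r ^ j" using c by simp
        finally show "ennreal (1 / c ^ (4 * j)) * (\<integral>\<^sup>+x\<in>{0<..<1}. Q j x \<partial>lborel) \<le> ennreal (K3 * A ^ 4 * r ^ j)" .
      qed
      also have "\<dots> = ennreal (\<Sum>j. K3 * A ^ 4 * r ^ j)"
        using r K3 A by (intro suminf_ennreal2 summable_mult summable_geometric) auto
      also have "(\<Sum>j. K3 * A ^ 4 * r ^ j) = K3 * A ^ 4 / (1 - r)"
        using r by (subst suminf_mult) (auto simp: suminf_geometric summable_geometric)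
      finally show ?thesis .
    qed
    have "(\<integral>\<^sup>+x\<in>{0<..<1}. maximal_fun m \<Theta> f x ^ 4 \<partial>lborel) \<le> (\<integral>\<^sup>+x. ennreal (1 / (1 - c) ^ 4) * (Z x * indicator {0<..<1} x) \<partial>lborel)"
      using pw by (intro nn_integral_mono) (auto simp: indicator_def)
    also have "\<dots> = ennreal (1 / (1 - c) ^ 4) * (\<integral>\<^sup>+x\<in>{0<..<1}. Z x \<partial>lborel)"
      by (rule nn_integral_cmult) measurable
    also have "\<dots> \<le> ennreal (1 / (1 - c) ^ 4) * ennreal (K3 * A ^ 4 / (1 - r))"
      by (intro mult_left_mono ZI) auto
    also have "\<dots> = ennreal (1 / (1 - c) ^ 4 * (K3 * A ^ 4 / (1 - r)))"
      using c r K3 A by (intro ennreal_mult[symmetric]) auto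
    also have "1 / (1 - c) ^ 4 * (K3 * A ^ 4 / (1 - r)) = L * A ^ 4" by (simp add: L_def)
    also have "\<dots> \<le> ((L powr (1/4) + 1) * A) ^ 4"
    proof -
      have "L = (L powr (1/4)) ^ 4" using L by (simp add: powr_powr flip: powr_numeral)
      also have "\<dots> \<le> (L powr (1/4) + 1) ^ 4" by (intro power_mono) auto
      finally show ?thesis unfolding power_mult_distrib using A by (intro mult_right_mono) auto
    qed
    finally have "(\<integral>\<^sup>+x\<in>{0<..<1}. maximal_fun m \<Theta> f x ^ 4 \<partial>lborel) \<le> ennreal (((L powr (1/4) + 1) * A) ^ 4)"
      by (simp add: ennreal_leI)
    then show "L4_norm {0<..<1} (maximal_fun m \<Theta> f) \<le> ennreal ((L powr (1/4) + 1) * sobolev_norm s f)"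
      unfolding A_def[symmetric] using A by (subst L4_norm_le_iff) auto
  qed
  moreover have "L powr (1/4) + 1 > 0" by (simp add: add_nonneg_pos)
  ultimately show ?thesis by blast
qed

text \<open>\<open>has_minkowski_dim\<close> fixes the upper dimension too, so the first part covers
  every set possessing a Minkowski dimension. For the unit interval \<beta> = 1, the two terms
  containing \<open>m\<close> cancel, and the threshold is 1/2 whatever \<open>m\<close> is.\<close>

theorem mainTheorem6:
  fixes m :: real
  assumes "0 < m" and "m < 1"
  shows "(\<forall>(\<Theta> :: real set) (\<beta> :: real) (s :: real).
            compact \<Theta> \<and> upper_minkowski_dim \<Theta> = ereal \<beta> \<and> \<beta> \<in> {0..1} \<and>
            s > 1 / 2 - m / 4 + m * \<beta> / 4 \<longrightarrow>
            (\<exists>C>0. maximal_estimate m \<Theta> s C)) \<and>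
         (\<exists>(\<Theta> :: real set) (\<beta> :: real).
            compact \<Theta> \<and> has_minkowski_dim \<Theta> \<beta> \<and>
            (\<forall>s :: real. s < 1 / 2 - m / 4 + m * \<beta> / 4 \<longrightarrow>
               \<not> (\<exists>C. maximal_estimate m \<Theta> s C)))"
proof
  show "\<forall>(\<Theta> :: real set) (\<beta> :: real) (s :: real).
            compact \<Theta> \<and> upper_minkowski_dim \<Theta> = ereal \<beta> \<and> \<beta> \<in> {0..1} \<and>
            s > 1 / 2 - m / 4 + m * \<beta> / 4 \<longrightarrow>
            (\<exists>C>0. maximal_estimate m \<Theta> s C)"
    using maximal_estimate_compact[OF assms] by auto
  show "\<exists>(\<Theta> :: real set) (\<beta> :: real).
            compact \<Theta> \<and> has_minkowski_dim \<Theta> \<beta> \<and>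
            (\<forall>s :: real. s < 1 / 2 - m / 4 + m * \<beta> / 4 \<longrightarrow>
               \<not> (\<exists>C. maximal_estimate m \<Theta> s C))"
    using has_minkowski_dim_unit_interval no_maximal_estimate_unit_interval
    by (intro exI[of _ "{0..1}"] exI[of _ 1]) auto
qed

end
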